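(* Let $\mu$ be a Borel probability measure on $\Omega$ which is invariant and ergodic under $(\tau_x)_{x\in\mathbb R^d}$ and satisfies $\mu(\Omega_{\mathfrak r})=1$ for some $\mathfrak r>0$. Then there exist a sequence $(\omega_n)_{n\in\mathbb N}\subset\Omega_{\mathfrak r}$ and an increasing sequence of positive numbers $(M_n)_{n\in\mathbb N}$ with $M_n\to\infty$ such that: (1) each $\omega_n$ is $M_n$-periodic in each variable, i.e. $\tau_{M_n e_i}\omega_n=\omega_n$ for all $n$ and $i=1,\dots,d$ ($e_i$ the canonical basis); (2) the probability measures on $(\Omega_{\mathfrak r},\mathcal B(\Omega_{\mathfrak r}))$ $$\mu_n(A):=\frac1{M_n^d}\int_{[-M_n/2,M_n/2]^d}\mathbf 1_A(\tau_y\omega_n)\,dy$$ converge weakly to $\mu$, i.e. $\lim_{n\to\infty}\int_{\Omega_{\mathfrak r}}F\,d\mu_n=\int_{\Omega_{\mathfrak r}}F\,d\mu$ for every bounded $\mathrm d_{\mathfrak r}$-continuous $F:\Omega_{\mathfrak r}\to\mathbb R$.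
   Context: Fix $d\ge1$, $\lambda,\Lambda>0$. $\mathcal S_d^+$ is the set of symmetric non-negative definite real $d\times d$ matrices, $\|a\|=\sum_{i,j}|a_{ij}|$. $\Omega$ is the set of continuous $\omega:\mathbb R^d\to\mathcal S_d^+$ with $\|\omega(x)\|\le\Lambda$, $\operatorname{Tr}\omega(x)\ge\lambda$, with the topology of locally uniform convergence and its Borel $\sigma$-field; $\tau_x\omega(y)=\omega(x+y)$. For $\mathfrak r>0$, $\Omega_{\mathfrak r}$ is the set of $\omega\in\Omega$ that are continuously differentiable and satisfy $\omega(x)-\mathfrak r I_d\in\mathcal S_d^+$ for all $x$, with the Polish metric $\mathrm d_{\mathfrak r}(\omega_1,\omega_2)=\sum_{K\ge1}2^{-K}\frac{\|\omega_1-\omega_2\|_{1,\infty,K}}{1+\|\omega_1-\omega_2\|_{1,\infty,K}}$, $\|\omega\|_{1,\infty,K}=\sup_{|x|\le K}|\omega(x)|+\sup_{|x|\le K}|\nabla\omega(x)|$; $\Omega_{\mathfrak r}$ is a Borel subset of $\Omega$ and is $\tau$-invariant. *)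

theory Defs
  imports "HOL-Analysis.Analysis" "HOL-Probability.Probability"
begin

type_synonym ('d) env = "real^'d \<Rightarrow> real^'d^'d"

definition l1norm :: "real^'d^'d \<Rightarrow> real" where
  "l1norm a = (\<Sum>i\<in>UNIV. \<Sum>j\<in>UNIV. \<bar>a $ i $ j\<bar>)"

definition mtrace :: "real^'d^'d \<Rightarrow> real" where
  "mtrace a = (\<Sum>i\<in>UNIV. a $ i $ i)"

definition psd :: "real^'d^'d \<Rightarrow> bool" where
  "psd a \<longleftrightarrow> transpose a = a \<and> (\<forall>v. 0 \<le> v \<bullet> (a *v v))"

definition shift :: "real^'d \<Rightarrow> ('d::finite) env \<Rightarrow> ('d::finite) env" where
  "shift x \<omega> = (\<lambda>y. \<omega> (x + y))"

definition OmegaSet :: "real \<Rightarrow> real \<Rightarrow> ('d::finite) env set" where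
  "OmegaSet lam Lam = {\<omega>. continuous_on UNIV \<omega> \<and>
      (\<forall>x. psd (\<omega> x) \<and> l1norm (\<omega> x) \<le> Lam \<and> mtrace (\<omega> x) \<ge> lam)}"

(* open sets of the topology of locally uniform convergence on Omega *)
definition lu_open :: "real \<Rightarrow> real \<Rightarrow> ('d::finite) env set set" where
  "lu_open lam Lam = {U. U \<subseteq> OmegaSet lam Lam \<and>
      (\<forall>\<omega>\<in>U. \<exists>K>0. \<exists>\<epsilon>>0. \<forall>\<omega>'\<in>OmegaSet lam Lam.
         (\<forall>x\<in>cball 0 K. norm (\<omega>' x - \<omega> x) < \<epsilon>) \<longrightarrow> \<omega>' \<in> U)}"

definition OmegaBorel :: "real \<Rightarrow> real \<Rightarrow> ('d::finite) env measure" where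
  "OmegaBorel lam Lam = sigma (OmegaSet lam Lam) (lu_open lam Lam)"

definition OmegaR :: "real \<Rightarrow> real \<Rightarrow> real \<Rightarrow> ('d::finite) env set" where
  "OmegaR lam Lam r = {\<omega>\<in>OmegaSet lam Lam.
      (\<exists>D :: (real^'d) \<Rightarrow> ((real^'d) \<Rightarrow>\<^sub>L (real^'d^'d)).
          (\<forall>x. (\<omega> has_derivative blinfun_apply (D x)) (at x)) \<and> continuous_on UNIV D) \<and>
      (\<forall>x. psd (\<omega> x - r *\<^sub>R mat 1))}"

definition gradnorm :: "('d::finite) env \<Rightarrow> real^'d \<Rightarrow> real" where
  "gradnorm \<omega> x = onorm (frechet_derivative \<omega> (at x))"

definition norm1K :: "('d::finite) env \<Rightarrow> nat \<Rightarrow> real" where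
  "norm1K \<omega> K = (SUP x\<in>cball 0 (real K). norm (\<omega> x)) + (SUP x\<in>cball 0 (real K). gradnorm \<omega> x)"

definition dist_r :: "('d::finite) env \<Rightarrow> ('d::finite) env \<Rightarrow> real" where
  "dist_r \<omega>1 \<omega>2 = (\<Sum>K. (1/2)^(Suc K) *
      (norm1K (\<lambda>x. \<omega>1 x - \<omega>2 x) (Suc K) / (1 + norm1K (\<lambda>x. \<omega>1 x - \<omega>2 x) (Suc K))))"

definition bdd_dr_cont :: "('d::finite) env set \<Rightarrow> (('d::finite) env \<Rightarrow> real) \<Rightarrow> bool" where
  "bdd_dr_cont S F \<longleftrightarrow> (\<exists>B. \<forall>\<omega>\<in>S. \<bar>F \<omega>\<bar> \<le> B) \<and>
     (\<forall>\<omega>\<in>S. \<forall>\<epsilon>>0. \<exists>\<delta>>0. \<forall>\<omega>'\<in>S. dist_r \<omega>' \<omega> < \<delta> \<longrightarrow> \<bar>F \<omega>' - F \<omega>\<bar> < \<epsilon>)"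

definition shift_invariant :: "('d::finite) env measure \<Rightarrow> bool" where
  "shift_invariant \<mu> \<longleftrightarrow> (\<forall>x. \<forall>A\<in>sets \<mu>.
      emeasure \<mu> (shift x -` A \<inter> space \<mu>) = emeasure \<mu> A)"

definition shift_ergodic :: "('d::finite) env measure \<Rightarrow> bool" where
  "shift_ergodic \<mu> \<longleftrightarrow> (\<forall>A\<in>sets \<mu>. (\<forall>x. shift x -` A \<inter> space \<mu> = A) \<longrightarrow>
      emeasure \<mu> A = 0 \<or> emeasure \<mu> A = 1)"

(* integral of F against mu_n, i.e. M^{-d} int_{[-M/2,M/2]^d} F(tau_y omega) dy *)
definition periodic_avg :: "real \<Rightarrow> ('d::finite) env \<Rightarrow> (('d::finite) env \<Rightarrow> real) \<Rightarrow> real" where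
  "periodic_avg M \<omega> F = (1 / M ^ CARD('d)) *
     (\<integral>y. indicator (cbox (-(M/2) *\<^sub>R One) ((M/2) *\<^sub>R One)) y * F (shift y \<omega>) \<partial>lborel)"

end

theory Submission
  imports Defs
begin

text \<open>Since \<open>\<omega>\<^sub>n\<close> may be chosen anew for every \<open>n\<close>, the mean ergodic theorem suffices: for finitely
  many bounded test functions there are a large cube of side \<open>M\<close> and an environment \<open>\<omega>\<close> in
  \<open>OmegaR\<close> whose orbit averages over the cube nearly agree with the integrals against \<open>\<mu>\<close>. Compose
  \<open>\<omega>\<close> with an \<open>M\<close>-periodic \<open>C\<^sup>1\<close> map that is the identity on the cube up to a boundary layer of
  bounded width. The result is periodic, stays in \<open>OmegaR\<close>, and has almost the same averages for
  every test function that depends on the restriction to a fixed ball only. Countably many such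
  local test functions suffice, because \<open>OmegaR\<close> is separable in the \<open>C\<^sup>1\<close> topology and each
  nonnegative continuous function is an increasing limit of finite maxima of local bumps.\<close>

section \<open>Averages over cubes\<close>

text \<open>The measure \<mu> lives on the Borel field of locally uniform convergence, while the
  test functions are continuous only for the finer C1 metric, so even their measurability is not
  immediate. The remedy is a norm built from difference quotients: a strict lower bound on it is
  witnessed by two points and is therefore an open condition for locally uniform convergence. Bumps
  built from this norm are Borel on \<open>OmegaR\<close>, and so are the pointwise limits of their
  maxima. The weak limit is reached through one-sided estimates. A nonnegative function dominates
  some bump maximum with nearly the same \<mu>-integral, so its averages are eventually bounded
  below; applied to B + F and B - F, with B a bound of F, this gives both inequalities. The
  environments come from a first-moment argument: over a large cube the \<mu>-expectation of the
  summed errors of the first n + 1 bump lists is below 1 / (n + 1), so some environment in the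
  full-measure set \<open>OmegaR\<close> has total error below that bound.\<close>

definition cube :: "real \<Rightarrow> 'e::euclidean_space set" where
  "cube M = cbox (-(M/2) *\<^sub>R One) ((M/2) *\<^sub>R One)"

text \<open>The normalisation is built in so that \<open>periodic_avg\<close> becomes an expectation
  (\<open>periodic_avg_eq\<close>); Fubini for probability spaces and nonnegativity of variances
  then apply directly.\<close>

definition unif :: "real \<Rightarrow> 'e::euclidean_space measure" where
  "unif M = density lborel (\<lambda>y. ennreal (indicator (cube M) y / M ^ DIM('e)))"

lemma mem_cube: "y \<in> cube M \<longleftrightarrow> (\<forall>i\<in>Basis. \<bar>y \<bullet> i\<bar> \<le> M / 2)"
  unfolding cube_def mem_box by (auto simp: abs_le_iff)

lemma cube_sets [measurable]: "cube M \<in> sets borel"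
  unfolding cube_def by simp

lemma emeasure_cube:
  assumes "M \<ge> 0"
  shows "emeasure lborel (cube M :: 'e::euclidean_space set) = ennreal (M ^ DIM('e))"
proof -
  have "(\<Prod>b\<in>Basis. ((M/2) *\<^sub>R One - (-(M/2)) *\<^sub>R (One::'e)) \<bullet> b) = (\<Prod>b\<in>(Basis::'e set). M)"
    by (rule prod.cong) (auto simp: inner_diff_left inner_add_left)
  then show ?thesis
    unfolding cube_def using assms by (subst emeasure_lborel_cbox) auto
qed

lemma measure_cube:
  "M \<ge> 0 \<Longrightarrow> measure lborel (cube M :: 'e::euclidean_space set) = M ^ DIM('e)"
  by (simp add: measure_def emeasure_cube)

lemma integrable_indicator_cube [simp]:
  "M \<ge> 0 \<Longrightarrow> integrable lborel (indicator (cube M :: 'e::euclidean_space set) :: 'e \<Rightarrow> real)"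
  by (rule integrable_real_indicator) (auto simp: emeasure_cube)

lemma unif_sets [simp, measurable_cong]: "sets (unif M) = sets borel"
  and unif_space [simp]: "space (unif M) = UNIV"
  by (auto simp: unif_def)

lemma integral_unif:
  fixes g :: "'e::euclidean_space \<Rightarrow> real"
  assumes "M > 0" and [measurable]: "g \<in> borel_measurable borel"
  shows "(\<integral>y. g y \<partial>unif M) = (1 / M ^ DIM('e)) * (\<integral>y. indicator (cube M) y * g y \<partial>lborel)"
proof -
  have "(\<integral>y. g y \<partial>unif M) = (\<integral>y. indicator (cube M) y / M ^ DIM('e) * g y \<partial>lborel)"
    unfolding unif_def using assms(1) by (subst integral_real_density) auto
  also have "\<dots> = (\<integral>y. (1 / M ^ DIM('e)) * (indicator (cube M) y * g y) \<partial>lborel)"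
    by simp
  finally show ?thesis by (simp only: integral_mult_right_zero)
qed

lemma prob_space_unif:
  assumes "M > 0"
  shows "prob_space (unif M :: 'e::euclidean_space measure)"
proof
  have "emeasure (unif M :: 'e measure) UNIV = (\<integral>\<^sup>+ y. ennreal (1 / M ^ DIM('e)) * indicator (cube M) (y::'e) \<partial>lborel)"
    unfolding unif_def using assms
    by (subst emeasure_density) (auto intro!: nn_integral_cong simp: indicator_def)
  also have "\<dots> = 1"
    using assms by (subst nn_integral_cmult_indicator) (auto simp: emeasure_cube simp flip: ennreal_mult)
  finally show "emeasure (unif M :: 'e measure) (space (unif M)) = 1" by simp
qed

text \<open>For \<open>0 \<le> 2 * s \<le> M\<close> this is the fraction of a
  \<open>d\<close>-dimensional cube of side \<open>M\<close> that lies within sup-distance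
  \<open>s\<close> of its boundary. All boundary errors below are multiples of it, and they vanish
  as \<open>M\<close> grows with \<open>s\<close> fixed.\<close>

definition boundary_frac :: "nat \<Rightarrow> real \<Rightarrow> real \<Rightarrow> real" where
  "boundary_frac d s M = 1 - (1 - 2 * s / M) ^ d"

lemma boundary_frac_tendsto: "((\<lambda>M. boundary_frac d s M) \<longlongrightarrow> 0) at_top"
proof -
  have "((\<lambda>M. 2 * s / M) \<longlongrightarrow> 0) at_top"
    by (rule real_tendsto_divide_at_top[OF tendsto_const filterlim_ident])
  from tendsto_power[OF tendsto_diff[OF tendsto_const[of 1] this], of d]
  have "((\<lambda>M. (1 - 2 * s / M) ^ d) \<longlongrightarrow> 1) at_top" by simp
  from tendsto_diff[OF tendsto_const[of 1] this] show ?thesis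
    by (simp add: boundary_frac_def)
qed

lemma cube_mono: "M \<le> N \<Longrightarrow> cube M \<subseteq> cube N"
  by (auto simp: mem_cube dest!: bspec)

lemma measure_shell:
  fixes s M :: real
  assumes "0 < M" "0 \<le> s" "2 * s \<le> M"
  shows "(\<integral>y. indicator (cube M) y - indicator (cube (M - 2 * s)) (y::'e::euclidean_space) \<partial>lborel)
    = M ^ DIM('e) * boundary_frac DIM('e) s M"
proof -
  have "(\<integral>y. indicator (cube M) y - indicator (cube (M - 2 * s)) (y::'e) \<partial>lborel)
      = M ^ DIM('e) - (M - 2 * s) ^ DIM('e)"
    using assms by (subst Bochner_Integration.integral_diff) (auto simp: measure_cube)
  also have "\<dots> = M ^ DIM('e) - (M * (1 - 2 * s / M)) ^ DIM('e)" using assms by (simp add: right_diff_distrib)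
  also have "\<dots> = M ^ DIM('e) * boundary_frac DIM('e) s M"
    unfolding boundary_frac_def power_mult_distrib by (simp add: algebra_simps)
  finally show ?thesis .
qed

lemma unif_integrable_bounded:
  fixes g :: "'e::euclidean_space \<Rightarrow> real"
  assumes "M > 0" and [measurable]: "g \<in> borel_measurable borel" and "\<And>y. \<bar>g y\<bar> \<le> B"
  shows "integrable (unif M) g"
proof -
  interpret prob_space "unif M :: 'e measure" by (rule prob_space_unif[OF assms(1)])
  show ?thesis using assms by (intro integrable_const_bound[of _ B]) auto
qed

lemma cube_integrable_bounded:
  fixes g :: "'e::euclidean_space \<Rightarrow> real"
  assumes "M \<ge> 0" and [measurable]: "g \<in> borel_measurable borel" and "\<And>y. \<bar>g y\<bar> \<le> B"
  shows "integrable lborel (\<lambda>y. indicator (cube M) y * g y)"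
proof (rule Bochner_Integration.integrable_bound)
  show "integrable lborel (\<lambda>y::'e. B * indicator (cube M) y)"
    using assms by simp
  have "0 \<le> B" using assms(3)[of undefined] by linarith
  then show "AE x in lborel. norm (indicator (cube M) x * g x) \<le> norm (B * indicator (cube M) x)"
    using assms(3) by (auto simp: indicator_def)
qed simp

text \<open>The integrands differ by at most \<open>2 * B\<close>, and only on the shell between the
  two cubes. This is the price of replacing an environment by its periodization.\<close>

lemma unif_integral_agree:
  fixes g h :: "'e::euclidean_space \<Rightarrow> real"
  assumes "0 < M" "0 \<le> s" "2 * s \<le> M"
    and [measurable]: "g \<in> borel_measurable borel" "h \<in> borel_measurable borel"
    and "\<And>y. \<bar>g y\<bar> \<le> B" "\<And>y. \<bar>h y\<bar> \<le> B"
    and eq: "\<And>y. y \<in> cube (M - 2 * s) \<Longrightarrow> g y = h y"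
  shows "\<bar>(\<integral>y. g y \<partial>unif M) - (\<integral>y. h y \<partial>unif M)\<bar> \<le> 2 * B * boundary_frac DIM('e) s M"
proof -
  have B: "0 \<le> B" using assms(6)[of undefined] by linarith
  have "\<bar>\<integral>y. indicator (cube M) y * g y - indicator (cube M) y * h y \<partial>lborel\<bar>
      \<le> (\<integral>y. 2 * B * (indicator (cube M) y - indicator (cube (M - 2 * s)) (y::'e)) \<partial>lborel)"
  proof (rule order_trans[OF Bochner_Integration.integral_abs_bound Bochner_Integration.integral_mono])
    show "integrable lborel (\<lambda>y. \<bar>indicator (cube M) y * g y - indicator (cube M) y * h y\<bar>)"
      using assms by (intro integrable_abs Bochner_Integration.integrable_diff cube_integrable_bounded[of _ _ B]) auto
    show "integrable lborel (\<lambda>y::'e. 2 * B * (indicator (cube M) y - indicator (cube (M - 2 * s)) y))"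
      using assms by (intro integrable_mult_right Bochner_Integration.integrable_diff) auto
    fix y :: 'e
    have "cube (M - 2 * s) \<subseteq> (cube M::'e set)" using assms by (intro cube_mono) auto
    moreover have "\<bar>g y - h y\<bar> \<le> 2 * B" using assms(6,7)[of y] by linarith
    ultimately show "\<bar>indicator (cube M) y * g y - indicator (cube M) y * h y\<bar>
        \<le> 2 * B * (indicator (cube M) y - indicator (cube (M - 2 * s)) y)"
      using eq[of y] B by (auto simp: indicator_def)
  qed
  also have "\<dots> = 2 * B * (M ^ DIM('e) * boundary_frac DIM('e) s M)"
    using assms measure_shell[of M s, where 'e='e] by simp
  also have "(\<integral>y. indicator (cube M) y * g y - indicator (cube M) y * h y \<partial>lborel)
     = M ^ DIM('e) * ((\<integral>y. g y \<partial>unif M) - (\<integral>y. h y \<partial>unif M))"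
  proof -
    have "integrable lborel (\<lambda>y. indicator (cube M) y * g y)" "integrable lborel (\<lambda>y. indicator (cube M) y * h y)"
      using assms by (auto intro!: cube_integrable_bounded[of _ _ B] simp del: integrable_mult_left)
    then show ?thesis using assms(1) by (simp add: integral_unif field_simps)
  qed
  finally have "M ^ DIM('e) * \<bar>(\<integral>y. g y \<partial>unif M) - (\<integral>y. h y \<partial>unif M)\<bar>
     \<le> M ^ DIM('e) * (2 * B * boundary_frac DIM('e) s M)"
    using assms(1) by (simp add: abs_mult ac_simps)
  then show ?thesis using assms(1) by (simp add: mult_le_cancel_left)
qed

text \<open>The Folner property of cubes. Changing variables moves the cube instead of
  \<open>g\<close>; the moved cube and the original both contain the concentric cube of side
  \<open>M - 2 * s\<close>, so their symmetric difference has at most twice the volume of the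
  shell.\<close>

lemma unif_integral_translate:
  fixes g :: "'e::euclidean_space \<Rightarrow> real"
  assumes "0 < M" "0 \<le> s" "2 * s \<le> M"
    and [measurable]: "g \<in> borel_measurable borel"
    and gB: "\<And>y. \<bar>g y\<bar> \<le> B"
    and z: "\<And>i. i \<in> Basis \<Longrightarrow> \<bar>z \<bullet> i\<bar> \<le> s"
  shows "\<bar>(\<integral>y. g (y + z) \<partial>unif M) - (\<integral>y. g y \<partial>unif M)\<bar> \<le> 2 * B * boundary_frac DIM('e) s M"
proof -
  have B: "0 \<le> B" using gB[of undefined] by linarith
  have tr: "(\<integral>y. f (y + z) \<partial>lborel) = (\<integral>y. f y \<partial>lborel)" if "f \<in> borel_measurable borel" for f :: "'e \<Rightarrow> real"
  proof -
    have "(\<integral>y. f y \<partial>lborel) = (\<integral>y. f y \<partial>distr lborel borel ((+) z))"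
      by (simp add: lborel_distr_plus)
    also have "\<dots> = (\<integral>y. f (y + z) \<partial>lborel)"
      using that by (subst integral_distr) (auto simp: add.commute)
    finally show ?thesis by simp
  qed
  have itr: "integrable lborel (\<lambda>y. f (y - z))" if "integrable lborel f" for f :: "'e \<Rightarrow> real"
  proof -
    have "integrable (distr lborel borel ((+) (-z))) f" using that by (simp add: lborel_distr_plus)
    then show ?thesis using that by (subst (asm) integrable_distr_eq) auto
  qed
  define I J where "I y = (indicator (cube M) (y - z) :: real)" and "J y = (indicator (cube M) y :: real)" for y :: 'e
  have [measurable]: "I \<in> borel_measurable borel" "J \<in> borel_measurable borel"
    unfolding I_def J_def by measurable
  have iI: "integrable lborel I" "integrable lborel J"
    unfolding I_def J_def using assms by (auto intro!: itr)
  have i1: "integrable lborel (\<lambda>y. I y * g y)"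
  proof (rule Bochner_Integration.integrable_bound[OF integrable_mult_right[OF iI(1), of B]])
    show "AE x in lborel. norm (I x * g x) \<le> norm (B * I x)" using B gB by (auto simp: I_def indicator_def)
  qed auto
  have i2: "integrable lborel (\<lambda>y. J y * g y)"
    unfolding J_def using assms by (intro cube_integrable_bounded[of _ _ B]) auto
  have eqI: "(\<integral>y. I y \<partial>lborel) = (\<integral>y. J y \<partial>lborel)"
    using tr[of I] by (simp add: I_def J_def)
  have "\<bar>\<integral>y. I y * g y - J y * g y \<partial>lborel\<bar>
      \<le> (\<integral>y. B * ((I y + J y) - 2 * indicator (cube (M - 2 * s)) y) \<partial>lborel)"
  proof (rule order_trans[OF Bochner_Integration.integral_abs_bound Bochner_Integration.integral_mono])
    show "integrable lborel (\<lambda>y. \<bar>I y * g y - J y * g y\<bar>)"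
      by (intro integrable_abs Bochner_Integration.integrable_diff i1 i2)
    show "integrable lborel (\<lambda>y. B * ((I y + J y) - 2 * indicator (cube (M - 2 * s)) y))"
      using assms iI by (intro integrable_mult_right Bochner_Integration.integrable_diff Bochner_Integration.integrable_add) auto
    fix y :: 'e
    have "y \<in> cube M \<and> y - z \<in> cube M" if "y \<in> cube (M - 2 * s)"
    proof -
      have "\<bar>y \<bullet> i\<bar> \<le> M/2 \<and> \<bar>(y - z) \<bullet> i\<bar> \<le> M/2" if "i \<in> Basis" for i
      proof -
        have "\<bar>y \<bullet> i\<bar> \<le> M / 2 - s"
          using \<open>y \<in> cube (M - 2 * s)\<close> that by (auto simp: mem_cube diff_divide_distrib dest!: bspec[OF _ that])
        then show ?thesis using z[OF that] assms(2) unfolding inner_diff_left by linarith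
      qed
      then show ?thesis by (auto simp: mem_cube)
    qed
    then show "\<bar>I y * g y - J y * g y\<bar> \<le> B * ((I y + J y) - 2 * indicator (cube (M - 2 * s)) y)"
      using gB[of y] B by (auto simp: I_def J_def indicator_def)
  qed
  also have "\<dots> = B * (2 * ((\<integral>y. J y \<partial>lborel) - (\<integral>y. indicator (cube (M - 2 * s)) (y::'e) \<partial>lborel)))"
    using iI assms by (simp add: eqI)
  also have "(\<integral>y. J y \<partial>lborel) - (\<integral>y. indicator (cube (M - 2 * s)) (y::'e) \<partial>lborel)
      = M ^ DIM('e) * boundary_frac DIM('e) s M"
    using assms measure_shell[of M s, where 'e='e] unfolding J_def by simp
  also have "(\<integral>y. I y * g y - J y * g y \<partial>lborel)
     = M ^ DIM('e) * ((\<integral>y. g (y + z) \<partial>unif M) - (\<integral>y. g y \<partial>unif M))"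
  proof -
    have "(\<integral>y. I y * g y \<partial>lborel) = (\<integral>y. indicator (cube M) y * g (y + z) \<partial>lborel)"
      using tr[of "\<lambda>y. I y * g y"] by (simp add: I_def)
    then show ?thesis
      using i1 i2 assms(1) by (simp add: integral_unif J_def field_simps)
  qed
  finally have "M ^ DIM('e) * \<bar>(\<integral>y. g (y + z) \<partial>unif M) - (\<integral>y. g y \<partial>unif M)\<bar>
     \<le> M ^ DIM('e) * (2 * B * boundary_frac DIM('e) s M)"
    using assms(1) by (simp add: abs_mult ac_simps)
  then show ?thesis using assms(1) by (simp add: mult_le_cancel_left)
qed

lemma AE_unif_cube: "AE y in (unif M :: 'e::euclidean_space measure). y \<in> cube M"
  unfolding unif_def by (subst AE_density) (auto simp: indicator_def)

section \<open>The mean ergodic theorem for actions of Euclidean space\<close>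

text \<open>Each \<open>T x\<close> is measurable by itself; joint measurability in position and
  point is asked of single functions, by \<open>orbit_measurable\<close>. Ergodicity speaks of
  strictly invariant sets, so an invariant limit must be invariant everywhere and not just almost
  everywhere.\<close>

locale ergodic_flow = prob_space \<mu> for \<mu> :: "'a measure" +
  fixes T :: "'e::euclidean_space \<Rightarrow> 'a \<Rightarrow> 'a"
  assumes T_measurable [measurable]: "\<And>x. T x \<in> measurable \<mu> \<mu>"
    and T_zero: "\<And>\<omega>. \<omega> \<in> space \<mu> \<Longrightarrow> T 0 \<omega> = \<omega>"
    and T_add: "\<And>x y \<omega>. \<omega> \<in> space \<mu> \<Longrightarrow> T x (T y \<omega>) = T (x + y) \<omega>"
    and T_preserving: "\<And>x. distr \<mu> \<mu> (T x) = \<mu>"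
    and ergodic: "\<And>A. A \<in> sets \<mu> \<Longrightarrow> (\<And>x. T x -` A \<inter> space \<mu> = A) \<Longrightarrow> prob A = 0 \<or> prob A = 1"
begin

lemma T_space: "\<omega> \<in> space \<mu> \<Longrightarrow> T x \<omega> \<in> space \<mu>"
  using measurable_space[OF T_measurable] .

text \<open>This is what Fubini between \<mu> and the averages over cubes requires.\<close>

definition orbit_measurable :: "('a \<Rightarrow> real) \<Rightarrow> bool" where
  "orbit_measurable f \<longleftrightarrow> (\<lambda>p. f (T (fst p) (snd p))) \<in> borel_measurable (borel \<Otimes>\<^sub>M \<mu>)"

definition avg :: "real \<Rightarrow> ('a \<Rightarrow> real) \<Rightarrow> 'a \<Rightarrow> real" where
  "avg N f \<omega> = (\<integral>y. f (T y \<omega>) \<partial>unif N)"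

lemma orbit_measurable_section:
  assumes "orbit_measurable f" "\<omega> \<in> space \<mu>"
  shows "(\<lambda>y. f (T y \<omega>)) \<in> borel_measurable borel"
proof -
  have "(\<lambda>y. (y, \<omega>)) \<in> measurable borel (borel \<Otimes>\<^sub>M \<mu>)" using assms(2) by simp
  from measurable_compose[OF this assms(1)[unfolded orbit_measurable_def]] show ?thesis by simp
qed

lemma orbit_measurable_imp_measurable:
  assumes "orbit_measurable f"
  shows "f \<in> borel_measurable \<mu>"
proof -
  have "(\<lambda>\<omega>. (0, \<omega>)) \<in> measurable \<mu> (borel \<Otimes>\<^sub>M \<mu>)" by simp
  from measurable_compose[OF this assms[unfolded orbit_measurable_def]]
  have "(\<lambda>\<omega>. f (T 0 \<omega>)) \<in> borel_measurable \<mu>" by simp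
  then show ?thesis by (rule measurable_cong[THEN iffD1, rotated]) (simp add: T_zero)
qed

lemma orbit_measurable_add:
  "orbit_measurable f \<Longrightarrow> orbit_measurable g \<Longrightarrow> orbit_measurable (\<lambda>\<omega>. f \<omega> + g \<omega>)"
  unfolding orbit_measurable_def by measurable

lemma orbit_measurable_square:
  "orbit_measurable f \<Longrightarrow> orbit_measurable (\<lambda>\<omega>. (f \<omega>)\<^sup>2)"
  unfolding orbit_measurable_def by measurable

text \<open>A Caratheodory function is a limit of functions that are countably step-like in \<open>y\<close>.\<close>
lemma orbit_measurable_continuous:
  assumes f [measurable]: "f \<in> borel_measurable \<mu>"
    and cont: "\<And>\<omega>. \<omega> \<in> space \<mu> \<Longrightarrow> continuous_on UNIV (\<lambda>y. f (T y \<omega>))"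
  shows "orbit_measurable f"
  unfolding orbit_measurable_def
proof (rule borel_measurable_LIMSEQ_real)
  \<comment> \<open>\<open>q n\<close> rounds every coordinate down to a multiple of
    \<open>1 / (n + 1)\<close>. Its range is countable, so the maps \<open>f (T z _)\<close> for
    fixed \<open>z\<close> can be glued along it measurably.\<close>
  define q :: "nat \<Rightarrow> 'e \<Rightarrow> 'e" where
    "q n y = (\<Sum>b\<in>Basis. (of_int \<lfloor>real (Suc n) * (y \<bullet> b)\<rfloor> / real (Suc n)) *\<^sub>R b)" for n y
  have qm [measurable]: "q n \<in> borel_measurable borel" for n
    unfolding q_def by measurable
  have "countable (range (q n))" for n
  proof -
    have "range (q n) \<subseteq> (\<lambda>c. \<Sum>b\<in>Basis. (of_int (c b) / real (Suc n)) *\<^sub>R b) ` (PiE Basis (\<lambda>_. UNIV :: int set))"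
    proof
      fix x assume "x \<in> range (q n)"
      then obtain y where "x = q n y" by auto
      then show "x \<in> (\<lambda>c. \<Sum>b\<in>Basis. (of_int (c b) / real (Suc n)) *\<^sub>R b) ` (PiE Basis (\<lambda>_. UNIV :: int set))"
        by (intro image_eqI[of _ _ "restrict (\<lambda>b. \<lfloor>real (Suc n) * (y \<bullet> b)\<rfloor>) Basis"]) (auto simp: q_def)
    qed
    then show ?thesis by (rule countable_subset) (intro countable_image countable_PiE, auto)
  qed
  then show "(\<lambda>p. f (T (q n (fst p)) (snd p))) \<in> borel_measurable (borel \<Otimes>\<^sub>M \<mu>)" for n
  proof (intro measurable_compose_countable'[where I = "range (q n)" and f = "\<lambda>z p. f (T z (snd p))" and g = "\<lambda>p. q n (fst p)"])
    show "(\<lambda>p. q n (fst p)) \<in> measurable (borel \<Otimes>\<^sub>M \<mu>) (count_space (range (q n)))"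
      using \<open>countable (range (q n))\<close>
      by (intro measurable_compose[OF measurable_fst] measurable_count_space_eq_countable[THEN iffD2])
         (auto intro!: measurable_sets[OF qm, of "{_}", simplified])
  qed auto
  fix p :: "'e \<times> 'a" assume "p \<in> space (borel \<Otimes>\<^sub>M \<mu>)"
  then have \<omega>: "snd p \<in> space \<mu>" by (auto simp: space_pair_measure)
  have "(\<lambda>n. q n y) \<longlonglongrightarrow> y" for y
  proof -
    have "(\<lambda>n. of_int \<lfloor>real (Suc n) * (y \<bullet> b)\<rfloor> / real (Suc n)) \<longlonglongrightarrow> y \<bullet> b" for b
    proof (rule tendsto_sandwich[OF _ _ _ tendsto_const])
      show "(\<lambda>n. y \<bullet> b - 1 / real (Suc n)) \<longlonglongrightarrow> y \<bullet> b"
        using tendsto_diff[OF tendsto_const LIMSEQ_Suc[OF lim_1_over_n]] by simp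
      show "\<forall>\<^sub>F n in sequentially. y \<bullet> b - 1 / real (Suc n) \<le> of_int \<lfloor>real (Suc n) * (y \<bullet> b)\<rfloor> / real (Suc n)"
      proof (rule always_eventually, rule)
        fix n
        have "real (Suc n) * (y \<bullet> b) - 1 \<le> of_int \<lfloor>real (Suc n) * (y \<bullet> b)\<rfloor>" by linarith
        then have "(real (Suc n) * (y \<bullet> b) - 1) / real (Suc n) \<le> of_int \<lfloor>real (Suc n) * (y \<bullet> b)\<rfloor> / real (Suc n)"
          by (rule divide_right_mono) simp
        then show "y \<bullet> b - 1 / real (Suc n) \<le> of_int \<lfloor>real (Suc n) * (y \<bullet> b)\<rfloor> / real (Suc n)"
          by (simp add: diff_divide_distrib del: of_nat_Suc)
      qed
      show "\<forall>\<^sub>F n in sequentially. of_int \<lfloor>real (Suc n) * (y \<bullet> b)\<rfloor> / real (Suc n) \<le> y \<bullet> b"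
      proof (rule always_eventually, rule)
        fix n
        have "of_int \<lfloor>real (Suc n) * (y \<bullet> b)\<rfloor> \<le> real (Suc n) * (y \<bullet> b)" by linarith
        then show "of_int \<lfloor>real (Suc n) * (y \<bullet> b)\<rfloor> / real (Suc n) \<le> y \<bullet> b"
          by (simp add: pos_divide_le_eq mult.commute del: of_nat_Suc)
      qed
    qed
    then have "(\<lambda>n. q n y) \<longlonglongrightarrow> (\<Sum>b\<in>Basis. (y \<bullet> b) *\<^sub>R b)"
      unfolding q_def by (intro tendsto_sum tendsto_scaleR tendsto_const)
    then show ?thesis by (simp add: euclidean_representation)
  qed
  moreover have "isCont (\<lambda>y. f (T y (snd p))) (fst p)"
    using cont[OF \<omega>] by (simp add: continuous_on_eq_continuous_at)
  ultimately show "(\<lambda>n. f (T (q n (fst p)) (snd p))) \<longlonglongrightarrow> f (T (fst p) (snd p))"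
    using isCont_tendsto_compose[of "fst p" "\<lambda>y. f (T y (snd p))" "\<lambda>n. q n (fst p)" sequentially] by blast
qed

lemma orbit_measurable_avg:
  assumes "orbit_measurable f" "N > 0"
  shows "orbit_measurable (avg N f)"
proof -
  interpret U: prob_space "unif N :: 'e measure" by (rule prob_space_unif[OF assms(2)])
  note [measurable] = assms(1)[unfolded orbit_measurable_def]
  have "(\<lambda>q. (snd q + fst (fst q), snd (fst q))) \<in> measurable ((borel \<Otimes>\<^sub>M \<mu>) \<Otimes>\<^sub>M (borel::'e measure)) (borel \<Otimes>\<^sub>M \<mu>)"
    by measurable
  from measurable_compose[OF this assms(1)[unfolded orbit_measurable_def]]
  have "(\<lambda>q. f (T (snd q + fst (fst q)) (snd (fst q)))) \<in> borel_measurable ((borel \<Otimes>\<^sub>M \<mu>) \<Otimes>\<^sub>M borel)"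
    by simp
  also have "borel_measurable ((borel \<Otimes>\<^sub>M \<mu>) \<Otimes>\<^sub>M (borel :: 'e measure)) = borel_measurable ((borel \<Otimes>\<^sub>M \<mu>) \<Otimes>\<^sub>M unif N)"
    by (intro measurable_cong_sets sets_pair_measure_cong) auto
  finally have "(\<lambda>p. \<integral>z. f (T (z + fst p) (snd p)) \<partial>unif N) \<in> borel_measurable (borel \<Otimes>\<^sub>M \<mu>)"
    by (intro U.borel_measurable_lebesgue_integral) (simp add: case_prod_beta)
  then show ?thesis
    unfolding orbit_measurable_def avg_def
    by (rule measurable_cong[THEN iffD1, rotated]) (auto simp: space_pair_measure T_add)
qed

lemma orbit_integrable:
  assumes "orbit_measurable f" "\<omega> \<in> space \<mu>" "N > 0" "\<And>\<omega>. \<omega> \<in> space \<mu> \<Longrightarrow> \<bar>f \<omega>\<bar> \<le> B"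
  shows "integrable (unif N) (\<lambda>y. f (T y \<omega>))"
  using assms by (intro unif_integrable_bounded[of _ _ B] orbit_measurable_section) (auto intro: T_space)

lemma avg_bound:
  assumes "orbit_measurable f" "\<omega> \<in> space \<mu>" "N > 0" "\<And>\<omega>. \<omega> \<in> space \<mu> \<Longrightarrow> \<bar>f \<omega>\<bar> \<le> B"
  shows "\<bar>avg N f \<omega>\<bar> \<le> B"
proof -
  interpret U: prob_space "unif N :: 'e measure" by (rule prob_space_unif[OF assms(3)])
  have "\<bar>avg N f \<omega>\<bar> \<le> (\<integral>y. \<bar>f (T y \<omega>)\<bar> \<partial>unif N)" unfolding avg_def by simp
  also have "\<dots> \<le> (\<integral>y. B \<partial>(unif N :: 'e measure))"
    using assms by (intro Bochner_Integration.integral_mono integrable_abs orbit_integrable[of f \<omega> N B]) (auto intro: T_space)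
  also have "\<dots> = B" by (simp add: U.prob_space[simplified])
  finally show ?thesis .
qed

lemma avg_shift:
  assumes "orbit_measurable f" "\<omega> \<in> space \<mu>" "N > 0" "\<And>\<omega>. \<omega> \<in> space \<mu> \<Longrightarrow> \<bar>f \<omega>\<bar> \<le> B"
    and "0 \<le> s" "2 * s \<le> N" "\<And>i. i \<in> Basis \<Longrightarrow> \<bar>z \<bullet> i\<bar> \<le> s"
  shows "\<bar>avg N f (T z \<omega>) - avg N f \<omega>\<bar> \<le> 2 * B * boundary_frac DIM('e) s N"
  using unif_integral_translate[of N s "\<lambda>y. f (T y \<omega>)" B z] assms
  by (simp add: avg_def T_add T_space orbit_measurable_section)

text \<open>By Fubini the iterated average is the mean of \<open>avg N f (T z \<omega>)\<close> over
  \<open>z\<close> in the small cube, whose coordinates are at most \<open>M / 2\<close>;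
  \<open>avg_shift\<close> bounds each of these terms.\<close>

lemma avg_avg_close:
  assumes "orbit_measurable f" "\<omega> \<in> space \<mu>" "0 < M" "M \<le> N" and fB: "\<And>\<omega>. \<omega> \<in> space \<mu> \<Longrightarrow> \<bar>f \<omega>\<bar> \<le> B"
  shows "\<bar>avg N (avg M f) \<omega> - avg N f \<omega>\<bar> \<le> 2 * B * boundary_frac DIM('e) (M/2) N"
proof -
  have N: "0 < N" using assms by simp
  interpret UN: prob_space "unif N :: 'e measure" by (rule prob_space_unif[OF N])
  interpret UM: prob_space "unif M :: 'e measure" by (rule prob_space_unif[OF assms(3)])
  interpret P: pair_prob_space "unif N :: 'e measure" "unif M :: 'e measure" ..
  have [measurable]: "(\<lambda>y. f (T y \<omega>)) \<in> borel_measurable borel"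
    by (rule orbit_measurable_section) fact+
  have int: "integrable (unif N \<Otimes>\<^sub>M unif M) (\<lambda>(y, z). f (T (z + y) \<omega>))"
    using fB T_space[OF assms(2)]
    by (intro P.integrable_const_bound[of _ B]) (auto simp: case_prod_beta)
  have "avg N (avg M f) \<omega> = (\<integral>y. (\<integral>z. f (T (z + y) \<omega>) \<partial>unif M) \<partial>unif N)"
    by (simp add: avg_def T_add assms(2))
  also have "\<dots> = (\<integral>z. (\<integral>y. f (T (z + y) \<omega>) \<partial>unif N) \<partial>unif M)"
    using P.Fubini_integral[OF int] by simp
  also have "\<dots> = (\<integral>z. avg N f (T z \<omega>) \<partial>unif M)"
    by (simp add: avg_def T_add assms(2) add.commute)
  finally have eq: "avg N (avg M f) \<omega> = (\<integral>z. avg N f (T z \<omega>) \<partial>unif M)" .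
  have i: "integrable (unif M) (\<lambda>z. avg N f (T z \<omega>))"
    using assms N by (intro orbit_integrable[of _ _ _ B] orbit_measurable_avg avg_bound) auto
  have "\<bar>avg N (avg M f) \<omega> - avg N f \<omega>\<bar> = \<bar>\<integral>z. avg N f (T z \<omega>) - avg N f \<omega> \<partial>unif M\<bar>"
    using i by (simp add: eq UM.prob_space[simplified])
  also have "\<dots> \<le> (\<integral>z. \<bar>avg N f (T z \<omega>) - avg N f \<omega>\<bar> \<partial>unif M)" by simp
  also have "\<dots> \<le> (\<integral>z. 2 * B * boundary_frac DIM('e) (M/2) N \<partial>(unif M :: 'e measure))"
  proof (rule integral_mono_AE)
    show "AE z in unif M. \<bar>avg N f (T z \<omega>) - avg N f \<omega>\<bar> \<le> 2 * B * boundary_frac DIM('e) (M/2) N"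
      using AE_unif_cube
    proof eventually_elim
      case (elim z)
      then show ?case
        using assms N by (intro avg_shift fB) (auto simp: mem_cube)
    qed
  qed (use i in auto)
  also have "\<dots> = 2 * B * boundary_frac DIM('e) (M/2) N" by (simp add: UM.prob_space[simplified])
  finally show ?thesis .
qed

lemma integral_T:
  assumes "f \<in> borel_measurable \<mu>"
  shows "(\<integral>\<omega>. f (T y \<omega>) \<partial>\<mu>) = (\<integral>\<omega>. (f \<omega> :: real) \<partial>\<mu>)"
proof -
  have "(\<integral>\<omega>. f \<omega> \<partial>\<mu>) = (\<integral>\<omega>. f \<omega> \<partial>distr \<mu> \<mu> (T y))" by (simp add: T_preserving)
  also have "\<dots> = (\<integral>\<omega>. f (T y \<omega>) \<partial>\<mu>)" using assms by (subst integral_distr) auto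
  finally show ?thesis by simp
qed

lemma integral_avg:
  assumes "orbit_measurable f" "N > 0" and fB: "\<And>\<omega>. \<omega> \<in> space \<mu> \<Longrightarrow> \<bar>f \<omega>\<bar> \<le> B"
  shows "(\<integral>\<omega>. avg N f \<omega> \<partial>\<mu>) = (\<integral>\<omega>. f \<omega> \<partial>\<mu>)"
proof -
  interpret U: prob_space "unif N :: 'e measure" by (rule prob_space_unif[OF assms(2)])
  interpret P: pair_prob_space "unif N :: 'e measure" \<mu> ..
  have "borel_measurable (borel \<Otimes>\<^sub>M \<mu>) = borel_measurable ((unif N :: 'e measure) \<Otimes>\<^sub>M \<mu>)"
    by (intro measurable_cong_sets sets_pair_measure_cong) auto
  then have [measurable]: "(\<lambda>p. f (T (fst p) (snd p))) \<in> borel_measurable ((unif N :: 'e measure) \<Otimes>\<^sub>M \<mu>)"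
    using assms(1) unfolding orbit_measurable_def by simp
  have int: "integrable (unif N \<Otimes>\<^sub>M \<mu>) (\<lambda>(y, \<omega>). f (T y \<omega>))"
    using fB T_space
    by (intro P.integrable_const_bound[of _ B]) (auto simp: case_prod_beta space_pair_measure)
  have "(\<integral>\<omega>. avg N f \<omega> \<partial>\<mu>) = (\<integral>y. (\<integral>\<omega>. f (T y \<omega>) \<partial>\<mu>) \<partial>unif N)"
    unfolding avg_def by (rule P.Fubini_integral[OF int])
  also have "\<dots> = (\<integral>\<omega>. f \<omega> \<partial>\<mu>)"
    using orbit_measurable_imp_measurable[OF assms(1)] by (simp add: integral_T U.prob_space[simplified])
  finally show ?thesis .
qed

lemma integrable_orbit_bounded:
  assumes "orbit_measurable f" "\<And>\<omega>. \<omega> \<in> space \<mu> \<Longrightarrow> \<bar>f \<omega>\<bar> \<le> B"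
  shows "integrable \<mu> f"
  using assms orbit_measurable_imp_measurable[OF assms(1)] by (intro integrable_const_bound[of _ B]) auto

text \<open>Jensen's inequality at each point, in the form that a variance under
  \<open>unif N\<close> is nonnegative, followed by \<open>integral_avg\<close> for the square of
  \<open>f\<close>.\<close>

lemma avg_contraction:
  assumes "orbit_measurable f" "N > 0" and fB: "\<And>\<omega>. \<omega> \<in> space \<mu> \<Longrightarrow> \<bar>f \<omega>\<bar> \<le> B"
  shows "(\<integral>\<omega>. (avg N f \<omega>)\<^sup>2 \<partial>\<mu>) \<le> (\<integral>\<omega>. (f \<omega>)\<^sup>2 \<partial>\<mu>)"
proof -
  interpret U: prob_space "unif N :: 'e measure" by (rule prob_space_unif[OF assms(2)])
  have f2B: "\<bar>(f \<omega>)\<^sup>2\<bar> \<le> B\<^sup>2" if "\<omega> \<in> space \<mu>" for \<omega>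
    using power_mono[OF fB[OF that], of 2] by simp
  note f2 = orbit_measurable_square[OF assms(1)]
  note om = orbit_measurable_avg[OF assms(1,2)]
  have a2B: "\<bar>(avg N f \<omega>)\<^sup>2\<bar> \<le> B\<^sup>2" if "\<omega> \<in> space \<mu>" for \<omega>
    using power_mono[OF avg_bound[OF assms(1) that assms(2) fB], of 2] by simp
  have a3B: "\<bar>avg N (\<lambda>\<omega>. (f \<omega>)\<^sup>2) \<omega>\<bar> \<le> B\<^sup>2" if "\<omega> \<in> space \<mu>" for \<omega>
    by (rule avg_bound[OF f2 that assms(2) f2B])
  have "(\<integral>\<omega>. (avg N f \<omega>)\<^sup>2 \<partial>\<mu>) \<le> (\<integral>\<omega>. avg N (\<lambda>\<omega>. (f \<omega>)\<^sup>2) \<omega> \<partial>\<mu>)"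
  proof (rule Bochner_Integration.integral_mono)
    show "integrable \<mu> (\<lambda>\<omega>. (avg N f \<omega>)\<^sup>2)"
      by (rule integrable_orbit_bounded[OF orbit_measurable_square[OF om] a2B])
    show "integrable \<mu> (avg N (\<lambda>\<omega>. (f \<omega>)\<^sup>2))"
      by (rule integrable_orbit_bounded[OF orbit_measurable_avg[OF f2 assms(2)] a3B])
    fix \<omega> assume \<omega>: "\<omega> \<in> space \<mu>"
    have i: "integrable (unif N) (\<lambda>y. f (T y \<omega>))" "integrable (unif N) (\<lambda>y. (f (T y \<omega>))\<^sup>2)"
      using orbit_integrable[OF assms(1) \<omega> assms(2) fB] orbit_integrable[OF f2 \<omega> assms(2) f2B] by auto
    show "(avg N f \<omega>)\<^sup>2 \<le> avg N (\<lambda>\<omega>. (f \<omega>)\<^sup>2) \<omega>"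
      using U.variance_positive[of "\<lambda>y. f (T y \<omega>)"] U.variance_eq[OF i] by (simp add: avg_def)
  qed
  also have "\<dots> = (\<integral>\<omega>. (f \<omega>)\<^sup>2 \<partial>\<mu>)"
    by (rule integral_avg[OF f2 assms(2) f2B])
  finally show ?thesis .
qed

end

section \<open>Cauchy property of the averages in L2 and identification of their limit\<close>

context ergodic_flow
begin

lemma avg_add:
  assumes "orbit_measurable f" "orbit_measurable g" "\<omega> \<in> space \<mu>" "N > 0"
    "\<And>\<omega>. \<omega> \<in> space \<mu> \<Longrightarrow> \<bar>f \<omega>\<bar> \<le> B" "\<And>\<omega>. \<omega> \<in> space \<mu> \<Longrightarrow> \<bar>g \<omega>\<bar> \<le> C"
  shows "avg N (\<lambda>\<omega>. f \<omega> + g \<omega>) \<omega> = avg N f \<omega> + avg N g \<omega>"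
  unfolding avg_def
  by (rule Bochner_Integration.integral_add) (rule orbit_integrable, fact+)+

lemma integrable_square_bounded:
  assumes "f \<in> borel_measurable \<mu>" "\<And>\<omega>. \<omega> \<in> space \<mu> \<Longrightarrow> \<bar>f \<omega>\<bar> \<le> (B::real)"
  shows "integrable \<mu> f" "integrable \<mu> (\<lambda>\<omega>. (f \<omega>)\<^sup>2)"
proof -
  show "integrable \<mu> f" using assms by (intro integrable_const_bound[of _ B]) auto
  have "\<bar>(f \<omega>)\<^sup>2\<bar> \<le> B\<^sup>2" if "\<omega> \<in> space \<mu>" for \<omega>
    using power_mono[OF assms(2)[OF that], of 2] by simp
  then show "integrable \<mu> (\<lambda>\<omega>. (f \<omega>)\<^sup>2)" using assms(1) by (intro integrable_const_bound[of _ "B\<^sup>2"]) auto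
qed

text \<open>Cauchy-Schwarz on a probability space, again as nonnegativity of a variance.\<close>

lemma integral_abs_le_sqrt:
  assumes "f \<in> borel_measurable \<mu>" "\<And>\<omega>. \<omega> \<in> space \<mu> \<Longrightarrow> \<bar>f \<omega>\<bar> \<le> (B::real)"
  shows "(\<integral>\<omega>. \<bar>f \<omega>\<bar> \<partial>\<mu>) \<le> sqrt (\<integral>\<omega>. (f \<omega>)\<^sup>2 \<partial>\<mu>)"
proof (rule real_le_rsqrt)
  show "(\<integral>\<omega>. \<bar>f \<omega>\<bar> \<partial>\<mu>)\<^sup>2 \<le> (\<integral>\<omega>. (f \<omega>)\<^sup>2 \<partial>\<mu>)"
    using variance_positive[of "\<lambda>\<omega>. \<bar>f \<omega>\<bar>"] integrable_square_bounded[OF assms]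
    by (subst (asm) variance_eq) auto
qed

text \<open>Factor the difference of squares as sum times difference and contract the average of
  \<open>g\<close>. It is used with \<open>c = 1\<close>, to carry near-minimality from one scale to
  all larger ones, and with \<open>c = 2\<close>, where \<open>g\<close> is a sum of two averages of
  \<open>f\<close>.\<close>

lemma avg_square_le:
  assumes f: "orbit_measurable f" "\<And>\<omega>. \<omega> \<in> space \<mu> \<Longrightarrow> \<bar>f \<omega>\<bar> \<le> B"
    and g: "orbit_measurable g" "\<And>\<omega>. \<omega> \<in> space \<mu> \<Longrightarrow> \<bar>g \<omega>\<bar> \<le> C"
    and "N > 0" "c \<ge> 0"
    and e: "\<And>\<omega>. \<omega> \<in> space \<mu> \<Longrightarrow> \<bar>avg N g \<omega> - c * avg N f \<omega>\<bar> \<le> e"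
  shows "c\<^sup>2 * (\<integral>\<omega>. (avg N f \<omega>)\<^sup>2 \<partial>\<mu>) \<le> (\<integral>\<omega>. (g \<omega>)\<^sup>2 \<partial>\<mu>) + (C + c * B) * e"
proof -
  note fB = avg_bound[OF f(1) _ assms(5) f(2)] and gB = avg_bound[OF g(1) _ assms(5) g(2)]
  note fm = orbit_measurable_imp_measurable[OF orbit_measurable_avg[OF f(1) assms(5)]]
    and gm = orbit_measurable_imp_measurable[OF orbit_measurable_avg[OF g(1) assms(5)]]
  note fi = integrable_square_bounded[OF fm fB] and gi = integrable_square_bounded[OF gm gB]
  have "c\<^sup>2 * (\<integral>\<omega>. (avg N f \<omega>)\<^sup>2 \<partial>\<mu>) = (\<integral>\<omega>. c\<^sup>2 * (avg N f \<omega>)\<^sup>2 \<partial>\<mu>)" by simp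
  also have "\<dots> \<le> (\<integral>\<omega>. (avg N g \<omega>)\<^sup>2 + (C + c * B) * e \<partial>\<mu>)"
  proof (rule Bochner_Integration.integral_mono)
    fix \<omega> assume \<omega>: "\<omega> \<in> space \<mu>"
    let ?a = "c * avg N f \<omega>" and ?b = "avg N g \<omega>"
    have "?a\<^sup>2 - ?b\<^sup>2 = (?a + ?b) * (?a - ?b)" by (simp add: power2_eq_square algebra_simps)
    also have "\<dots> \<le> \<bar>?a + ?b\<bar> * \<bar>?a - ?b\<bar>" by (simp flip: abs_mult)
    also have "\<dots> \<le> (C + c * B) * e"
    proof (rule mult_mono)
      have "\<bar>?a\<bar> \<le> c * B" using fB[OF \<omega>] \<open>c \<ge> 0\<close> by (simp add: abs_mult mult_left_mono)
      then show "\<bar>?a + ?b\<bar> \<le> C + c * B" using gB[OF \<omega>] by linarith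
      then show "0 \<le> C + c * B" by linarith
      show "\<bar>?a - ?b\<bar> \<le> e" using e[OF \<omega>] by linarith
    qed simp
    finally show "c\<^sup>2 * (avg N f \<omega>)\<^sup>2 \<le> (avg N g \<omega>)\<^sup>2 + (C + c * B) * e"
      by (simp add: power_mult_distrib)
  qed (use fi gi in auto)
  also have "\<dots> = (\<integral>\<omega>. (avg N g \<omega>)\<^sup>2 \<partial>\<mu>) + (C + c * B) * e"
    using gi by (simp add: prob_space)
  also have "(\<integral>\<omega>. (avg N g \<omega>)\<^sup>2 \<partial>\<mu>) \<le> (\<integral>\<omega>. (g \<omega>)\<^sup>2 \<partial>\<mu>)"
    by (rule avg_contraction[OF g(1) assms(5) g(2)])
  finally show ?thesis by simp
qed

text \<open>The minimal-norm argument for von Neumann's theorem: with \<open>m\<close> the infimum of the squared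
  norms of the averages, averaging \<open>avg M f + avg K f\<close> once more over a huge cube gives almost
  twice an average of \<open>f\<close>, so its squared norm is at least \<open>4m\<close>; conclude by the parallelogram law.\<close>
lemma avg_Cauchy:
  assumes f: "orbit_measurable f" and fB: "\<And>\<omega>. \<omega> \<in> space \<mu> \<Longrightarrow> \<bar>f \<omega>\<bar> \<le> B" and "\<epsilon> > 0"
  obtains N0 :: nat where "N0 \<ge> 1"
    "\<And>M K. M \<ge> N0 \<Longrightarrow> K \<ge> N0 \<Longrightarrow> (\<integral>\<omega>. (avg (real M) f \<omega> - avg (real K) f \<omega>)\<^sup>2 \<partial>\<mu>) \<le> \<epsilon>"
proof -
  define s where "s N = (\<integral>\<omega>. (avg (real N) f \<omega>)\<^sup>2 \<partial>\<mu>)" for N :: nat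
  define m where "m = Inf (s ` {1..})"
  have bb: "bdd_below (s ` {1..})" unfolding s_def by (intro bdd_belowI[of _ 0]) auto
  have m_le: "m \<le> s N" if "N \<ge> 1" for N
    unfolding m_def by (rule cInf_lower) (use that bb in auto)
  obtain B0 where B0: "B0 \<ge> 0" "\<And>\<omega>. \<omega> \<in> space \<mu> \<Longrightarrow> \<bar>f \<omega>\<bar> \<le> B0"
    using fB not_empty by (metis abs_ge_zero ex_in_conv order_trans)
  define e where "e M N = 2 * B0 * boundary_frac DIM('e) (real M / 2) (real N)" for M N :: nat
  have e_lim: "(\<lambda>N. e M N) \<longlonglongrightarrow> 0" for M
    unfolding e_def
    by (intro tendsto_mult_right_zero filterlim_compose[OF boundary_frac_tendsto filterlim_real_sequentially])
  have eM: "\<bar>avg (real N) (avg (real M) f) \<omega> - avg (real N) f \<omega>\<bar> \<le> e M N"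
    if "M \<ge> 1" "N \<ge> M" "\<omega> \<in> space \<mu>" for M N \<omega>
    unfolding e_def by (rule avg_avg_close[OF f]) (use that B0 in auto)
  have om: "orbit_measurable (avg (real M) f)" if "M \<ge> 1" for M :: nat
    using that by (intro orbit_measurable_avg f) auto
  have bd: "\<bar>avg (real M) f \<omega>\<bar> \<le> B0" if "M \<ge> 1" "\<omega> \<in> space \<mu>" for M :: nat and \<omega>
    using that by (intro avg_bound f B0) auto
  note mi = integrable_square_bounded[OF orbit_measurable_imp_measurable[OF om] bd]
  \<comment> \<open>One error of \<open>\<epsilon> / 8\<close> comes from near-minimality at
    \<open>M1\<close>, another from averaging \<open>avg M1 f\<close> once more. Together they give
    \<open>s N \<le> m + \<epsilon> / 4\<close>, and \<open>2 * s M + 2 * s K - 4 * m\<close> is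
    then at most \<open>\<epsilon>\<close>.\<close>
  have "m < m + \<epsilon> / 8" using \<open>\<epsilon> > 0\<close> by simp
  then obtain M1 where M1: "M1 \<ge> 1" "s M1 < m + \<epsilon> / 8"
    unfolding m_def by (subst (asm) cInf_less_iff) (use bb in auto)
  have "(\<lambda>N. (B0 + 1 * B0) * e M1 N) \<longlonglongrightarrow> 0" by (intro tendsto_mult_right_zero e_lim)
  from order_tendstoD(2)[OF this, of "\<epsilon> / 8"] \<open>\<epsilon> > 0\<close>
  obtain N1 where N1: "\<And>N. N \<ge> N1 \<Longrightarrow> (B0 + 1 * B0) * e M1 N < \<epsilon> / 8"
    unfolding eventually_sequentially by auto
  define N0 where "N0 = max N1 M1"
  have s_le: "s N \<le> m + \<epsilon> / 4" if "N \<ge> N0" for N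
  proof -
    have "1\<^sup>2 * s N \<le> s M1 + (B0 + 1 * B0) * e M1 N"
      unfolding s_def using that M1
      by (intro avg_square_le[OF f B0(2) om bd]) (auto simp: N0_def intro!: eM)
    then show ?thesis using N1[of N] M1 that by (auto simp: N0_def)
  qed
  show ?thesis
  proof (rule that[of N0])
    show "N0 \<ge> 1" using M1 by (simp add: N0_def)
    fix M K assume MK: "M \<ge> N0" "K \<ge> N0"
    then have MK1: "M \<ge> 1" "K \<ge> 1" using M1 by (auto simp: N0_def)
    let ?g = "\<lambda>\<omega>. avg (real M) f \<omega> + avg (real K) f \<omega>"
    have g: "orbit_measurable ?g" by (intro orbit_measurable_add om MK1)
    have gB: "\<bar>?g \<omega>\<bar> \<le> 2 * B0" if "\<omega> \<in> space \<mu>" for \<omega>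
      using bd[OF MK1(1) that] bd[OF MK1(2) that] by linarith
    \<comment> \<open>\<open>N\<close> is an auxiliary scale. It tends to infinity with
      \<open>M\<close> and \<open>K\<close> fixed, which removes the error term.\<close>
    have "4 * m \<le> (\<integral>\<omega>. (?g \<omega>)\<^sup>2 \<partial>\<mu>) + (2 * B0 + 2 * B0) * (e M N + e K N)" if "N \<ge> max M K" for N
    proof -
      have N: "N \<ge> M" "N \<ge> K" "N \<ge> 1" using that MK1 by auto
      have "2\<^sup>2 * (\<integral>\<omega>. (avg (real N) f \<omega>)\<^sup>2 \<partial>\<mu>) \<le> (\<integral>\<omega>. (?g \<omega>)\<^sup>2 \<partial>\<mu>) + (2 * B0 + 2 * B0) * (e M N + e K N)"
      proof (rule avg_square_le[OF f B0(2) g gB])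
        fix \<omega> assume \<omega>: "\<omega> \<in> space \<mu>"
        have "avg (real N) ?g \<omega> = avg (real N) (avg (real M) f) \<omega> + avg (real N) (avg (real K) f) \<omega>"
          using N by (intro avg_add[OF om[OF MK1(1)] om[OF MK1(2)] \<omega> _ bd[OF MK1(1)] bd[OF MK1(2)]]) auto
        then show "\<bar>avg (real N) ?g \<omega> - 2 * avg (real N) f \<omega>\<bar> \<le> e M N + e K N"
          using eM[OF MK1(1) N(1) \<omega>] eM[OF MK1(2) N(2) \<omega>] by linarith
      qed (use N in auto)
      then show ?thesis using m_le[OF N(3)] by (simp add: s_def)
    qed
    then have "\<forall>\<^sub>F N in sequentially. 4 * m \<le> (\<integral>\<omega>. (?g \<omega>)\<^sup>2 \<partial>\<mu>) + (2 * B0 + 2 * B0) * (e M N + e K N)"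
      unfolding eventually_sequentially by blast
    moreover have "(\<lambda>N. (\<integral>\<omega>. (?g \<omega>)\<^sup>2 \<partial>\<mu>) + (2 * B0 + 2 * B0) * (e M N + e K N)) \<longlonglongrightarrow> (\<integral>\<omega>. (?g \<omega>)\<^sup>2 \<partial>\<mu>) + (2 * B0 + 2 * B0) * (0 + 0)"
      by (intro tendsto_add tendsto_mult tendsto_const e_lim)
    ultimately have g4: "4 * m \<le> (\<integral>\<omega>. (?g \<omega>)\<^sup>2 \<partial>\<mu>)"
      using tendsto_lowerbound[of _ _ sequentially "4 * m"] by fastforce
    have "(\<integral>\<omega>. (avg (real M) f \<omega> - avg (real K) f \<omega>)\<^sup>2 \<partial>\<mu>)
      = (\<integral>\<omega>. 2 * (avg (real M) f \<omega>)\<^sup>2 + 2 * (avg (real K) f \<omega>)\<^sup>2 - (?g \<omega>)\<^sup>2 \<partial>\<mu>)"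
      by (intro Bochner_Integration.integral_cong) (auto simp: power2_eq_square algebra_simps)
    also have "\<dots> = 2 * s M + 2 * s K - (\<integral>\<omega>. (?g \<omega>)\<^sup>2 \<partial>\<mu>)"
      using mi[OF MK1(1) MK1(1)] mi[OF MK1(2) MK1(2)] integrable_square_bounded[OF orbit_measurable_imp_measurable[OF g] gB]
      by (simp add: s_def)
    also have "\<dots> \<le> \<epsilon>" using s_le[OF MK(1)] s_le[OF MK(2)] g4 by linarith
    finally show "(\<integral>\<omega>. (avg (real M) f \<omega> - avg (real K) f \<omega>)\<^sup>2 \<partial>\<mu>) \<le> \<epsilon>" .
  qed
qed

text \<open>Ergodicity is applied to the sets where \<open>L\<close> lies strictly above or strictly
  below its mean. If one of them had probability one, a function of mean zero would be positive
  almost surely.\<close>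

lemma invariant_AE_const:
  fixes L :: "'a \<Rightarrow> real"
  assumes L [measurable]: "L \<in> borel_measurable \<mu>" and int: "integrable \<mu> L"
    and inv: "\<And>x \<omega>. \<omega> \<in> space \<mu> \<Longrightarrow> L (T x \<omega>) = L \<omega>"
  shows "AE \<omega> in \<mu>. L \<omega> = expectation L"
proof -
  let ?c = "expectation L"
  have nolt: "prob {\<omega> \<in> space \<mu>. h \<omega> > 0} = 0"
    if [measurable]: "h \<in> borel_measurable \<mu>" and hi: "integrable \<mu> h" "expectation h = 0"
      and hinv: "\<And>x \<omega>. \<omega> \<in> space \<mu> \<Longrightarrow> h (T x \<omega>) = h \<omega>" for h :: "'a \<Rightarrow> real"
  proof (rule ccontr)
    let ?A = "{\<omega> \<in> space \<mu>. h \<omega> > 0}"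
    assume "prob ?A \<noteq> 0"
    moreover have "prob ?A = 0 \<or> prob ?A = 1"
      by (rule ergodic) (auto simp: hinv T_space)
    ultimately have "prob ?A = 1" by blast
    then have ae: "AE \<omega> in \<mu>. h \<omega> > 0" using prob_eq_1[of ?A] by simp
    then have "AE \<omega> in \<mu>. 0 \<le> h \<omega>" by eventually_elim simp
    from integral_nonneg_eq_0_iff_AE[OF hi(1) this] hi(2) have "AE \<omega> in \<mu>. h \<omega> = 0" by simp
    with ae have "AE \<omega> in \<mu>. False" by eventually_elim simp
    then show False by simp
  qed
  have "prob {\<omega> \<in> space \<mu>. L \<omega> - ?c > 0} = 0" "prob {\<omega> \<in> space \<mu>. ?c - L \<omega> > 0} = 0"
    using nolt[of "\<lambda>\<omega>. L \<omega> - ?c"] nolt[of "\<lambda>\<omega>. ?c - L \<omega>"] int by (simp_all add: inv prob_space)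
  then have "AE \<omega> in \<mu>. \<not> (L \<omega> - ?c > 0)" "AE \<omega> in \<mu>. \<not> (?c - L \<omega> > 0)"
    by (auto simp: AE_iff_measurable[OF _ refl] emeasure_eq_measure)
  then show ?thesis by eventually_elim auto
qed

text \<open>An L2 limit is determined only up to null sets, while ergodicity is available for
  strictly invariant sets. Hence a rapidly converging subsequence is chosen, whose pointwise limit
  can be made invariant at every point; its mean is that of \<open>f\<close> by dominated
  convergence.\<close>

theorem mean_ergodic:
  assumes f: "orbit_measurable f" and fB: "\<And>\<omega>. \<omega> \<in> space \<mu> \<Longrightarrow> \<bar>f \<omega>\<bar> \<le> B"
  shows "(\<lambda>N. \<integral>\<omega>. \<bar>avg (real N) f \<omega> - expectation f\<bar> \<partial>\<mu>) \<longlonglongrightarrow> 0"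
proof -
  \<comment> \<open>The square root turns \<open>(1/4) ^ j\<close> into the summable L1 bound
    \<open>(1/2) ^ j\<close>.\<close>
  have "\<exists>N0\<ge>1. \<forall>M K. M \<ge> N0 \<longrightarrow> K \<ge> N0 \<longrightarrow> (\<integral>\<omega>. (avg (real M) f \<omega> - avg (real K) f \<omega>)\<^sup>2 \<partial>\<mu>) \<le> (1/4) ^ j" for j :: nat
    by (rule avg_Cauchy[OF f fB, of "(1/4)^j"]) auto
  then obtain N0 :: "nat \<Rightarrow> nat" where N0: "\<And>j. N0 j \<ge> 1"
    "\<And>j M K. M \<ge> N0 j \<Longrightarrow> K \<ge> N0 j \<Longrightarrow> (\<integral>\<omega>. (avg (real M) f \<omega> - avg (real K) f \<omega>)\<^sup>2 \<partial>\<mu>) \<le> (1/4) ^ j"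
    by metis
  \<comment> \<open>Partial sums make \<open>M j\<close> increasing, at least \<open>N0 j\<close>,
    and larger than \<open>j\<close>.\<close>
  define M where "M j = (\<Sum>i\<le>j. N0 i)" for j
  have M_ge: "N0 j \<le> M j" for j unfolding M_def by (rule member_le_sum) auto
  have M_Suc: "M (Suc j) = M j + N0 (Suc j)" for j by (simp add: M_def)
  have M_gt: "j < M j" for j
  proof (induction j)
    case 0
    then show ?case using N0(1)[of 0] by (simp add: M_def)
  next
    case (Suc j)
    then show ?case using N0(1)[of "Suc j"] by (simp add: M_Suc)
  qed
  have M1: "M j \<ge> 1" for j using M_gt[of j] by linarith
  define X where "X j = avg (real (M j)) f" for j
  have Xom: "orbit_measurable (X j)" for j unfolding X_def using M1[of j] by (intro orbit_measurable_avg f) auto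
  note Xm [measurable] = orbit_measurable_imp_measurable[OF Xom]
  have XB: "\<bar>X j \<omega>\<bar> \<le> B" if "\<omega> \<in> space \<mu>" for j \<omega>
    unfolding X_def using M1[of j] that by (intro avg_bound[OF f _ _ fB]) auto
  define d where "d j \<omega> = \<bar>X (Suc j) \<omega> - X j \<omega>\<bar>" for j \<omega>
  have dm [measurable]: "d j \<in> borel_measurable \<mu>" for j unfolding d_def by measurable
  have dB: "\<bar>X (Suc j) \<omega> - X j \<omega>\<bar> \<le> 2 * B" if "\<omega> \<in> space \<mu>" for j \<omega>
    using XB[OF that, of j] XB[OF that, of "Suc j"] by linarith
  have d_int: "expectation (d j) \<le> (1/2) ^ j" for j
  proof -
    have "expectation (d j) \<le> sqrt (\<integral>\<omega>. (X (Suc j) \<omega> - X j \<omega>)\<^sup>2 \<partial>\<mu>)"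
      unfolding d_def by (rule integral_abs_le_sqrt[OF _ dB]) measurable
    also have "\<dots> \<le> sqrt ((1/4) ^ j)"
      unfolding X_def using M_ge[of j] M_Suc[of j] by (intro real_sqrt_le_mono N0(2)) auto
    also have "(1/4::real) ^ j = ((1/2) ^ j)\<^sup>2" by (simp add: power2_eq_square flip: power_mult_distrib)
    finally show ?thesis by simp
  qed
  \<comment> \<open>The expected total variation of the subsequence is finite, so its increments are
    absolutely summable almost everywhere.\<close>
  have "(\<integral>\<^sup>+\<omega>. (\<Sum>j. ennreal (d j \<omega>)) \<partial>\<mu>) = (\<Sum>j. \<integral>\<^sup>+\<omega>. ennreal (d j \<omega>) \<partial>\<mu>)"
    by (rule nn_integral_suminf) measurable
  also have "\<dots> = (\<Sum>j. ennreal (expectation (d j)))"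
  proof (intro suminf_cong nn_integral_eq_integral)
    show "integrable \<mu> (d j)" for j
      unfolding d_def by (intro integrable_abs integrable_square_bounded(1)[OF _ dB]) measurable
  qed (auto simp: d_def)
  also have "\<dots> \<le> (\<Sum>j. ennreal ((1/2) ^ j))"
    by (intro suminf_le ennreal_leI d_int) auto
  also have "\<dots> = ennreal (\<Sum>j. (1/2) ^ j)" by (rule suminf_ennreal2) auto
  also have "\<dots> < \<infinity>" by simp
  finally have "(\<integral>\<^sup>+\<omega>. (\<Sum>j. ennreal (d j \<omega>)) \<partial>\<mu>) \<noteq> \<infinity>" by simp
  then have "AE \<omega> in \<mu>. (\<Sum>j. ennreal (d j \<omega>)) \<noteq> \<infinity>" by (intro nn_integral_PInf_AE) auto
  then have X_conv: "AE \<omega> in \<mu>. convergent (\<lambda>j. X j \<omega>)"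
  proof eventually_elim
    case (elim \<omega>)
    then have "summable (\<lambda>j. d j \<omega>)" by (intro summable_suminf_not_top) (auto simp: d_def)
    then have "summable (\<lambda>j. X (Suc j) \<omega> - X j \<omega>)" unfolding d_def by (rule summable_rabs_cancel)
    then have "convergent (\<lambda>n. \<Sum>j<n. X (Suc j) \<omega> - X j \<omega>)" by (simp add: summable_iff_convergent)
    then have "convergent (\<lambda>n. X n \<omega> - X 0 \<omega>)" by (simp only: sum_lessThan_telescope[of "\<lambda>n. X n \<omega>"])
    then have "convergent (\<lambda>n. (X n \<omega> - X 0 \<omega>) + X 0 \<omega>)" by (rule convergent_add[OF _ convergent_const])
    then show ?case by simp
  qed
  define L where "L \<omega> = lim (\<lambda>j. X j \<omega>)" for \<omega>
  have Lm [measurable]: "L \<in> borel_measurable \<mu>" unfolding L_def by measurable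
  have XL: "AE \<omega> in \<mu>. (\<lambda>j. X j \<omega>) \<longlonglongrightarrow> L \<omega>"
    using X_conv by eventually_elim (simp add: L_def convergent_LIMSEQ_iff)
  have LB: "AE \<omega> in \<mu>. \<bar>L \<omega>\<bar> \<le> B"
    using XL AE_space
  proof eventually_elim
    case (elim \<omega>)
    show ?case
      by (rule tendsto_upperbound[OF tendsto_rabs[OF elim(1)]]) (use XB[OF elim(2)] in auto)
  qed
  have Linv: "L (T x \<omega>) = L \<omega>" if \<omega>: "\<omega> \<in> space \<mu>" for x \<omega>
  proof -
    have "(\<lambda>j. X j (T x \<omega>) - X j \<omega>) \<longlonglongrightarrow> 0"
    proof (rule Lim_null_comparison)
      have rM: "filterlim (\<lambda>j. real (M j)) at_top sequentially"
        by (rule filterlim_at_top_mono[OF filterlim_real_sequentially]) (use M_gt in \<open>auto intro!: always_eventually less_imp_le\<close>)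
      show "(\<lambda>j. 2 * B * boundary_frac DIM('e) (norm x) (real (M j))) \<longlonglongrightarrow> 0"
        by (intro tendsto_mult_right_zero filterlim_compose[OF boundary_frac_tendsto rM])
      have "\<forall>\<^sub>F j in sequentially. real (M j) \<ge> 2 * norm x"
        using rM by (simp add: filterlim_at_top)
      then show "\<forall>\<^sub>F j in sequentially. norm (X j (T x \<omega>) - X j \<omega>) \<le> 2 * B * boundary_frac DIM('e) (norm x) (real (M j))"
      proof eventually_elim
        case (elim j)
        then show ?case
          unfolding X_def real_norm_def using M1[of j] by (intro avg_shift f \<omega> fB) (auto simp: Basis_le_norm)
      qed
    qed
    \<comment> \<open>Both sequences have the same limits, so \<open>lim\<close> returns the same
      value for both even where neither converges. This is why \<open>L\<close> is invariant
      everywhere.\<close>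
    then have "(\<lambda>j. X j (T x \<omega>)) \<longlonglongrightarrow> l \<longleftrightarrow> (\<lambda>j. X j \<omega>) \<longlonglongrightarrow> l" for l
      by (rule Lim_transform_eq)
    then show ?thesis by (simp add: L_def lim_def)
  qed
  have Li: "integrable \<mu> L" using LB by (intro integrable_const_bound[of _ B]) auto
  have "(\<lambda>j. expectation (X j)) \<longlonglongrightarrow> expectation L"
    by (rule integral_dominated_convergence[where w = "\<lambda>_. B"]) (use XL XB in auto)
  moreover have "expectation (X j) = expectation f" for j
    unfolding X_def using M1[of j] by (intro integral_avg[OF f _ fB]) auto
  ultimately have "expectation L = expectation f" by (simp add: LIMSEQ_const_iff)
  with invariant_AE_const[OF Lm Li Linv] have Lc: "AE \<omega> in \<mu>. L \<omega> = expectation f" by simp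
  have Xc: "(\<lambda>j. expectation (\<lambda>\<omega>. \<bar>X j \<omega> - expectation f\<bar>)) \<longlonglongrightarrow> expectation (\<lambda>\<omega>. 0)"
  proof (rule integral_dominated_convergence[where w = "\<lambda>_. B + \<bar>expectation f\<bar>"])
    show "AE \<omega> in \<mu>. (\<lambda>j. \<bar>X j \<omega> - expectation f\<bar>) \<longlonglongrightarrow> 0"
      using XL Lc
    proof eventually_elim
      case (elim \<omega>)
      then show ?case by (simp add: LIM_zero_iff tendsto_rabs_zero_iff)
    qed
    show "AE \<omega> in \<mu>. norm \<bar>X j \<omega> - expectation f\<bar> \<le> B + \<bar>expectation f\<bar>" for j
    proof (rule AE_I2)
      fix \<omega> assume "\<omega> \<in> space \<mu>"
      then show "norm \<bar>X j \<omega> - expectation f\<bar> \<le> B + \<bar>expectation f\<bar>"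
        using XB[of \<omega> j] by simp
    qed
  qed auto
  \<comment> \<open>The Cauchy bound compares every late average with a member of the subsequence,
    which extends the L1 convergence to all \<open>N\<close>.\<close>
  have "\<forall>\<^sub>F N in sequentially. expectation (\<lambda>\<omega>. \<bar>avg (real N) f \<omega> - expectation f\<bar>) < \<epsilon>" if "\<epsilon> > 0" for \<epsilon>
  proof -
    have "(\<lambda>j. (1/2::real) ^ j) \<longlonglongrightarrow> 0" by (rule LIMSEQ_realpow_zero) auto
    then have "(\<lambda>j. (1/2) ^ j + expectation (\<lambda>\<omega>. \<bar>X j \<omega> - expectation f\<bar>)) \<longlonglongrightarrow> 0 + 0"
      using Xc by (intro tendsto_add) auto
    from order_tendstoD(2)[OF this, of \<epsilon>] that
    obtain j where j: "(1/2) ^ j + expectation (\<lambda>\<omega>. \<bar>X j \<omega> - expectation f\<bar>) < \<epsilon>"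
      unfolding eventually_sequentially by auto
    have "expectation (\<lambda>\<omega>. \<bar>avg (real N) f \<omega> - expectation f\<bar>) < \<epsilon>" if "N \<ge> N0 j" for N
    proof -
      have N: "N > 0" using that N0(1)[of j] by linarith
      have [measurable]: "avg (real N) f \<in> borel_measurable \<mu>"
        using N by (intro orbit_measurable_imp_measurable orbit_measurable_avg f) auto
      have aB: "\<bar>avg (real N) f \<omega>\<bar> \<le> B" if "\<omega> \<in> space \<mu>" for \<omega>
        using N by (intro avg_bound[OF f that _ fB]) auto
      have daB: "\<bar>avg (real N) f \<omega> - X j \<omega>\<bar> \<le> 2 * B" if "\<omega> \<in> space \<mu>" for \<omega>
        using XB[OF that, of j] aB[OF that] by linarith
      have i: "integrable \<mu> (avg (real N) f)" "integrable \<mu> (X j)"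
        by (rule integrable_square_bounded(1)[OF _ aB], measurable) (rule integrable_square_bounded(1)[OF Xm XB])
      have "expectation (\<lambda>\<omega>. \<bar>avg (real N) f \<omega> - expectation f\<bar>)
          \<le> expectation (\<lambda>\<omega>. \<bar>avg (real N) f \<omega> - X j \<omega>\<bar> + \<bar>X j \<omega> - expectation f\<bar>)"
        using i by (intro Bochner_Integration.integral_mono) auto
      also have "\<dots> = expectation (\<lambda>\<omega>. \<bar>avg (real N) f \<omega> - X j \<omega>\<bar>) + expectation (\<lambda>\<omega>. \<bar>X j \<omega> - expectation f\<bar>)"
        using i by (intro Bochner_Integration.integral_add) auto
      also have "expectation (\<lambda>\<omega>. \<bar>avg (real N) f \<omega> - X j \<omega>\<bar>) \<le> sqrt (\<integral>\<omega>. (avg (real N) f \<omega> - X j \<omega>)\<^sup>2 \<partial>\<mu>)"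
        by (rule integral_abs_le_sqrt[OF _ daB]) measurable
      also have "\<dots> \<le> sqrt ((1/4) ^ j)"
        unfolding X_def using M_ge[of j] that by (intro real_sqrt_le_mono N0(2)) auto
      also have "(1/4::real) ^ j = ((1/2) ^ j)\<^sup>2" by (simp add: power2_eq_square flip: power_mult_distrib)
      finally show ?thesis using j by simp
    qed
    then show ?thesis unfolding eventually_sequentially by blast
  qed
  moreover have "a < expectation (\<lambda>\<omega>. \<bar>avg (real N) f \<omega> - expectation f\<bar>)" if "a < 0" for a N
    by (rule less_le_trans[OF that Bochner_Integration.integral_nonneg]) simp
  ultimately show ?thesis
    by (intro order_tendstoI) (auto intro: always_eventually)
qed

end

section \<open>The \<open>C\<^sup>1\<close> topology\<close>

definition C1_deriv :: "('e::euclidean_space \<Rightarrow> 'v::euclidean_space) \<Rightarrow> ('e \<Rightarrow> 'e \<Rightarrow>\<^sub>L 'v) \<Rightarrow> bool" where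
  "C1_deriv f D \<longleftrightarrow> (\<forall>x. (f has_derivative blinfun_apply (D x)) (at x)) \<and> continuous_on UNIV D"

definition C1_maps :: "('e::euclidean_space \<Rightarrow> 'v::euclidean_space) set" where
  "C1_maps = {f. \<exists>D. C1_deriv f D}"

text \<open>On the diagonal the difference quotient is \<open>0 / 0 = 0\<close>.\<close>
definition slope :: "('e::euclidean_space \<Rightarrow> 'v::euclidean_space) \<Rightarrow> 'e \<times> 'e \<Rightarrow> real" where
  "slope f p = max (norm (f (fst p))) (norm (f (fst p) - f (snd p)) / norm (fst p - snd p))"

text \<open>A norm for the \<open>C\<^sup>1\<close> topology on balls that mentions no derivative: its superlevel sets are
  open for locally uniform convergence.\<close>
definition c1norm :: "nat \<Rightarrow> ('e::euclidean_space \<Rightarrow> 'v::euclidean_space) \<Rightarrow> real" where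
  "c1norm K f = (SUP p\<in>cball 0 (real K) \<times> cball 0 (real K). slope f p)"

lemma C1_deriv_continuous: "C1_deriv f D \<Longrightarrow> continuous_on UNIV f"
  unfolding C1_deriv_def by (meson has_derivative_continuous continuous_at_imp_continuous_on)

lemma C1_maps_continuous: "f \<in> C1_maps \<Longrightarrow> continuous_on UNIV f"
  using C1_deriv_continuous by (auto simp: C1_maps_def)

lemma C1_deriv_diff: "C1_deriv f D \<Longrightarrow> C1_deriv g E \<Longrightarrow> C1_deriv (\<lambda>x. f x - g x) (\<lambda>x. D x - E x)"
  unfolding C1_deriv_def
  by (auto intro!: continuous_intros derivative_eq_intros simp: blinfun.diff_left)

lemma C1_maps_diff: "f \<in> C1_maps \<Longrightarrow> g \<in> C1_maps \<Longrightarrow> (\<lambda>x. f x - g x) \<in> C1_maps"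
  using C1_deriv_diff by (fastforce simp: C1_maps_def)

lemma C1_deriv_shift:
  assumes "C1_deriv f D" shows "C1_deriv (\<lambda>x. f (a + x)) (\<lambda>x. D (a + x))"
  unfolding C1_deriv_def
proof (intro conjI allI)
  fix x
  have "((\<lambda>x. a + x) has_derivative (\<lambda>h. h)) (at x)" by (auto intro!: derivative_eq_intros)
  from has_derivative_compose[OF this, of f "blinfun_apply (D (a + x))"]
  show "((\<lambda>x. f (a + x)) has_derivative blinfun_apply (D (a + x))) (at x)"
    using assms by (auto simp: C1_deriv_def)
  show "continuous_on UNIV (\<lambda>x. D (a + x))"
    by (rule continuous_on_compose2[of UNIV D]) (use assms in \<open>auto simp: C1_deriv_def intro!: continuous_intros\<close>)
qed

lemma C1_maps_shift: "f \<in> C1_maps \<Longrightarrow> (\<lambda>x. f (a + x)) \<in> C1_maps"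
  using C1_deriv_shift by (fastforce simp: C1_maps_def)

lemma slope_nonneg: "0 \<le> slope f p"
  unfolding slope_def by (simp add: le_max_iff_disj)

text \<open>The mean value inequality on the ball, which is convex.\<close>

lemma slope_le_C1:
  assumes f: "C1_deriv f D" and "\<And>x. x \<in> cball 0 R \<Longrightarrow> norm (f x) \<le> e" "\<And>x. x \<in> cball 0 R \<Longrightarrow> norm (D x) \<le> e"
    and p: "p \<in> cball 0 R \<times> cball 0 R"
  shows "slope f p \<le> e"
proof -
  have xy: "fst p \<in> cball 0 R" "snd p \<in> cball 0 R" using p by auto
  have "norm (f (fst p) - f (snd p)) \<le> e * norm (fst p - snd p)"
  proof (rule differentiable_bound[of "cball 0 R" f "\<lambda>x. blinfun_apply (D x)"])
    show "(f has_derivative blinfun_apply (D x)) (at x within cball 0 R)" for x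
      using f by (auto simp: C1_deriv_def intro: has_derivative_at_withinI)
    show "onorm (blinfun_apply (D x)) \<le> e" if "x \<in> cball 0 R" for x
      using assms(3)[OF that] by (simp add: norm_blinfun.rep_eq)
  qed (use xy in auto)
  moreover have "0 \<le> e" using assms(2)[OF xy(1)] norm_ge_zero order_trans by blast
  ultimately show ?thesis
    unfolding slope_def using assms(2)[OF xy(1)] by (auto simp: divide_le_eq)
qed

lemma c1norm_le:
  "(\<And>p. p \<in> cball 0 (real K) \<times> cball 0 (real K) \<Longrightarrow> slope f p \<le> e) \<Longrightarrow> c1norm K f \<le> e"
  unfolding c1norm_def by (rule cSUP_least) auto

lemma bdd_above_slope:
  assumes "f \<in> C1_maps"
  shows "bdd_above (slope f ` (cball 0 R \<times> cball 0 R))"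
proof -
  obtain D where D: "C1_deriv f D" using assms by (auto simp: C1_maps_def)
  have "compact (f ` cball 0 R)" "compact (D ` cball 0 R)"
    using D C1_deriv_continuous[OF D] unfolding C1_deriv_def
    by (auto intro!: compact_continuous_image intro: continuous_on_subset)
  then have "bounded (f ` cball 0 R)" "bounded (D ` cball 0 R)" by (simp_all add: compact_imp_bounded)
  then obtain a b where ab: "\<And>x. x \<in> cball 0 R \<Longrightarrow> norm (f x) \<le> a" "\<And>x. x \<in> cball 0 R \<Longrightarrow> norm (D x) \<le> b"
    unfolding bounded_iff by blast
  show ?thesis
  proof (rule bdd_aboveI2)
    fix p :: "'a \<times> 'a" assume p: "p \<in> cball 0 R \<times> cball 0 R"
    show "slope f p \<le> max a b"
      by (rule slope_le_C1[OF D _ _ p]) (use ab in \<open>auto simp: le_max_iff_disj\<close>)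
  qed
qed

lemma slope_le_c1norm:
  "f \<in> C1_maps \<Longrightarrow> p \<in> cball 0 (real K) \<times> cball 0 (real K) \<Longrightarrow> slope f p \<le> c1norm K f"
  unfolding c1norm_def by (rule cSUP_upper[OF _ bdd_above_slope])

text \<open>The source of measurability: one pair of points witnesses a strict lower bound. Being C1
  makes the slopes bounded, so that the supremum is a genuine one.\<close>

lemma c1norm_greater_iff:
  "f \<in> C1_maps \<Longrightarrow> q < c1norm K f \<longleftrightarrow> (\<exists>p\<in>cball 0 (real K) \<times> cball 0 (real K). q < slope f p)"
  unfolding c1norm_def by (rule less_cSUP_iff[OF _ bdd_above_slope]) auto

lemma c1norm_nonneg: "f \<in> C1_maps \<Longrightarrow> 0 \<le> c1norm K f"
  using slope_le_c1norm[of f "(0, 0)" K] slope_nonneg[of f "(0,0)"] by (force intro: order_trans)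

lemma c1norm_mono: "f \<in> C1_maps \<Longrightarrow> K \<le> L \<Longrightarrow> c1norm K f \<le> c1norm L f"
  by (rule c1norm_le, rule slope_le_c1norm) auto

text \<open>The locality on which periodization relies: no value outside the ball enters, not even
  through a derivative at its boundary.\<close>

lemma c1norm_cong:
  assumes "\<And>x. x \<in> cball 0 (real K) \<Longrightarrow> f x = g x" shows "c1norm K f = c1norm K g"
  unfolding c1norm_def slope_def using assms by (intro SUP_cong) auto

lemma c1norm_minus_commute: "c1norm K (\<lambda>x. f x - g x) = c1norm K (\<lambda>x. g x - f x)"
proof -
  have "f x - g x - (f y - g y) = - (g x - f x - (g y - f y))" for x y by simp
  then show ?thesis unfolding c1norm_def slope_def by (metis (no_types, lifting) norm_minus_commute norm_minus_cancel)
qed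

lemma c1norm_triangle:
  assumes "f \<in> C1_maps" "g \<in> C1_maps" "h \<in> C1_maps"
  shows "c1norm K (\<lambda>x. f x - g x) \<le> c1norm K (\<lambda>x. f x - h x) + c1norm K (\<lambda>x. h x - g x)"
proof (rule c1norm_le)
  fix p :: "'a \<times> 'a" assume p: "p \<in> cball 0 (real K) \<times> cball 0 (real K)"
  let ?x = "fst p" and ?y = "snd p"
  let ?u = "\<lambda>x. f x - h x" and ?v = "\<lambda>x. h x - g x"
  have a: "slope ?u p \<le> c1norm K ?u" "slope ?v p \<le> c1norm K ?v"
    by (intro slope_le_c1norm C1_maps_diff assms p)+
  have "norm (f ?x - g ?x) \<le> norm (?u ?x) + norm (?v ?x)"
    using norm_triangle_ineq[of "?u ?x" "?v ?x"] by simp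
  moreover have "norm (f ?x - g ?x - (f ?y - g ?y)) \<le> norm (?u ?x - ?u ?y) + norm (?v ?x - ?v ?y)"
    using norm_triangle_ineq[of "?u ?x - ?u ?y" "?v ?x - ?v ?y"] by (simp add: algebra_simps)
  then have "norm (f ?x - g ?x - (f ?y - g ?y)) / norm (?x - ?y)
      \<le> norm (?u ?x - ?u ?y) / norm (?x - ?y) + norm (?v ?x - ?v ?y) / norm (?x - ?y)"
    by (simp add: divide_right_mono flip: add_divide_distrib)
  ultimately have "slope (\<lambda>x. f x - g x) p \<le> slope ?u p + slope ?v p"
    unfolding slope_def by (smt (verit))
  then show "slope (\<lambda>x. f x - g x) p \<le> c1norm K ?u + c1norm K ?v" using a by linarith
qed

text \<open>The derivative in direction \<open>v\<close> is a limit of difference quotients between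
  \<open>x\<close> and \<open>x + t v\<close>. The radius grows by one so that these points stay in
  the ball when \<open>x\<close> lies on the smaller sphere.\<close>

lemma deriv_norm_le_c1norm:
  assumes f: "C1_deriv f D" and x: "x \<in> cball 0 (real K)"
  shows "norm (D x) \<le> c1norm (Suc K) f"
proof (rule norm_blinfun_bound)
  have fC: "f \<in> C1_maps" using f by (auto simp: C1_maps_def)
  show "0 \<le> c1norm (Suc K) f" by (rule c1norm_nonneg[OF fC])
  fix v
  have "((\<lambda>t. x + t *\<^sub>R v) has_derivative (\<lambda>t. t *\<^sub>R v)) (at 0)"
    by (auto intro!: derivative_eq_intros)
  from has_derivative_compose[OF this, of f "blinfun_apply (D x)"]
  have "((\<lambda>t. f (x + t *\<^sub>R v)) has_derivative (\<lambda>t. t *\<^sub>R D x v)) (at 0)"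
    using f by (simp add: C1_deriv_def blinfun.scaleR_right)
  then have "((\<lambda>t. norm (f (x + t *\<^sub>R v) - f x - t *\<^sub>R D x v) / norm t) \<longlongrightarrow> 0) (at 0)"
    by (simp add: has_derivative_at)
  moreover have "norm (f (x + t *\<^sub>R v) - f x - t *\<^sub>R D x v) / norm t = norm ((f (x + t *\<^sub>R v) - f x) /\<^sub>R t - D x v)"
    if "t \<noteq> 0" for t
  proof -
    have "(f (x + t *\<^sub>R v) - f x) /\<^sub>R t - D x v = (f (x + t *\<^sub>R v) - f x - t *\<^sub>R D x v) /\<^sub>R t"
      using that by (simp add: scaleR_diff_right)
    then show ?thesis by (simp add: divide_inverse mult.commute)
  qed
  then have "\<forall>\<^sub>F t in at 0. norm (f (x + t *\<^sub>R v) - f x - t *\<^sub>R D x v) / norm t = norm ((f (x + t *\<^sub>R v) - f x) /\<^sub>R t - D x v)"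
    by (simp add: eventually_at_filter)
  ultimately have "((\<lambda>t. norm ((f (x + t *\<^sub>R v) - f x) /\<^sub>R t - D x v)) \<longlongrightarrow> 0) (at 0)"
    by (rule Lim_transform_eventually)
  then have "((\<lambda>t. (f (x + t *\<^sub>R v) - f x) /\<^sub>R t) \<longlongrightarrow> D x v) (at 0)"
    by (simp add: tendsto_norm_zero_iff LIM_zero_iff)
  then have lim: "((\<lambda>t. norm ((f (x + t *\<^sub>R v) - f x) /\<^sub>R t)) \<longlongrightarrow> norm (D x v)) (at 0)"
    by (rule tendsto_norm)
  have "((\<lambda>t. norm (t *\<^sub>R v)) \<longlongrightarrow> norm (0 *\<^sub>R v)) (at (0::real))"
    by (intro tendsto_intros)
  from order_tendstoD(2)[OF this, of 1]
  have "\<forall>\<^sub>F t in at (0::real). norm (t *\<^sub>R v) < 1" by simp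
  moreover have "\<forall>\<^sub>F t in at (0::real). t \<noteq> 0" by (simp add: eventually_at_filter)
  ultimately have "\<forall>\<^sub>F t in at (0::real). norm ((f (x + t *\<^sub>R v) - f x) /\<^sub>R t) \<le> c1norm (Suc K) f * norm v"
  proof eventually_elim
    case (elim t)
    have "norm (x + t *\<^sub>R v) \<le> real (Suc K)"
      using norm_triangle_ineq[of x "t *\<^sub>R v"] elim x by simp
    then have "slope f (x + t *\<^sub>R v, x) \<le> c1norm (Suc K) f"
      using x by (intro slope_le_c1norm fC) auto
    then have "norm (f (x + t *\<^sub>R v) - f x) / norm (t *\<^sub>R v) \<le> c1norm (Suc K) f"
      by (simp add: slope_def)
    then have "norm (f (x + t *\<^sub>R v) - f x) \<le> c1norm (Suc K) f * norm (t *\<^sub>R v)"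
      using elim(2) by (cases "v = 0") (auto simp: divide_le_eq)
    moreover have "norm ((f (x + t *\<^sub>R v) - f x) /\<^sub>R t) = norm (f (x + t *\<^sub>R v) - f x) / \<bar>t\<bar>"
      by (simp add: divide_inverse mult.commute)
    ultimately show ?case using elim(2) by (simp add: pos_divide_le_eq ac_simps)
  qed
  then show "norm (D x v) \<le> c1norm (Suc K) f * norm v"
    by (rule tendsto_upperbound[OF lim]) simp
qed

text \<open>A C1 map and its derivative are uniformly continuous on compact balls, and
  \<open>slope_le_C1\<close> combines the two moduli.\<close>

lemma c1norm_shift_tendsto:
  assumes f: "f \<in> C1_maps"
  shows "((\<lambda>y. c1norm K (\<lambda>x. f (y + x) - f (y0 + x))) \<longlongrightarrow> 0) (at y0)"
proof (rule tendstoI)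
  fix e :: real assume e: "e > 0"
  obtain D where D: "C1_deriv f D" using f by (auto simp: C1_maps_def)
  \<comment> \<open>This ball contains \<open>y + x\<close> whenever \<open>y\<close> is within
    \<open>1\<close> of \<open>y0\<close> and \<open>x\<close> has norm at most
    \<open>K\<close>.\<close>
  let ?B = "cball 0 (norm y0 + 1 + real K)"
  have uc: "uniformly_continuous_on ?B f" "uniformly_continuous_on ?B D"
    using D C1_deriv_continuous[OF D] unfolding C1_deriv_def
    by (auto intro!: compact_uniformly_continuous intro: continuous_on_subset)
  obtain d1 where d1: "d1 > 0" "\<And>x x'. x \<in> ?B \<Longrightarrow> x' \<in> ?B \<Longrightarrow> dist x' x < d1 \<Longrightarrow> dist (f x') (f x) < e/2"
    using uc(1) e unfolding uniformly_continuous_on_def by (meson half_gt_zero)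
  obtain d2 where d2: "d2 > 0" "\<And>x x'. x \<in> ?B \<Longrightarrow> x' \<in> ?B \<Longrightarrow> dist x' x < d2 \<Longrightarrow> dist (D x') (D x) < e/2"
    using uc(2) e unfolding uniformly_continuous_on_def by (meson half_gt_zero)
  have "\<forall>\<^sub>F y in at y0. dist y y0 < min 1 (min d1 d2)"
    using d1(1) d2(1) by (auto simp: eventually_at intro!: exI[of _ "min 1 (min d1 d2)"])
  then show "\<forall>\<^sub>F y in at y0. dist (c1norm K (\<lambda>x. f (y + x) - f (y0 + x))) 0 < e"
  proof eventually_elim
    case (elim y)
    have "c1norm K (\<lambda>x. f (y + x) - f (y0 + x)) \<le> e / 2"
    proof (rule c1norm_le, rule slope_le_C1[OF C1_deriv_diff[OF C1_deriv_shift[OF D] C1_deriv_shift[OF D]]])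
      fix x :: 'a assume x: "x \<in> cball 0 (real K)"
      have in_B: "y + x \<in> ?B" "y0 + x \<in> ?B"
      proof -
        have "norm (y + x) \<le> norm y0 + norm (y - y0) + norm x"
          using norm_triangle_ineq[of y0 "y - y0"] norm_triangle_ineq[of y x] by simp
        then show "y + x \<in> ?B" using elim x unfolding mem_cball_0 by (auto simp: dist_norm)
        show "y0 + x \<in> ?B" using norm_triangle_ineq[of y0 x] x unfolding mem_cball_0 by simp
      qed
      have "dist (y + x) (y0 + x) < d1" "dist (y + x) (y0 + x) < d2" using elim by (auto simp: dist_norm)
      then show "norm (f (y + x) - f (y0 + x)) \<le> e / 2" "norm (D (y + x) - D (y0 + x)) \<le> e / 2"
        using d1(2)[OF in_B(2,1)] d2(2)[OF in_B(2,1)] by (auto simp: dist_norm)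
    qed
    moreover have "0 \<le> c1norm K (\<lambda>x. f (y + x) - f (y0 + x))"
      by (intro c1norm_nonneg C1_maps_diff C1_maps_shift f)
    ultimately show ?case using e by simp
  qed
qed

lemma c1norm_shift_continuous:
  assumes f: "f \<in> C1_maps" and a: "a \<in> C1_maps"
  shows "continuous_on UNIV (\<lambda>y. c1norm K (\<lambda>x. f (y + x) - a x))"
proof (intro continuous_at_imp_continuous_on ballI)
  fix y0
  have "\<bar>c1norm K (\<lambda>x. f (y + x) - a x) - c1norm K (\<lambda>x. f (y0 + x) - a x)\<bar> \<le> c1norm K (\<lambda>x. f (y + x) - f (y0 + x))" for y
    using c1norm_triangle[OF C1_maps_shift[OF f] a C1_maps_shift[OF f], of K y y0]
      c1norm_triangle[OF C1_maps_shift[OF f] a C1_maps_shift[OF f], of K y0 y]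
      c1norm_minus_commute[of K "\<lambda>x. f (y + x)" "\<lambda>x. f (y0 + x)"] by linarith
  then have "((\<lambda>y. c1norm K (\<lambda>x. f (y + x) - a x) - c1norm K (\<lambda>x. f (y0 + x) - a x)) \<longlongrightarrow> 0) (at y0)"
    by (intro Lim_null_comparison[OF always_eventually c1norm_shift_tendsto[OF f]]) auto
  then show "isCont (\<lambda>y. c1norm K (\<lambda>x. f (y + x) - a x)) y0"
    by (simp add: isCont_def LIM_zero_iff)
qed

section \<open>Separability of the C1 topology\<close>

lemma heine_borel_countable_dense:
  obtains Q :: "'v::heine_borel set" where "countable Q" "\<And>v e. e > 0 \<Longrightarrow> \<exists>q\<in>Q. dist q v < e"
proof -
  have "\<exists>k. finite k \<and> cball a (real n) \<subseteq> (\<Union>x\<in>k. ball x (1 / real (Suc m)))" for a :: 'v and n m :: nat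
  proof -
    have "compact (cball a (real n))" by (simp add: compact_eq_bounded_closed)
    from seq_compact_imp_totally_bounded[OF this[unfolded compact_eq_seq_compact_metric], rule_format, of "1 / real (Suc m)"]
    show ?thesis by auto
  qed
  then obtain k where k: "\<And>n m. finite (k n m)"
    "\<And>n m. cball (undefined::'v) (real n) \<subseteq> (\<Union>x\<in>k n m. ball x (1 / real (Suc m)))"
    by metis
  show ?thesis
  proof (rule that[of "\<Union>n m. k n m"])
    show "countable (\<Union>n m. k n m)" using k(1) by (intro countable_UN) (auto intro: countable_finite)
    fix v :: 'v and e :: real assume e: "e > 0"
    obtain m where m: "1 / real (Suc m) < e" using e nat_approx_posE by blast
    obtain n where "dist undefined v \<le> real n" using real_arch_simple by blast
    then have "v \<in> cball undefined (real n)" by simp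
    with k(2)[of n m] obtain x where "x \<in> k n m" "dist x v < 1 / real (Suc m)" by auto
    then have "x \<in> (\<Union>n m. k n m)" "dist x v < e" using m by auto
    then show "\<exists>q\<in>(\<Union>n m. k n m). dist q v < e" by blast
  qed
qed

text \<open>Each function is coded by a scale at which it is uniformly continuous and a list of
  approximate values on a finite net of that scale. There are countably many codes, and one
  representative in \<open>S\<close> is picked for each code that occurs. The class of
  \<open>'v\<close> covers pairs of a value and a derivative.\<close>

lemma uniformly_separable:
  fixes G :: "'i \<Rightarrow> 'x::metric_space \<Rightarrow> 'v::heine_borel"
  assumes C: "compact C" and cont: "\<And>i. i \<in> S \<Longrightarrow> continuous_on C (G i)" and e: "e > 0"
  obtains T where "T \<subseteq> S" "countable T" "\<And>i. i \<in> S \<Longrightarrow> \<exists>j\<in>T. \<forall>x\<in>C. dist (G i x) (G j x) < e"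
proof -
  obtain Q :: "'v set" where Q: "countable Q" "\<And>v e. e > 0 \<Longrightarrow> \<exists>q\<in>Q. dist q v < e"
    using heine_borel_countable_dense by blast
  have "\<exists>xs. set xs \<subseteq> C \<and> C \<subseteq> (\<Union>x\<in>set xs. ball x (1 / real (Suc n)))" for n
  proof -
    obtain k where "finite k" "k \<subseteq> C" "C \<subseteq> (\<Union>x\<in>k. ball x (1 / real (Suc n)))"
      using seq_compact_imp_totally_bounded[OF C[unfolded compact_eq_seq_compact_metric], rule_format, of "1 / real (Suc n)"]
      by auto
    then show ?thesis using finite_list by metis
  qed
  then obtain xs where xs: "\<And>n. set (xs n) \<subseteq> C" "\<And>n. C \<subseteq> (\<Union>x\<in>set (xs n). ball x (1 / real (Suc n)))"
    by metis
  \<comment> \<open>Comparing two functions with the same code passes through a net point and its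
    listed value: two oscillations and two approximations, each below \<open>e / 4\<close>.\<close>
  define R where "R i c \<longleftrightarrow> (\<forall>x\<in>C. \<forall>y\<in>C. dist y x < 1 / real (Suc (fst c)) \<longrightarrow> dist (G i y) (G i x) < e / 4)
      \<and> list_all2 (\<lambda>q x. dist q (G i x) < e / 4) (snd c) (xs (fst c))" for i and c :: "nat \<times> 'v list"
  define P where "P = {c \<in> UNIV \<times> lists Q. \<exists>i\<in>S. R i c}"
  define pick where "pick c = (SOME i. i \<in> S \<and> R i c)" for c
  have pick: "pick c \<in> S \<and> R (pick c) c" if "c \<in> P" for c
    unfolding pick_def by (rule someI_ex) (use that in \<open>auto simp: P_def\<close>)
  show ?thesis
  proof (rule that[of "pick ` P"])
    show "pick ` P \<subseteq> S" using pick by auto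
    have "countable P" unfolding P_def
      by (rule countable_subset[of _ "UNIV \<times> lists Q"]) (use Q(1) in auto)
    then show "countable (pick ` P)" by simp
    fix i assume i: "i \<in> S"
    have "uniformly_continuous_on C (G i)" by (rule compact_uniformly_continuous[OF cont[OF i] C])
    then obtain d where d: "d > 0" "\<And>x y. x \<in> C \<Longrightarrow> y \<in> C \<Longrightarrow> dist y x < d \<Longrightarrow> dist (G i y) (G i x) < e / 4"
      unfolding uniformly_continuous_on_def using e by (metis zero_less_divide_iff zero_less_numeral)
    obtain n where n: "1 / real (Suc n) < d" using d(1) nat_approx_posE by blast
    define q where "q x = (SOME q. q \<in> Q \<and> dist q (G i x) < e / 4)" for x
    have q: "q x \<in> Q \<and> dist (q x) (G i x) < e / 4" for x
      unfolding q_def by (rule someI_ex) (use Q(2)[of "e/4" "G i x"] e in auto)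
    let ?c = "(n, map q (xs n))"
    have R: "R i ?c"
      unfolding R_def using d(2) n q by (auto simp: list_all2_map1 list_all2_same)
    then have c: "?c \<in> P" unfolding P_def using i q by auto
    have "dist (G i x) (G (pick ?c) x) < e" if x: "x \<in> C" for x
    proof -
      obtain z where z: "z \<in> set (xs n)" "dist z x < 1 / real (Suc n)" using xs(2)[of n] x by auto
      then have zC: "z \<in> C" using xs(1) by auto
      have "\<forall>z\<in>set (xs n). dist (q z) (G (pick ?c) z) < e / 4"
        using pick[OF c] unfolding R_def by (simp add: list_all2_map1 list_all2_same)
      then have "dist (q z) (G (pick ?c) z) < e / 4" using z by blast
      moreover have "dist (q z) (G i z) < e / 4" using q by blast
      moreover have "dist (G i z) (G i x) < e / 4" using R x zC z(2) by (auto simp: R_def)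
      moreover have "dist (G (pick ?c) z) (G (pick ?c) x) < e / 4" using pick[OF c] x zC z(2) by (auto simp: R_def)
      ultimately show ?thesis by metric
    qed
    then show "\<exists>j\<in>pick ` P. \<forall>x\<in>C. dist (G i x) (G j x) < e" using c by blast
  qed
qed

text \<open>\<open>uniformly_separable\<close> is applied to a map together with its derivative on
  every ball and for every accuracy; uniform closeness of both gives closeness in
  \<open>c1norm\<close> by \<open>slope_le_C1\<close>.\<close>

lemma c1norm_separable:
  fixes S :: "('e::euclidean_space \<Rightarrow> 'v::euclidean_space) set"
  assumes S: "S \<subseteq> C1_maps"
  obtains A where "A \<subseteq> S" "countable A"
    "\<And>f K e. f \<in> S \<Longrightarrow> e > 0 \<Longrightarrow> \<exists>a\<in>A. c1norm K (\<lambda>x. f x - a x) < e"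
proof -
  define D :: "('e \<Rightarrow> 'v) \<Rightarrow> 'e \<Rightarrow> 'e \<Rightarrow>\<^sub>L 'v" where "D f = (SOME D. C1_deriv f D)" for f
  have D: "C1_deriv f (D f)" if f: "f \<in> S" for f
  proof -
    obtain E where "C1_deriv f E" using f S by (auto simp: C1_maps_def)
    then show ?thesis unfolding D_def by (rule someI[of "C1_deriv f"])
  qed
  have "\<exists>T. T \<subseteq> S \<and> countable T \<and> (\<forall>i\<in>S. \<exists>j\<in>T. \<forall>x\<in>cball 0 (real K). dist (i x, D i x) (j x, D j x) < 1 / real (Suc n))"
    for K n :: nat
  proof (rule uniformly_separable[of "cball 0 (real K)" S "\<lambda>i x. (i x, D i x)" "1 / real (Suc n)"])
    show "continuous_on (cball 0 (real K)) (\<lambda>x. (i x, D i x))" if "i \<in> S" for i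
      using D[OF that] C1_deriv_continuous[OF D[OF that]] unfolding C1_deriv_def
      by (auto intro!: continuous_on_Pair intro: continuous_on_subset)
  qed auto
  then obtain T where T: "\<And>K n. T K n \<subseteq> S" "\<And>K n. countable (T K n)"
    "\<And>K n i. i \<in> S \<Longrightarrow> \<exists>j\<in>T K n. \<forall>x\<in>cball 0 (real K). dist (i x, D i x) (j x, D j x) < 1 / real (Suc n)"
    by metis
  show ?thesis
  proof (rule that[of "\<Union>K n. T K n"])
    show "(\<Union>K n. T K n) \<subseteq> S" using T(1) by auto
    show "countable (\<Union>K n. T K n)" using T(2) by auto
    fix f and K :: nat and e :: real assume f: "f \<in> S" and e: "e > 0"
    obtain n where n: "1 / real (Suc n) < e" using e nat_approx_posE by blast
    obtain j where j: "j \<in> T K n" "\<And>x. x \<in> cball 0 (real K) \<Longrightarrow> dist (f x, D f x) (j x, D j x) < 1 / real (Suc n)"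
      using T(3)[OF f] by blast
    have jS: "j \<in> S" using j(1) T(1) by auto
    have "c1norm K (\<lambda>x. f x - j x) \<le> 1 / real (Suc n)"
    proof (rule c1norm_le, rule slope_le_C1[OF C1_deriv_diff[OF D[OF f] D[OF jS]]])
      fix x :: 'e assume "x \<in> cball 0 (real K)"
      from j(2)[OF this] show "norm (f x - j x) \<le> 1 / real (Suc n)" "norm (D f x - D j x) \<le> 1 / real (Suc n)"
        using dist_fst_le[of "(f x, D f x)" "(j x, D j x)"] dist_snd_le[of "(f x, D f x)" "(j x, D j x)"]
        by (auto simp: dist_norm)
    qed
    then show "\<exists>a\<in>(\<Union>K n. T K n). c1norm K (\<lambda>x. f x - a x) < e" using j(1) n by force
  qed
qed

section \<open>Comparison of \<open>c1norm\<close> with the metric \<open>dist_r\<close>\<close>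

lemma OmegaR_subset_C1: "OmegaR lam Lam r \<subseteq> C1_maps"
  unfolding OmegaR_def C1_maps_def C1_deriv_def by auto

text \<open>The factor two accounts for the two suprema in \<open>norm1K\<close>, and the larger
  radius comes from \<open>deriv_norm_le_c1norm\<close>.\<close>

lemma norm1K_bounds:
  fixes f :: "('d::finite) env"
  assumes "f \<in> C1_maps"
  shows "0 \<le> norm1K f K" "norm1K f K \<le> 2 * c1norm (Suc K) f"
proof -
  obtain D where D: "C1_deriv f D" using assms by (auto simp: C1_maps_def)
  have "frechet_derivative f (at x) = blinfun_apply (D x)" for x
    using D frechet_derivative_at unfolding C1_deriv_def by metis
  then have g: "gradnorm f x = norm (D x)" for x
    by (simp add: gradnorm_def norm_blinfun.rep_eq)
  have a: "norm (f x) \<le> c1norm (Suc K) f" "gradnorm f x \<le> c1norm (Suc K) f" if "x \<in> cball 0 (real K)" for x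
  proof -
    show "norm (f x) \<le> c1norm (Suc K) f"
      using slope_le_c1norm[OF assms, of "(x, x)" "Suc K"] that by (simp add: slope_def)
    show "gradnorm f x \<le> c1norm (Suc K) f" unfolding g by (rule deriv_norm_le_c1norm[OF D that])
  qed
  have "(SUP x\<in>cball 0 (real K). norm (f x)) \<le> c1norm (Suc K) f"
    "(SUP x\<in>cball 0 (real K). gradnorm f x) \<le> c1norm (Suc K) f"
    by (rule cSUP_least; use a in simp)+
  then show "norm1K f K \<le> 2 * c1norm (Suc K) f" by (simp add: norm1K_def)
  have "bdd_above ((\<lambda>x. norm (f x)) ` cball 0 (real K))" "bdd_above (gradnorm f ` cball 0 (real K))"
    by (rule bdd_aboveI2[of _ _ "c1norm (Suc K) f"], use a in simp)+
  then have "0 \<le> (SUP x\<in>cball 0 (real K). norm (f x))" "0 \<le> (SUP x\<in>cball 0 (real K). gradnorm f x)"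
    by (auto intro!: cSUP_upper2[where x = 0] simp: g)
  then show "0 \<le> norm1K f K" by (simp add: norm1K_def)
qed

text \<open>The first \<open>K\<close> terms involve radii up to \<open>K\<close>, hence
  \<open>c1norm (Suc K)\<close>, and their weights add up to at most one; the remaining weights add
  up to \<open>(1/2) ^ K\<close>. This comparison makes \<open>dist_r\<close>-continuous functions
  continuous for \<open>c1norm\<close>.\<close>

lemma dist_r_le:
  fixes f g :: "('d::finite) env"
  assumes "f \<in> C1_maps" "g \<in> C1_maps"
  shows "dist_r f g \<le> 2 * c1norm (Suc K) (\<lambda>x. f x - g x) + (1/2) ^ K"
proof -
  let ?h = "\<lambda>x. f x - g x"
  have h: "?h \<in> C1_maps" by (intro C1_maps_diff assms)
  define q where "q = 2 * c1norm (Suc K) ?h"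
  have q: "0 \<le> q" unfolding q_def using c1norm_nonneg[OF h] by simp
  define t where "t j = norm1K ?h (Suc j) / (1 + norm1K ?h (Suc j))" for j
  have t0: "0 \<le> t j" "t j \<le> 1" for j
    using norm1K_bounds(1)[OF h, of "Suc j"] by (auto simp: t_def divide_le_eq)
  have tq: "t j \<le> q" if "j < K" for j
  proof -
    have "t j \<le> norm1K ?h (Suc j)"
    proof -
      have "norm1K ?h (Suc j) / (1 + norm1K ?h (Suc j)) \<le> norm1K ?h (Suc j) / 1"
        using norm1K_bounds(1)[OF h, of "Suc j"] by (intro divide_left_mono) auto
      then show ?thesis by (simp add: t_def)
    qed
    also have "\<dots> \<le> 2 * c1norm (Suc (Suc j)) ?h" by (rule norm1K_bounds(2)[OF h])
    also have "\<dots> \<le> q" unfolding q_def using that by (intro mult_left_mono c1norm_mono h) auto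
    finally show ?thesis .
  qed
  have half: "(\<lambda>j. (1/2::real) ^ Suc j) sums 1" by (rule power_half_series)
  \<comment> \<open>The tail of the weights, which dominates the terms from index \<open>K\<close>
    on.\<close>
  define u where "u j = (if j < K then 0 else (1/2::real) ^ Suc j)" for j
  have "(\<lambda>j. u (j + K)) sums (1/2) ^ K"
    using sums_mult[OF half, of "(1/2) ^ K"] by (simp add: u_def power_add mult.commute)
  then have u: "u sums (1/2) ^ K"
    by (subst (asm) sums_iff_shift) (simp add: u_def)
  have sum_q: "(\<lambda>j. (1/2) ^ Suc j * q + u j) sums (1 * q + (1/2) ^ K)"
    by (intro sums_add sums_mult2 half u)
  have term_le: "(1/2) ^ Suc j * t j \<le> (1/2) ^ Suc j * q + u j" for j
  proof (cases "j < K")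
    case True
    then show ?thesis using tq[OF True] by (simp add: u_def)
  next
    case False
    have "(1/2) ^ Suc j * t j \<le> (1/2::real) ^ Suc j" using t0(2)[of j] by simp
    then show ?thesis using False q by (simp add: u_def add_increasing)
  qed
  have "summable (\<lambda>j. (1/2) ^ Suc j * t j)"
    by (rule summable_comparison_test'[OF sums_summable[OF sum_q], of 0]) (use term_le t0 in auto)
  then have "(\<Sum>j. (1/2) ^ Suc j * t j) \<le> (\<Sum>j. (1/2) ^ Suc j * q + u j)"
    by (intro suminf_le sums_summable[OF sum_q] term_le)
  also have "\<dots> = q + (1/2) ^ K" using sums_unique[OF sum_q] by simp
  finally show ?thesis unfolding dist_r_def t_def q_def .
qed

section \<open>Periodization of environments\<close>

lemma continuous_antiderivative:
  fixes k :: "real \<Rightarrow> real"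
  assumes "continuous_on UNIV k"
  obtains g where "\<And>x. (g has_real_derivative k x) (at x)"
proof -
  have "\<exists>F. \<forall>x::real. -\<infinity> < ereal x \<longrightarrow> ereal x < \<infinity> \<longrightarrow> (F has_vector_derivative k x) (at x)"
    by (rule einterval_antiderivative) (use assms in \<open>auto simp: continuous_on_eq_continuous_at\<close>)
  then show ?thesis using that by (auto simp: has_real_derivative_iff_has_vector_derivative)
qed

lemma equal_derivative_imp_equal:
  fixes g h :: "real \<Rightarrow> real"
  assumes "\<And>x. x \<in> {a..b} \<Longrightarrow> (g has_real_derivative k x) (at x)"
    "\<And>x. x \<in> {a..b} \<Longrightarrow> (h has_real_derivative k x) (at x)" "g c = h c" "c \<in> {a..b}" "x \<in> {a..b}"
  shows "g x = h x"
proof -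
  have "((\<lambda>x. g x - h x) has_real_derivative 0) (at x within {a..b})" if "x \<in> {a..b}" for x
    using DERIV_diff[OF assms(1,2)[OF that]] by (auto intro: has_field_derivative_at_within)
  then obtain d where "\<And>x. x \<in> {a..b} \<Longrightarrow> g x - h x = d"
    using has_field_derivative_zero_constant[of "{a..b}" "\<lambda>x. g x - h x"] by auto
  from this[OF assms(4)] this[OF assms(5)] assms(3) show ?thesis by simp
qed

text \<open>Composing with this map in each coordinate makes any environment periodic without leaving
  \<open>OmegaR\<close>, since the constraints defining \<open>OmegaR\<close> are pointwise. It is the antiderivative of a
  continuous periodic function of mean zero that equals \<open>1\<close> away from \<open>M/2 + M\<int>\<close>; the triangle
  wave \<open>dist(t, M\<int>)\<close> is written as \<open>arccos (cos (2\<pi>t/M)) * M / (2\<pi>)\<close>.\<close>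
lemma periodic_fold:
  fixes M :: real
  assumes M: "M > 2"
  obtains g k where "\<And>x. (g has_real_derivative k x) (at x)" "continuous_on UNIV k"
    "\<And>x. g (x + M) = g x" "\<And>x. \<bar>x\<bar> \<le> M / 2 - 1 \<Longrightarrow> g x = x"
proof -
  define th where "th t = arccos (cos (2 * pi * t / M)) * M / (2 * pi)" for t
  \<comment> \<open>Over one period the subtracted part consists of two triangles of base
    \<open>1\<close> and height \<open>M\<close>. Their total area \<open>M\<close> is the length of
    the period, so \<open>k\<close> has mean zero.\<close>
  define k where "k t = 1 - M * max 0 (th t - (M / 2 - 1))" for t
  have th_per: "th (t + M) = th t" for t
  proof -
    have "2 * pi * (t + M) / M = 2 * pi * t / M + 2 * pi" using M by (simp add: field_simps)
    then show ?thesis by (simp add: th_def)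
  qed
  have th_abs: "th t = \<bar>t\<bar>" if "\<bar>t\<bar> \<le> M / 2" for t
  proof -
    have "arccos (cos (2 * pi * t / M)) = \<bar>2 * pi * t / M\<bar>"
      using that M by (intro arccos_cos2 [THEN trans] arccos_cos_eq_abs) (auto simp: abs_mult field_simps)
    then show ?thesis using M by (simp add: th_def abs_mult)
  qed
  have "continuous_on UNIV th" unfolding th_def by (intro continuous_intros) (use M in auto)
  then have k_cont: "continuous_on UNIV k" unfolding k_def by (intro continuous_intros)
  obtain g0 where g0: "\<And>x. (g0 has_real_derivative k x) (at x)"
    using continuous_antiderivative[OF k_cont] by blast
  define g where "g x = g0 x - g0 0" for x
  have g: "(g has_real_derivative k x) (at x)" for x
    unfolding g_def using DERIV_diff[OF g0 DERIV_const] by simp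
  have g_0: "g 0 = 0" by (simp add: g_def)
  let ?c = "M / 2 - 1"
  have inner: "g x = x" if "\<bar>x\<bar> \<le> ?c" for x
  proof (rule equal_derivative_imp_equal[of "-?c" ?c g k "\<lambda>x. x" 0])
    fix x assume "x \<in> {-?c..?c}"
    then have x: "\<bar>x\<bar> \<le> ?c" by auto
    then have "th x = \<bar>x\<bar>" by (intro th_abs) linarith
    then have "k x = 1" using x by (simp add: k_def)
    then show "((\<lambda>x. x) has_real_derivative k x) (at x)" by simp
  qed (use that M g g_0 in auto)
  \<comment> \<open>On the boundary layer \<open>g\<close> is an explicit parabola, and it vanishes
    at \<open>M / 2\<close>; likewise at \<open>-(M / 2)\<close>. The constant
    \<open>g (x + M) - g x\<close> is therefore zero.\<close>
  have right: "g (M / 2) = 0"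
  proof -
    have "g (M / 2) = M / 2 - (M / 2) * (M / 2 - ?c)\<^sup>2"
    proof (rule equal_derivative_imp_equal[of ?c "M/2" g k "\<lambda>x. x - (M / 2) * (x - ?c)\<^sup>2" ?c])
      fix x assume x: "x \<in> {?c..M/2}"
      then have "th x = x" using th_abs[of x] M by (auto simp: abs_if)
      then have "k x = 1 - M * (x - ?c)" using x by (simp add: k_def)
      then show "((\<lambda>x. x - (M / 2) * (x - ?c)\<^sup>2) has_real_derivative k x) (at x)"
        by (auto intro!: derivative_eq_intros simp: field_simps)
    qed (use M g inner[of ?c] in auto)
    then show ?thesis by simp
  qed
  have left: "g (-(M / 2)) = 0"
  proof -
    have "g (-(M / 2)) = -(M / 2) + (M / 2) * (-(M / 2) + ?c)\<^sup>2"
    proof (rule equal_derivative_imp_equal[of "-(M/2)" "-?c" g k "\<lambda>x. x + (M / 2) * (x + ?c)\<^sup>2" "-?c"])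
      fix x assume x: "x \<in> {-(M/2)..-?c}"
      then have "th x = - x" using th_abs[of x] M by (auto simp: abs_if)
      then have "k x = 1 + M * (x + ?c)" using x by (simp add: k_def max_def algebra_simps)
      then show "((\<lambda>x. x + (M / 2) * (x + ?c)\<^sup>2) has_real_derivative k x) (at x)"
        by (auto intro!: derivative_eq_intros simp: field_simps)
    qed (use M g inner[of "-?c"] in auto)
    then show ?thesis by simp
  qed
  have per: "g (x + M) = g x" for x
  proof -
    have d: "((\<lambda>x. g (x + M) - g x) has_real_derivative 0) (at x)" for x
    proof -
      have "((\<lambda>x. g (x + M)) has_real_derivative k (x + M)) (at x)"
        using DERIV_shift[of g "k (x + M)" x M] g by blast
      from DERIV_diff[OF this g] show ?thesis by (simp add: k_def th_per)
    qed
    have "g (x + M) - g x = g (-(M/2) + M) - g (-(M/2))"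
      using DERIV_isconst_all[of "\<lambda>x. g (x + M) - g x"] d by blast
    also have "\<dots> = 0" using left right by (simp add: field_simps)
    finally show ?thesis by simp
  qed
  show ?thesis by (rule that[OF g k_cont per inner])
qed

section \<open>Translations of environments and the periodized environment\<close>

lemma shift_zero [simp]: "shift 0 \<omega> = \<omega>"
  by (simp add: shift_def)

lemma shift_shift: "shift x (shift y \<omega>) = shift (x + y) \<omega>"
  by (simp add: shift_def add_ac)

lemma OmegaSet_shift: "\<omega> \<in> OmegaSet lam Lam \<Longrightarrow> shift x \<omega> \<in> OmegaSet lam Lam"
  unfolding OmegaSet_def shift_def
  by (auto intro!: continuous_intros continuous_on_compose2[of UNIV \<omega>])

lemma OmegaR_iff:
  "\<omega> \<in> OmegaR lam Lam r \<longleftrightarrow> \<omega> \<in> OmegaSet lam Lam \<and> \<omega> \<in> C1_maps \<and> (\<forall>x. psd (\<omega> x - r *\<^sub>R mat 1))"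
  unfolding OmegaR_def C1_maps_def C1_deriv_def by auto

lemma OmegaR_shift: "\<omega> \<in> OmegaR lam Lam r \<Longrightarrow> shift x \<omega> \<in> OmegaR lam Lam r"
  unfolding OmegaR_iff using OmegaSet_shift C1_maps_shift by (auto simp: shift_def)

text \<open>Exact invariance makes the indicator of \<open>OmegaR\<close> constant along each
  orbit.\<close>

lemma OmegaR_shift_iff: "shift x \<omega> \<in> OmegaR lam Lam r \<longleftrightarrow> \<omega> \<in> OmegaR lam Lam r"
  using OmegaR_shift[of \<omega> lam Lam r x] OmegaR_shift[of "shift x \<omega>" lam Lam r "- x"]
  by (auto simp: shift_shift)

lemma C1_deriv_compose:
  assumes f: "C1_deriv f D" and p: "C1_deriv p E"
  shows "C1_deriv (\<lambda>x. f (p x)) (\<lambda>x. D (p x) o\<^sub>L E x)"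
  unfolding C1_deriv_def
proof (intro conjI allI)
  fix x
  show "((\<lambda>x. f (p x)) has_derivative blinfun_apply (D (p x) o\<^sub>L E x)) (at x)"
    using has_derivative_compose[of p "blinfun_apply (E x)" x UNIV f "blinfun_apply (D (p x))"] f p
    by (simp add: C1_deriv_def blinfun_compose.rep_eq o_def)
  have "continuous_on UNIV (\<lambda>x. D (p x))"
    by (rule continuous_on_compose2[of UNIV D]) (use f C1_deriv_continuous[OF p] in \<open>auto simp: C1_deriv_def\<close>)
  then show "continuous_on UNIV (\<lambda>x. D (p x) o\<^sub>L E x)"
    using p unfolding C1_deriv_def
    by (intro bounded_bilinear.continuous_on[OF bounded_bilinear_blinfun_compose]) auto
qed

text \<open>The derivative at \<open>x\<close> combines the fixed coordinate projections
  \<open>P i\<close> with the scalar coefficients \<open>k (x $ i)\<close>, so its continuity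
  reduces to that of \<open>k\<close>.\<close>

lemma coordinatewise_C1:
  fixes g k :: "real \<Rightarrow> real"
  assumes g: "\<And>t. (g has_real_derivative k t) (at t)" and k: "continuous_on UNIV k"
  shows "(\<lambda>x::real^'d. \<chi> i. g (x $ i)) \<in> C1_maps"
proof -
  define P :: "'d \<Rightarrow> (real^'d) \<Rightarrow>\<^sub>L (real^'d)" where "P i = Blinfun (\<lambda>h. (h $ i) *\<^sub>R axis i 1)" for i
  have P: "blinfun_apply (P i) h = (h $ i) *\<^sub>R axis i 1" for i h
    unfolding P_def by (subst bounded_linear_Blinfun_apply) (auto intro!: bounded_linear_intros)
  have eq: "(\<lambda>x::real^'d. \<chi> i. g (x $ i)) = (\<lambda>x. \<Sum>i\<in>UNIV. g (x $ i) *\<^sub>R axis i 1)"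
    by (auto simp: vec_eq_iff axis_def if_distrib cong: if_cong)
  have "C1_deriv (\<lambda>x. \<Sum>i\<in>UNIV. g (x $ i) *\<^sub>R axis i 1) (\<lambda>x. \<Sum>i\<in>UNIV. k (x $ i) *\<^sub>R P i)"
    unfolding C1_deriv_def
  proof (intro conjI allI)
    fix x :: "real^'d"
    have "((\<lambda>x::real^'d. g (x $ i)) has_derivative (\<lambda>h. k (x $ i) * h $ i)) (at x)" for i
    proof -
      have "((\<lambda>x::real^'d. x $ i) has_derivative (\<lambda>h. h $ i)) (at x)"
        by (rule bounded_linear.has_derivative[OF bounded_linear_vec_nth has_derivative_ident])
      from has_derivative_compose[OF this, of g "(*) (k (x $ i))"] g[of "x $ i"]
      show ?thesis by (simp add: has_field_derivative_def)
    qed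
    then have "((\<lambda>x::real^'d. \<Sum>i\<in>UNIV. g (x $ i) *\<^sub>R axis i (1::real)) has_derivative
        (\<lambda>h. \<Sum>i\<in>UNIV. (k (x $ i) * h $ i) *\<^sub>R axis i 1)) (at x)"
      by (intro has_derivative_sum has_derivative_scaleR_left)
    moreover have "(\<lambda>h. \<Sum>i\<in>UNIV. (k (x $ i) * h $ i) *\<^sub>R axis i 1) = blinfun_apply (\<Sum>i\<in>UNIV. k (x $ i) *\<^sub>R P i)"
      by (rule ext) (simp add: blinfun.sum_left blinfun.scaleR_left P)
    ultimately show "((\<lambda>x::real^'d. \<Sum>i\<in>UNIV. g (x $ i) *\<^sub>R axis i (1::real)) has_derivative
        blinfun_apply (\<Sum>i\<in>UNIV. k (x $ i) *\<^sub>R P i)) (at x)"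
      by simp
    show "continuous_on UNIV (\<lambda>x::real^'d. \<Sum>i\<in>UNIV. k (x $ i) *\<^sub>R P i)"
      by (intro continuous_intros continuous_on_compose2[OF k]) auto
  qed
  then show ?thesis unfolding eq C1_maps_def by blast
qed

text \<open>The margin \<open>K + 1\<close> is made of \<open>K\<close> for the observed ball and
  \<open>1\<close> for the layer in which the folding map differs from the identity.\<close>

lemma periodization:
  fixes \<omega> :: "('d::finite) env"
  assumes \<omega>: "\<omega> \<in> OmegaR lam Lam r" and M: "M > 2"
  obtains \<omega>' where "\<omega>' \<in> OmegaR lam Lam r" "\<And>i. shift (M *\<^sub>R axis i 1) \<omega>' = \<omega>'"
    "\<And>y K x. y \<in> cube (M - 2 * (real K + 1)) \<Longrightarrow> x \<in> cball 0 (real K) \<Longrightarrow> shift y \<omega>' x = shift y \<omega> x"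
proof -
  obtain g k where g: "\<And>x. (g has_real_derivative k x) (at x)" "continuous_on UNIV k"
    "\<And>x. g (x + M) = g x" "\<And>x. \<bar>x\<bar> \<le> M / 2 - 1 \<Longrightarrow> g x = x"
    using periodic_fold[OF M] by blast
  define p :: "real^'d \<Rightarrow> real^'d" where "p x = (\<chi> i. g (x $ i))" for x
  have "p \<in> C1_maps" using coordinatewise_C1[OF g(1,2)] by (simp add: p_def[abs_def])
  then obtain E where E: "C1_deriv p E" by (auto simp: C1_maps_def)
  obtain D where D: "C1_deriv \<omega> D" using \<omega> by (auto simp: OmegaR_iff C1_maps_def)
  have C1: "(\<lambda>x. \<omega> (p x)) \<in> C1_maps" using C1_deriv_compose[OF D E] by (auto simp: C1_maps_def)
  show ?thesis
  proof (rule that[of "\<lambda>x. \<omega> (p x)"])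
    show "(\<lambda>x. \<omega> (p x)) \<in> OmegaR lam Lam r"
      using \<omega> C1 C1_maps_continuous[OF C1] by (auto simp: OmegaR_iff OmegaSet_def)
    fix i
    have "p (M *\<^sub>R axis i 1 + y) = p y" for y
      using g(3) by (auto simp: p_def vec_eq_iff axis_def add.commute[of M])
    then show "shift (M *\<^sub>R axis i 1) (\<lambda>x. \<omega> (p x)) = (\<lambda>x. \<omega> (p x))" by (simp add: shift_def)
  next
    fix y :: "real^'d" and K :: nat and x :: "real^'d"
    assume y: "y \<in> cube (M - 2 * (real K + 1))" and x: "x \<in> cball 0 (real K)"
    have "p (y + x) = y + x"
    proof -
      have "\<bar>y $ i + x $ i\<bar> \<le> M / 2 - 1" for i
      proof -
        have "axis i 1 \<in> (Basis :: (real^'d) set)" by (simp add: axis_in_Basis_iff)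
        then have "\<bar>y \<bullet> axis i 1\<bar> \<le> (M - 2 * (real K + 1)) / 2" using y unfolding mem_cube by blast
        then have "\<bar>y $ i\<bar> \<le> M / 2 - (real K + 1)" by (simp add: inner_axis field_simps)
        moreover have "\<bar>x $ i\<bar> \<le> real K" using x component_le_norm_cart[of x i] by simp
        ultimately show ?thesis by linarith
      qed
      then show ?thesis using g(4) by (simp add: p_def vec_eq_iff)
    qed
    then show "shift y (\<lambda>x. \<omega> (p x)) x = shift y \<omega> x" by (simp add: shift_def)
  qed
qed

section \<open>Borel sets of environments\<close>

lemma lu_open_Pow: "lu_open lam Lam \<subseteq> Pow (OmegaSet lam Lam)"
  by (auto simp: lu_open_def)

lemma space_OmegaBorel: "space (OmegaBorel lam Lam) = OmegaSet lam Lam"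
  unfolding OmegaBorel_def by (rule space_measure_of[OF lu_open_Pow])

lemma lu_open_sets: "U \<in> lu_open lam Lam \<Longrightarrow> U \<in> sets (OmegaBorel lam Lam)"
  unfolding OmegaBorel_def sets_measure_of[OF lu_open_Pow] by (rule sigma_sets.Basic)

lemma lu_open_shift_vimage:
  fixes U :: "('d::finite) env set"
  assumes U: "U \<in> lu_open lam Lam"
  shows "shift x -` U \<inter> OmegaSet lam Lam \<in> lu_open lam Lam"
  unfolding lu_open_def
proof (intro CollectI conjI ballI)
  fix \<omega> :: "'d env" assume \<omega>: "\<omega> \<in> shift x -` U \<inter> OmegaSet lam Lam"
  then have "shift x \<omega> \<in> U" by simp
  then obtain K e where Ke: "K > 0" "e > 0"
    "\<forall>\<omega>'\<in>OmegaSet lam Lam. (\<forall>z\<in>cball 0 K. norm (\<omega>' z - shift x \<omega> z) < e) \<longrightarrow> \<omega>' \<in> U"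
    using U unfolding lu_open_def by fast
  have "\<forall>\<omega>'\<in>OmegaSet lam Lam. (\<forall>z\<in>cball 0 (K + norm x). norm (\<omega>' z - \<omega> z) < e) \<longrightarrow> \<omega>' \<in> shift x -` U \<inter> OmegaSet lam Lam"
  proof (intro ballI impI)
    fix \<omega>' :: "'d env" assume \<omega>': "\<omega>' \<in> OmegaSet lam Lam" "\<forall>z\<in>cball 0 (K + norm x). norm (\<omega>' z - \<omega> z) < e"
    have "shift x \<omega>' \<in> U"
    proof (rule Ke(3)[rule_format, OF OmegaSet_shift[OF \<omega>'(1)]])
      fix z :: "real^'d" assume "z \<in> cball 0 K"
      then have "norm (x + z) \<le> K + norm x" using norm_triangle_ineq[of x z] by simp
      then show "norm (shift x \<omega>' z - shift x \<omega> z) < e" using \<omega>'(2) by (simp add: shift_def)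
    qed
    then show "\<omega>' \<in> shift x -` U \<inter> OmegaSet lam Lam" using \<omega>'(1) by auto
  qed
  moreover have "0 < K + norm x" using Ke by (auto intro: add_pos_nonneg)
  ultimately show "\<exists>K>0. \<exists>\<epsilon>>0. \<forall>\<omega>'\<in>OmegaSet lam Lam. (\<forall>x\<in>cball 0 K. norm (\<omega>' x - \<omega> x) < \<epsilon>) \<longrightarrow> \<omega>' \<in> shift x -` U \<inter> OmegaSet lam Lam"
    using Ke(2) by blast
qed auto

lemma shift_measurable:
  "shift x \<in> measurable (OmegaBorel lam Lam) (OmegaBorel lam Lam)"
proof -
  have "shift x \<in> measurable (OmegaBorel lam Lam) (sigma (OmegaSet lam Lam) (lu_open lam Lam))"
  proof (rule measurable_measure_of[OF lu_open_Pow])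
    show "shift x \<in> space (OmegaBorel lam Lam) \<rightarrow> OmegaSet lam Lam"
      using OmegaSet_shift by (auto simp: space_OmegaBorel)
    fix U :: "'a env set" assume "U \<in> lu_open lam Lam"
    from lu_open_sets[OF lu_open_shift_vimage[OF this]]
    show "shift x -` U \<inter> space (OmegaBorel lam Lam) \<in> sets (OmegaBorel lam Lam)"
      by (simp add: space_OmegaBorel)
  qed
  then show ?thesis by (simp add: OmegaBorel_def)
qed

text \<open>For a fixed pair of points the slope depends on two values of \<omega> only, so a strict
  lower bound survives small changes of these values. The cases follow which entry of the maximum
  exceeds \<open>q\<close>.\<close>

lemma lu_open_slope_greater:
  fixes a :: "('d::finite) env"
  shows "{\<omega> \<in> OmegaSet lam Lam. \<exists>p\<in>cball 0 (real K) \<times> cball 0 (real K). q < slope (\<lambda>x. \<omega> x - a x) p} \<in> lu_open lam Lam"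
    (is "?U \<in> _")
  unfolding lu_open_def
proof (intro CollectI conjI ballI)
  fix \<omega> :: "'d env" assume "\<omega> \<in> ?U"
  then obtain x y where xy: "x \<in> cball 0 (real K)" "y \<in> cball 0 (real K)" "q < slope (\<lambda>x. \<omega> x - a x) (x, y)" by auto
  have "\<exists>e>0. \<forall>\<omega>'::'d env. norm (\<omega>' x - \<omega> x) < e \<longrightarrow> norm (\<omega>' y - \<omega> y) < e \<longrightarrow> q < slope (\<lambda>x. \<omega>' x - a x) (x, y)"
  proof (cases "q < norm (\<omega> x - a x)")
    case True
    show ?thesis
    proof (intro exI[of _ "norm (\<omega> x - a x) - q"] conjI allI impI)
      fix \<omega>' :: "'d env" assume "norm (\<omega>' x - \<omega> x) < norm (\<omega> x - a x) - q"
      moreover have "norm (\<omega> x - a x) \<le> norm (\<omega>' x - \<omega> x) + norm (\<omega>' x - a x)"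
        using norm_triangle_ineq4[of "\<omega>' x - a x" "\<omega>' x - \<omega> x"] by (simp add: algebra_simps)
      ultimately show "q < slope (\<lambda>x. \<omega>' x - a x) (x, y)" by (simp add: slope_def less_max_iff_disj)
    qed (use True in auto)
  next
    case False
    then have q: "0 \<le> q" using norm_ge_zero order_trans linorder_not_le by blast
    let ?N = "norm ((\<omega> x - a x) - (\<omega> y - a y))" and ?d = "norm (x - y)"
    have lt: "q < ?N / ?d" using xy(3) False by (simp add: slope_def less_max_iff_disj)
    \<comment> \<open>If the points coincide, the quotient is \<open>0\<close> by division by zero
      and cannot exceed the nonnegative \<open>q\<close>.\<close>
    have d: "?d > 0" using lt q by (cases "?d = 0") auto
    then have Nq: "q * ?d < ?N" using lt by (simp add: pos_less_divide_eq)
    show ?thesis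
    \<comment> \<open>Each of the two points may use half of the slack in
      \<open>q * ?d < ?N\<close>.\<close>
    proof (intro exI[of _ "(?N - q * ?d) / 2"] conjI allI impI)
      fix \<omega>' :: "'d env" assume e: "norm (\<omega>' x - \<omega> x) < (?N - q * ?d) / 2" "norm (\<omega>' y - \<omega> y) < (?N - q * ?d) / 2"
      let ?A = "(\<omega>' x - a x) - (\<omega>' y - a y)" and ?B = "(\<omega>' x - \<omega> x) - (\<omega>' y - \<omega> y)"
      have "?N = norm (?A - ?B)" by (rule arg_cong[where f = norm]) (simp add: algebra_simps)
      also have "\<dots> \<le> norm ?A + norm ?B" by (rule norm_triangle_ineq4)
      finally have "?N \<le> norm ?A + (norm (\<omega>' x - \<omega> x) + norm (\<omega>' y - \<omega> y))"
        using norm_triangle_ineq4[of "\<omega>' x - \<omega> x" "\<omega>' y - \<omega> y"] by linarith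
      then have "q * ?d < norm ((\<omega>' x - a x) - (\<omega>' y - a y))" using e by argo
      then show "q < slope (\<lambda>x. \<omega>' x - a x) (x, y)"
        using d by (simp add: slope_def less_max_iff_disj pos_less_divide_eq)
    qed (use Nq in auto)
  qed
  then obtain e where e: "e > 0" "\<And>\<omega>'::'d env. norm (\<omega>' x - \<omega> x) < e \<Longrightarrow> norm (\<omega>' y - \<omega> y) < e \<Longrightarrow> q < slope (\<lambda>x. \<omega>' x - a x) (x, y)"
    by blast
  \<comment> \<open>\<open>lu_open\<close> demands a positive radius and \<open>K\<close> may be
    \<open>0\<close>, whence \<open>K + 1\<close>.\<close>
  have "\<omega>' \<in> ?U" if "\<omega>' \<in> OmegaSet lam Lam" "\<forall>x\<in>cball 0 (real K + 1). norm (\<omega>' x - \<omega> x) < e" for \<omega>'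
  proof -
    have "q < slope (\<lambda>x. \<omega>' x - a x) (x, y)" using e(2)[of \<omega>'] that(2) xy(1,2) by simp
    moreover have "(x, y) \<in> cball 0 (real K) \<times> cball 0 (real K)" using xy by simp
    ultimately show ?thesis using that(1) by blast
  qed
  moreover have "0 < real K + 1" by simp
  ultimately show "\<exists>R>0. \<exists>\<epsilon>>0. \<forall>\<omega>'\<in>OmegaSet lam Lam. (\<forall>x\<in>cball 0 R. norm (\<omega>' x - \<omega> x) < \<epsilon>) \<longrightarrow> \<omega>' \<in> ?U"
    using e(1) by blast
qed auto

section \<open>Local test functions\<close>

type_synonym ('e, 'v) bump_data = "('e \<Rightarrow> 'v) \<times> nat \<times> real \<times> real"

text \<open>A tent of height \<open>c\<close> over the \<open>c1norm K\<close> ball of radius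
  \<open>q\<close> around \<open>a\<close>. Keeping its parameters as data makes countability of a
  family of test functions a matter of tuples.\<close>

fun bump :: "('e::euclidean_space, 'v::euclidean_space) bump_data \<Rightarrow> ('e \<Rightarrow> 'v) \<Rightarrow> real" where
  "bump (a, K, q, c) f = c * max 0 (1 - c1norm K (\<lambda>x. f x - a x) / q)"

declare bump.simps [simp del]

fun valid_bump :: "('e::euclidean_space, 'v::euclidean_space) bump_data \<Rightarrow> bool" where
  "valid_bump (a, K, q, c) \<longleftrightarrow> a \<in> C1_maps \<and> q > 0 \<and> c \<ge> 0"

text \<open>The value \<open>0\<close> on the empty list keeps all maxima nonnegative, like the
  functions they approximate from below.\<close>

primrec max_bumps :: "('e::euclidean_space, 'v::euclidean_space) bump_data list \<Rightarrow> ('e \<Rightarrow> 'v) \<Rightarrow> real" where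
  "max_bumps [] f = 0"
| "max_bumps (p # ps) f = max (bump p f) (max_bumps ps f)"

lemma max_bumps_nonneg: "0 \<le> max_bumps ps f"
  by (induction ps) (auto simp: le_max_iff_disj)

lemma max_bumps_le_iff: "max_bumps ps f \<le> u \<longleftrightarrow> 0 \<le> u \<and> (\<forall>p\<in>set ps. bump p f \<le> u)"
  by (induction ps) auto

lemma bump_le_max_bumps: "p \<in> set ps \<Longrightarrow> bump p f \<le> max_bumps ps f"
  using max_bumps_le_iff[of ps f "max_bumps ps f"] by simp

lemma bump_le:
  assumes "valid_bump (a, K, q, c)" "f \<in> C1_maps"
  shows "bump (a, K, q, c) f \<le> c"
proof -
  have "0 \<le> c1norm K (\<lambda>x. f x - a x) / q"
    using assms by (intro divide_nonneg_nonneg c1norm_nonneg C1_maps_diff) auto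
  then have "max 0 (1 - c1norm K (\<lambda>x. f x - a x) / q) \<le> 1" by simp
  then show ?thesis using assms(1) by (simp add: bump.simps mult_left_le)
qed

lemma max_bumps_bounded:
  assumes "\<forall>p\<in>set ps. valid_bump p"
  obtains B where "B \<ge> 0" "\<And>f. f \<in> C1_maps \<Longrightarrow> \<bar>max_bumps ps f\<bar> \<le> B"
proof -
  have "\<exists>B\<ge>0. \<forall>f\<in>C1_maps. max_bumps ps f \<le> B"
    using assms
  proof (induction ps)
    case (Cons p ps)
    then obtain B where B: "B \<ge> 0" "\<forall>f\<in>C1_maps. max_bumps ps f \<le> B" by auto
    obtain a K q c where p: "p = (a, K, q, c)" by (metis surj_pair)
    have "\<forall>f\<in>C1_maps. bump p f \<le> c" using bump_le[of a K q c] Cons.prems unfolding p by simp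
    then have "\<forall>f\<in>C1_maps. max_bumps (p # ps) f \<le> max c B"
      unfolding max_bumps.simps using B(2) by (blast intro: max.mono)
    then show ?case using B(1) by (intro exI[of _ "max c B"]) (simp add: max.coboundedI2)
  qed auto
  then show ?thesis using that max_bumps_nonneg by (metis abs_of_nonneg)
qed

lemma max_bumps_orbit_continuous:
  assumes "\<forall>p\<in>set ps. valid_bump p" "f \<in> C1_maps"
  shows "continuous_on UNIV (\<lambda>y. max_bumps ps (\<lambda>x. f (y + x)))"
  using assms(1)
proof (induction ps)
  case (Cons p ps)
  obtain a K q c where p: "p = (a, K, q, c)" by (metis surj_pair)
  then have "a \<in> C1_maps" "q > 0" using Cons.prems by auto
  then have "continuous_on UNIV (\<lambda>y. bump p (\<lambda>x. f (y + x)))"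
    unfolding p bump.simps by (intro continuous_intros c1norm_shift_continuous assms) auto
  then show ?case using Cons by (auto intro!: continuous_intros)
qed simp

text \<open>A list mentions finitely many radii, and their maximum serves as \<open>L\<close>.
  Periodization thus leaves the value unchanged at orbit points away from the boundary of the
  cube.\<close>

lemma max_bumps_local:
  obtains L :: nat where "\<And>f g. (\<And>x. x \<in> cball 0 (real L) \<Longrightarrow> f x = g x) \<Longrightarrow> max_bumps ps f = max_bumps ps g"
proof -
  have "\<exists>L::nat. \<forall>f g. (\<forall>x\<in>cball 0 (real L). f x = g x) \<longrightarrow> max_bumps ps f = max_bumps ps g"
  proof (induction ps)
    case (Cons p ps)
    then obtain L :: nat where L: "\<forall>f g. (\<forall>x\<in>cball 0 (real L). f x = g x) \<longrightarrow> max_bumps ps f = max_bumps ps g" by auto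
    obtain a K q c where p: "p = (a, K, q, c)" by (metis surj_pair)
    show ?case
    proof (intro exI[of _ "max L K"] allI impI)
      fix f g :: "'a \<Rightarrow> 'b" assume fg: "\<forall>x\<in>cball 0 (real (max L K)). f x = g x"
      then have "max_bumps ps f = max_bumps ps g" by (intro L[rule_format]) auto
      moreover have "c1norm K (\<lambda>x. f x - a x) = c1norm K (\<lambda>x. g x - a x)"
        using fg by (intro c1norm_cong) auto
      ultimately show "max_bumps (p # ps) f = max_bumps (p # ps) g" by (simp add: p bump.simps)
    qed
  qed auto
  then show ?thesis using that by blast
qed

text \<open>Continuity for the topology of all \<open>c1norm K\<close> together; one
  \<open>K\<close> per neighbourhood is enough because these norms increase with
  \<open>K\<close>.\<close>

definition c1_continuous_on :: "('e::euclidean_space \<Rightarrow> 'v::euclidean_space) set \<Rightarrow> (('e \<Rightarrow> 'v) \<Rightarrow> real) \<Rightarrow> bool" where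
  "c1_continuous_on S F \<longleftrightarrow> (\<forall>f\<in>S. \<forall>e>0. \<exists>K. \<exists>d>0. \<forall>g\<in>S. c1norm K (\<lambda>x. g x - f x) < d \<longrightarrow> \<bar>F g - F f\<bar> < e)"

text \<open>Near \<open>f\<close> the function \<open>F\<close> stays above some \<open>c\<close>
  slightly below \<open>F f\<close>. A tent of height \<open>c\<close> supported in that
  neighbourhood lies below \<open>F\<close>, and it is almost \<open>c\<close> at \<open>f\<close>
  if its centre is close to \<open>f\<close> relative to its radius. Height and radius come from
  countable sets.\<close>

lemma bump_below:
  fixes S A :: "('e::euclidean_space \<Rightarrow> 'v::euclidean_space) set"
  assumes S: "S \<subseteq> C1_maps" and A: "A \<subseteq> S"
    and dense: "\<And>f K e. f \<in> S \<Longrightarrow> e > 0 \<Longrightarrow> \<exists>a\<in>A. c1norm K (\<lambda>x. f x - a x) < e"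
    and F: "\<And>f. f \<in> S \<Longrightarrow> 0 \<le> F f" "c1_continuous_on S F" and f: "f \<in> S" and e: "e > 0"
  obtains a K m c where "a \<in> A" "c \<in> \<rat>" "c \<ge> 0" "F f - e < bump (a, K, 1 / real (Suc m), c) f"
    "\<And>g. g \<in> S \<Longrightarrow> bump (a, K, 1 / real (Suc m), c) g \<le> F g"
proof (cases "F f < e")
  \<comment> \<open>A bump of height \<open>0\<close> already exceeds the negative number
    \<open>F f - e\<close>, so any centre in \<open>A\<close> will do.\<close>
  case True
  obtain a where "a \<in> A" using dense[OF f zero_less_one] by blast
  then show ?thesis using True F(1) by (intro that[of a 0 0 0]) (auto simp: bump.simps)
next
  case False
  obtain K d where d: "d > 0" "\<And>g. g \<in> S \<Longrightarrow> c1norm K (\<lambda>x. g x - f x) < d \<Longrightarrow> \<bar>F g - F f\<bar> < e / 4"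
  proof -
    have "e / 4 > 0" using e by simp
    from F(2)[unfolded c1_continuous_on_def, rule_format, OF f this] show thesis using that by blast
  qed
  \<comment> \<open>The gap of \<open>e / 4\<close> keeps \<open>F\<close> above \<open>c\<close>
    near \<open>f\<close>. The height loses at most \<open>e / 2\<close> and the displaced centre at
    most \<open>e / 4\<close>, in total less than \<open>e\<close>.\<close>
  obtain c where c: "c \<in> \<rat>" "F f - e / 2 < c" "c < F f - e / 4"
    using Rats_dense_in_real[of "F f - e / 2" "F f - e / 4"] e by auto
  have c0: "c > 0" using c False e by linarith
  \<comment> \<open>Half of \<open>d\<close>, since a point of the support of the tent and
    \<open>f\<close> are each within the radius of the centre.\<close>
  obtain m where m: "1 / real (Suc m) < d / 2" using d(1) nat_approx_posE[of "d/2"] by auto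
  define q where "q = 1 / real (Suc m)"
  have q: "q > 0" "2 * q < d" using m by (auto simp: q_def)
  \<comment> \<open>The offset of the centre as a fraction of the radius: the tent loses at most
    \<open>c * \<eta>\<close> at \<open>f\<close>.\<close>
  define \<eta> where "\<eta> = min 1 (e / (4 * c))"
  have \<eta>: "\<eta> > 0" "\<eta> \<le> 1" "c * \<eta> \<le> e / 4"
    using e c0 by (auto simp: \<eta>_def min_def field_simps)
  obtain a where a: "a \<in> A" "c1norm K (\<lambda>x. f x - a x) < q * \<eta>"
    using dense[OF f, of "q * \<eta>" K] q \<eta> by auto
  have aS: "a \<in> C1_maps" using a A S by auto
  show ?thesis
  proof (rule that[of a c K m])
    have "c1norm K (\<lambda>x. f x - a x) / q \<le> \<eta>" using a(2) q by (simp add: divide_le_eq mult.commute)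
    then have "c * (1 - \<eta>) \<le> c * max 0 (1 - c1norm K (\<lambda>x. f x - a x) / q)"
      using c0 by (intro mult_left_mono) auto
    then have "c - e / 4 \<le> bump (a, K, q, c) f" using \<eta>(3) by (simp add: bump.simps right_diff_distrib)
    then show "F f - e < bump (a, K, 1 / real (Suc m), c) f" using c e by (simp add: q_def)
    fix g assume g: "g \<in> S"
    show "bump (a, K, 1 / real (Suc m), c) g \<le> F g"
    proof (cases "c1norm K (\<lambda>x. g x - a x) < q")
      case True
      have "c1norm K (\<lambda>x. g x - f x) \<le> c1norm K (\<lambda>x. g x - a x) + c1norm K (\<lambda>x. a x - f x)"
        using g f S aS by (intro c1norm_triangle) auto
      also have "c1norm K (\<lambda>x. a x - f x) < q * \<eta>" using a(2) c1norm_minus_commute[of K a f] by simp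
      also have "q * \<eta> \<le> q" using q \<eta> by (simp add: mult_left_le)
      finally have "c1norm K (\<lambda>x. g x - f x) < d" using True q(2) by linarith
      then have "c < F g" using d(2)[OF g] c by linarith
      moreover have "bump (a, K, q, c) g \<le> c" using aS q c0 g S by (intro bump_le) auto
      ultimately show ?thesis by (simp add: q_def)
    next
      case False
      then have "bump (a, K, q, c) g = 0" using q(1) by (simp add: bump.simps max_def le_divide_eq)
      then show ?thesis using F(1)[OF g] by (simp add: q_def)
    qed
  qed (use a c c0 in auto)
qed

text \<open>One countable family serves all \<open>F\<close> simultaneously. This order of choices
  lets the periodic environments be fixed before the test function.\<close>

lemma bump_approximation:
  fixes S :: "('e::euclidean_space \<Rightarrow> 'v::euclidean_space) set"
  assumes S: "S \<subseteq> C1_maps"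
  obtains Z where "countable Z" "\<And>p. p \<in> Z \<Longrightarrow> valid_bump p"
    "\<And>F. (\<And>f. f \<in> S \<Longrightarrow> 0 \<le> F f) \<Longrightarrow> c1_continuous_on S F \<Longrightarrow>
      \<exists>ps. (\<forall>n::nat. ps n \<in> lists Z) \<and> (\<forall>n. \<forall>f\<in>S. max_bumps (ps n) f \<le> F f)
        \<and> (\<forall>f\<in>S. (\<lambda>n. max_bumps (ps n) f) \<longlonglongrightarrow> F f)"
proof -
  obtain A where A: "A \<subseteq> S" "countable A"
    "\<And>f K e. f \<in> S \<Longrightarrow> e > 0 \<Longrightarrow> \<exists>a\<in>A. c1norm K (\<lambda>x. f x - a x) < e"
    using c1norm_separable[OF S] by metis
  define Z where "Z = A \<times> (UNIV :: nat set) \<times> (range (\<lambda>m. 1 / real (Suc m)) :: real set) \<times> (\<rat> \<inter> {0..} :: real set)"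
  show ?thesis
  proof (rule that[of Z])
    show "countable Z" unfolding Z_def using A(2) countable_rat by (intro countable_SIGMA countable_Int1) auto
    show "valid_bump p" if "p \<in> Z" for p using that A(1) S by (auto simp: Z_def)
    fix F assume F: "\<And>f. f \<in> S \<Longrightarrow> 0 \<le> F f" "c1_continuous_on S F"
    \<comment> \<open>The selection depends on \<open>F\<close>; the family \<open>Z\<close> does
      not.\<close>
    define P where "P = {p \<in> Z. \<forall>f\<in>S. bump p f \<le> F f}"
    have cP: "countable P" unfolding P_def using \<open>countable Z\<close> by (rule countable_subset[rotated]) auto
    \<comment> \<open>The prefixes of an enumeration of \<open>P\<close>. The empty case is separate
      because \<open>from_nat_into\<close> then returns no element of \<open>P\<close>.\<close>
    define ps where "ps n = (if P = {} then [] else map (from_nat_into P) [0..<n])" for n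
    have psP: "set (ps n) \<subseteq> P" for n unfolding ps_def by (auto intro: from_nat_into)
    show "\<exists>ps. (\<forall>n::nat. ps n \<in> lists Z) \<and> (\<forall>n. \<forall>f\<in>S. max_bumps (ps n) f \<le> F f)
        \<and> (\<forall>f\<in>S. (\<lambda>n. max_bumps (ps n) f) \<longlonglongrightarrow> F f)"
    proof (intro exI[of _ ps] conjI allI ballI)
      show "ps n \<in> lists Z" for n using psP[of n] by (auto simp: P_def)
      show le: "max_bumps (ps n) f \<le> F f" if "f \<in> S" for n f
        unfolding max_bumps_le_iff using psP[of n] F(1)[OF that] that by (auto simp: P_def)
      fix f assume f: "f \<in> S"
      show "(\<lambda>n. max_bumps (ps n) f) \<longlonglongrightarrow> F f"
      proof (rule order_tendstoI)
        fix u assume "u < F f"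
        then have e: "0 < F f - u" by simp
        obtain a K m c where p: "a \<in> A" "c \<in> \<rat>" "c \<ge> 0" "F f - (F f - u) < bump (a, K, 1 / real (Suc m), c) f"
          "\<And>g. g \<in> S \<Longrightarrow> bump (a, K, 1 / real (Suc m), c) g \<le> F g"
          by (rule bump_below[OF S A(1,3) F f e]) blast+
        define p where "p = (a, K, 1 / real (Suc m), c)"
        have pP: "p \<in> P" using p by (auto simp: P_def Z_def p_def)
        then obtain j where j: "from_nat_into P j = p" using cP from_nat_into_surj by metis
        have "u < max_bumps (ps n) f" if "n \<ge> Suc j" for n
        proof -
          have "p \<in> set (ps n)" using pP j that by (auto simp: ps_def)
          then show ?thesis using bump_le_max_bumps[of p "ps n" f] p(4) by (simp add: p_def)
        qed
        then show "\<forall>\<^sub>F n in sequentially. u < max_bumps (ps n) f" unfolding eventually_sequentially by blast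
      next
        fix u assume "F f < u"
        then show "\<forall>\<^sub>F n in sequentially. max_bumps (ps n) f < u"
          by (intro always_eventually allI le_less_trans[OF le[OF f]])
      qed
    qed
  qed
qed

section \<open>Approximation by periodic environments\<close>

lemma bdd_dr_cont_imp_c1_continuous:
  fixes F :: "('d::finite) env \<Rightarrow> real"
  assumes F: "bdd_dr_cont S F" and S: "S \<subseteq> C1_maps"
  shows "c1_continuous_on S F"
  unfolding c1_continuous_on_def
proof (intro ballI allI impI)
  fix f and e :: real assume f: "f \<in> S" and e: "e > 0"
  obtain d where d: "d > 0" "\<And>g. g \<in> S \<Longrightarrow> dist_r g f < d \<Longrightarrow> \<bar>F g - F f\<bar> < e"
    using F f e unfolding bdd_dr_cont_def by meson
  \<comment> \<open>Half of \<open>d\<close> goes to the tail in \<open>dist_r_le\<close>, the other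
    half to \<open>2 * c1norm (Suc K)\<close>; hence \<open>d / 4\<close> below.\<close>
  obtain K where K: "(1/2) ^ K < d / 2" using real_arch_pow_inv[of "d/2" "1/2"] d(1) by auto
  have "\<bar>F g - F f\<bar> < e" if g: "g \<in> S" "c1norm (Suc K) (\<lambda>x. g x - f x) < d / 4" for g
  proof (rule d(2)[OF g(1)])
    have "dist_r g f \<le> 2 * c1norm (Suc K) (\<lambda>x. g x - f x) + (1/2) ^ K"
      using f g(1) S by (intro dist_r_le) auto
    then show "dist_r g f < d" using g(2) K by linarith
  qed
  then show "\<exists>K. \<exists>d>0. \<forall>g\<in>S. c1norm K (\<lambda>x. g x - f x) < d \<longrightarrow> \<bar>F g - F f\<bar> < e"
    using d(1) by (intro exI[of _ "Suc K"] exI[of _ "d / 4"]) auto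
qed

lemma c1_continuous_orbit:
  fixes F :: "('d::finite) env \<Rightarrow> real"
  assumes F: "c1_continuous_on (OmegaR lam Lam r) F" and \<omega>: "\<omega> \<in> OmegaR lam Lam r"
  shows "continuous_on UNIV (\<lambda>y. F (shift y \<omega>))"
proof (intro continuous_at_imp_continuous_on ballI)
  fix y0
  have C1: "\<omega> \<in> C1_maps" using \<omega> OmegaR_subset_C1 by blast
  have "((\<lambda>y. F (shift y \<omega>)) \<longlongrightarrow> F (shift y0 \<omega>)) (at y0)"
  proof (rule tendstoI)
    fix e :: real assume e: "e > 0"
    obtain K d where d: "d > 0"
      "\<forall>g\<in>OmegaR lam Lam r. c1norm K (\<lambda>x. g x - shift y0 \<omega> x) < d \<longrightarrow> \<bar>F g - F (shift y0 \<omega>)\<bar> < e"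
      using F[unfolded c1_continuous_on_def, rule_format, OF OmegaR_shift[OF \<omega>, of y0] e] by blast
    from order_tendstoD(2)[OF c1norm_shift_tendsto[OF C1, of K y0] d(1)]
    show "\<forall>\<^sub>F y in at y0. dist (F (shift y \<omega>)) (F (shift y0 \<omega>)) < e"
    proof eventually_elim
      case (elim y)
      then show ?case using d(2)[rule_format, OF OmegaR_shift[OF \<omega>, of y]] by (simp add: shift_def dist_real_def)
    qed
  qed
  then show "isCont (\<lambda>y. F (shift y \<omega>)) y0" by (simp add: isCont_def)
qed

lemma periodic_avg_eq:
  fixes \<omega> :: "('d::finite) env"
  assumes "M > 0" "(\<lambda>y. F (shift y \<omega>)) \<in> borel_measurable borel"
  shows "periodic_avg M \<omega> F = (\<integral>y. F (shift y \<omega>) \<partial>unif M)"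
  by (simp only: periodic_avg_def integral_unif[OF assms] cube_def DIM_cart DIM_real mult_1_right)

text \<open>The restriction to \<open>OmegaR\<close> supplies the C1 hypothesis of
  \<open>c1norm_greater_iff\<close>; there the superlevel sets are traces of locally uniformly open
  sets.\<close>

lemma c1norm_measurable:
  fixes \<mu> :: "('d::finite) env measure"
  assumes sets: "sets \<mu> = sets (OmegaBorel lam Lam)" and a: "a \<in> C1_maps"
  shows "(\<lambda>\<omega>. c1norm K (\<lambda>x. \<omega> x - a x)) \<in> borel_measurable (restrict_space \<mu> (OmegaR lam Lam r))"
  unfolding borel_measurable_iff_greater
proof
  fix q
  let ?U = "{\<omega> \<in> OmegaSet lam Lam. \<exists>p\<in>cball 0 (real K) \<times> cball 0 (real K). q < slope (\<lambda>x. \<omega> x - a x) p}"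
  have sp: "space (restrict_space \<mu> (OmegaR lam Lam r)) = OmegaR lam Lam r"
  proof -
    have "space \<mu> = OmegaSet lam Lam" using sets_eq_imp_space_eq[OF sets] by (simp only: space_OmegaBorel)
    moreover have "OmegaR lam Lam r \<subseteq> OmegaSet lam Lam" unfolding OmegaR_def by (rule Collect_restrict)
    ultimately show ?thesis unfolding space_restrict_space by (metis Int_absorb2)
  qed
  have "{\<omega> \<in> OmegaR lam Lam r. q < c1norm K (\<lambda>x. \<omega> x - a x)} = OmegaR lam Lam r \<inter> ?U"
  proof -
    have "q < c1norm K (\<lambda>x. \<omega> x - a x) \<longleftrightarrow> (\<exists>p\<in>cball 0 (real K) \<times> cball 0 (real K). q < slope (\<lambda>x. \<omega> x - a x) p)"
      if "\<omega> \<in> OmegaR lam Lam r" for \<omega>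
      by (rule c1norm_greater_iff[OF C1_maps_diff[OF subsetD[OF OmegaR_subset_C1 that] a]])
    moreover have "OmegaR lam Lam r \<subseteq> OmegaSet lam Lam" unfolding OmegaR_def by (rule Collect_restrict)
    ultimately show ?thesis by blast
  qed
  also have "\<dots> \<in> sets (restrict_space \<mu> (OmegaR lam Lam r))"
  proof -
    have "?U \<in> sets \<mu>" unfolding sets by (rule lu_open_sets[OF lu_open_slope_greater])
    then show ?thesis unfolding sets_restrict_space by (rule imageI)
  qed
  finally show "{\<omega> \<in> space (restrict_space \<mu> (OmegaR lam Lam r)). q < c1norm K (\<lambda>x. \<omega> x - a x)}
      \<in> sets (restrict_space \<mu> (OmegaR lam Lam r))" unfolding sp .
qed

lemma max_bumps_measurable:
  fixes \<mu> :: "('d::finite) env measure"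
  assumes sets: "sets \<mu> = sets (OmegaBorel lam Lam)" and S: "OmegaR lam Lam r \<in> sets \<mu>"
    and ps: "\<forall>p\<in>set ps. valid_bump p"
  shows "(\<lambda>\<omega>. indicator (OmegaR lam Lam r) \<omega> * max_bumps ps \<omega>) \<in> borel_measurable \<mu>"
proof -
  have "max_bumps ps \<in> borel_measurable (restrict_space \<mu> (OmegaR lam Lam r))"
    using ps
  proof (induction ps)
    case (Cons p ps)
    obtain a K q c where p: "p = (a, K, q, c)" by (metis surj_pair)
    then have "a \<in> C1_maps" using Cons.prems by auto
    note [measurable] = c1norm_measurable[OF sets this]
    have "bump p \<in> borel_measurable (restrict_space \<mu> (OmegaR lam Lam r))"
      unfolding p bump.simps[abs_def] by measurable
    moreover have "max_bumps ps \<in> borel_measurable (restrict_space \<mu> (OmegaR lam Lam r))"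
      using Cons by simp
    ultimately show ?case unfolding max_bumps.simps(2)[abs_def] by measurable
  next
    case Nil
    show ?case unfolding max_bumps.simps(1)[abs_def] by (rule borel_measurable_const)
  qed
  moreover have "OmegaR lam Lam r \<inter> space \<mu> \<in> sets \<mu>" by (rule sets.Int[OF S sets.top])
  ultimately show ?thesis by (simp only: borel_measurable_restrict_space_iff real_scaleR_def)
qed

section \<open>The flow of translations and the choice of the periodic environments\<close>

lemma ergodic_flow_shift:
  fixes \<mu> :: "('d::finite) env measure"
  assumes "prob_space \<mu>" and sets: "sets \<mu> = sets (OmegaBorel lam Lam)"
    and inv: "shift_invariant \<mu>" and erg: "shift_ergodic \<mu>"
  shows "ergodic_flow \<mu> shift"
proof -
  interpret prob_space \<mu> by fact
  have m: "shift x \<in> measurable \<mu> \<mu>" for x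
    using shift_measurable[of x lam Lam] measurable_cong_sets[OF sets sets] by simp
  show ?thesis
  proof
    show "distr \<mu> \<mu> (shift x) = \<mu>" for x
      by (rule measure_eqI) (use inv m in \<open>auto simp: emeasure_distr shift_invariant_def\<close>)
    show "prob A = 0 \<or> prob A = 1" if "A \<in> events" "\<And>x. shift x -` A \<inter> space \<mu> = A" for A
    proof -
      have "emeasure \<mu> A = 0 \<or> emeasure \<mu> A = 1" using erg that unfolding shift_ergodic_def by blast
      then show ?thesis by (auto simp: measure_def)
    qed
  qed (auto simp: shift_shift m)
qed

text \<open>A diagonal choice: stage \<open>n\<close> treats the first \<open>n + 1\<close> lists
  with tolerance \<open>1 / (n + 1)\<close>, so every single list is treated from some stage
  on.\<close>

lemma periodic_approximants:
  fixes \<mu> :: "('d::finite) env measure"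
  assumes ps: "prob_space \<mu>" and sets: "sets \<mu> = sets (OmegaBorel lam Lam)"
    and inv: "shift_invariant \<mu>" "shift_ergodic \<mu>"
    and full: "emeasure \<mu> (OmegaR lam Lam r) = 1"
    and Z: "countable Z" "\<And>p. p \<in> Z \<Longrightarrow> valid_bump p"
  obtains \<omega>s :: "nat \<Rightarrow> 'd env" and M :: "nat \<Rightarrow> real"
  where "\<And>n. \<omega>s n \<in> OmegaR lam Lam r" "\<And>n. M n > 0" "strict_mono M" "filterlim M at_top sequentially"
    "\<And>n i. shift (M n *\<^sub>R axis i 1) (\<omega>s n) = \<omega>s n"
    "\<And>ps. ps \<in> lists Z \<Longrightarrow> (\<lambda>n. \<integral>y. max_bumps ps (shift y (\<omega>s n)) \<partial>unif (M n))
       \<longlonglongrightarrow> (\<integral>\<omega>. indicator (OmegaR lam Lam r) \<omega> * max_bumps ps \<omega> \<partial>\<mu>)"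
proof -
  let ?S = "OmegaR lam Lam r"
  interpret ergodic_flow \<mu> shift by (rule ergodic_flow_shift[OF ps sets inv])
  \<comment> \<open>A set outside the \<sigma>-field has \<open>emeasure\<close> zero, so total mass
    one forces measurability.\<close>
  have S: "?S \<in> events" using full emeasure_notin_sets[of ?S \<mu>] by auto
  have AE_S: "AE \<omega> in \<mu>. \<omega> \<in> ?S"
    using prob_eq_1[OF S] full by (simp add: measure_def)
  have bumps_orbit: "continuous_on UNIV (\<lambda>y. max_bumps ps (shift y \<omega>))" if "\<omega> \<in> ?S" "ps \<in> lists Z" for ps \<omega>
    unfolding shift_def by (rule max_bumps_orbit_continuous[OF _ subsetD[OF OmegaR_subset_C1 that(1)]]) (use that(2) Z(2) in blast)
  \<comment> \<open>The empty list makes \<open>lists Z\<close> nonempty, so the enumeration is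
    onto.\<close>
  define en where "en = from_nat_into (lists Z)"
  have en_range: "range en = lists Z"
    unfolding en_def by (rule range_from_nat_into) (use Z(1) in auto)
  then have en: "en i \<in> lists Z" for i by auto
  have env: "\<forall>p\<in>set (en i). valid_bump p" for i using en[of i] Z(2) by auto
  \<comment> \<open>Extension by zero off \<open>OmegaR\<close>: measurable on the whole space, and
    continuous along every orbit because \<open>OmegaR\<close> is invariant.\<close>
  define h where "h i \<omega> = indicator ?S \<omega> * max_bumps (en i) \<omega>" for i and \<omega> :: "'d env"
  have h_meas [measurable]: "h i \<in> borel_measurable \<mu>" for i
    unfolding h_def by (rule max_bumps_measurable[OF sets S env])
  have "\<exists>B. \<forall>\<omega>. \<bar>h i \<omega>\<bar> \<le> B" for i
  proof (rule max_bumps_bounded[OF env[of i]])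
    fix B assume B: "B \<ge> 0" "\<And>f. f \<in> C1_maps \<Longrightarrow> \<bar>max_bumps (en i) f\<bar> \<le> B"
    have "\<bar>h i \<omega>\<bar> \<le> B" for \<omega>
    proof (cases "\<omega> \<in> ?S")
      case True
      then show ?thesis using B(2)[OF subsetD[OF OmegaR_subset_C1 True]] by (simp add: h_def)
    qed (simp add: h_def B(1))
    then show ?thesis by blast
  qed
  then obtain B where hB: "\<And>i \<omega>. \<bar>h i \<omega>\<bar> \<le> B i" by metis
  have h_orbit: "h i (shift y \<omega>) = indicator ?S \<omega> * max_bumps (en i) (shift y \<omega>)" for i y \<omega>
    by (simp add: h_def indicator_def OmegaR_shift_iff)
  have h_cont: "continuous_on UNIV (\<lambda>y. h i (shift y \<omega>))" for i \<omega>
    unfolding h_orbit using bumps_orbit[OF _ en[of i], of \<omega>] by (cases "\<omega> \<in> ?S") auto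
  have om: "orbit_measurable (h i)" for i
    by (rule orbit_measurable_continuous[OF h_meas h_cont])
  have erg: "(\<lambda>N. expectation (\<lambda>\<omega>. \<bar>avg (real N) (h i) \<omega> - expectation (h i)\<bar>)) \<longlonglongrightarrow> 0" for i
    by (rule mean_ergodic[OF om hB])
  have "\<exists>N0. \<forall>N\<ge>N0. (\<Sum>i\<le>n. expectation (\<lambda>\<omega>. \<bar>avg (real N) (h i) \<omega> - expectation (h i)\<bar>)) < 1 / real (Suc n)" for n
  proof -
    have "(\<lambda>N. \<Sum>i\<le>n. expectation (\<lambda>\<omega>. \<bar>avg (real N) (h i) \<omega> - expectation (h i)\<bar>)) \<longlonglongrightarrow> (\<Sum>i\<le>n. 0)"
      by (intro tendsto_sum erg)
    from order_tendstoD(2)[OF this, of "1 / real (Suc n)"] show ?thesis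
      by (simp add: eventually_sequentially)
  qed
  from choice[OF allI, OF this]
  obtain N0 where N0: "\<forall>n. \<forall>N\<ge>N0 n.
      (\<Sum>i\<le>n. expectation (\<lambda>\<omega>. \<bar>avg (real N) (h i) \<omega> - expectation (h i)\<bar>)) < 1 / real (Suc n)" ..
  \<comment> \<open>The sum dominates each \<open>N0 n\<close> and increases strictly; the summand
    \<open>3\<close> ensures the side length above \<open>2\<close> that
    \<open>periodization\<close> requires.\<close>
  define N where "N n = (\<Sum>i\<le>n. N0 i + 3)" for n
  have N_Suc: "N (Suc n) = N n + (N0 (Suc n) + 3)" for n by (simp add: N_def)
  have N_ge: "N0 n + 3 \<le> N n" for n unfolding N_def by (rule member_le_sum) auto
  have N_gt: "n \<le> N n" for n
  proof (induction n)
    case (Suc n)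
    then show ?case by (simp add: N_Suc)
  qed simp
  define M where "M n = real (N n)" for n
  have M3: "M n > 2" for n using N_ge[of n] by (simp add: M_def)
  have M_mono: "strict_mono M" unfolding strict_mono_Suc_iff by (simp add: M_def N_Suc)
  have M_top: "filterlim M at_top sequentially"
    by (rule filterlim_at_top_mono[OF filterlim_real_sequentially]) (use N_gt in \<open>simp add: M_def\<close>)
  have om_avg: "orbit_measurable (avg (M n) (h i))" for n i
    using M3[of n] by (intro orbit_measurable_avg om) auto
  \<comment> \<open>If almost every environment had total error at least \<open>1 / (n + 1)\<close>,
    so would the expectation, against the choice of \<open>N0\<close>.\<close>
  have "\<exists>\<omega>. \<omega> \<in> ?S \<and> (\<Sum>i\<le>n. \<bar>avg (M n) (h i) \<omega> - expectation (h i)\<bar>) < 1 / real (Suc n)" for n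
  proof (rule ccontr)
    let ?D = "\<lambda>\<omega>. \<Sum>i\<le>n. \<bar>avg (M n) (h i) \<omega> - expectation (h i)\<bar>"
    assume "\<not> (\<exists>\<omega>. \<omega> \<in> ?S \<and> ?D \<omega> < 1 / real (Suc n))"
    then have ge: "AE \<omega> in \<mu>. 1 / real (Suc n) \<le> ?D \<omega>"
      using AE_S by (auto elim!: eventually_mono simp: not_less)
    have i: "integrable \<mu> (\<lambda>\<omega>. \<bar>avg (M n) (h i) \<omega> - expectation (h i)\<bar>)" for i
    proof -
      have "integrable \<mu> (avg (M n) (h i))"
        by (rule integrable_orbit_bounded[OF om_avg avg_bound[OF om _ _ hB]]) (use M3[of n] in auto)
      then show ?thesis by simp
    qed
    have "1 / real (Suc n) \<le> expectation ?D"
      by (rule integral_ge_const[OF Bochner_Integration.integrable_sum[OF i] ge])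
    also have "\<dots> = (\<Sum>i\<le>n. expectation (\<lambda>\<omega>. \<bar>avg (M n) (h i) \<omega> - expectation (h i)\<bar>))"
      by (rule Bochner_Integration.integral_sum[OF i])
    also have "\<dots> < 1 / real (Suc n)" unfolding M_def using N_ge[of n] by (intro N0[rule_format]) auto
    finally show False by simp
  qed
  from choice[OF allI, OF this]
  obtain w where "\<forall>n. w n \<in> ?S \<and> (\<Sum>i\<le>n. \<bar>avg (M n) (h i) (w n) - expectation (h i)\<bar>) < 1 / real (Suc n)" ..
  then have w: "w n \<in> ?S" "(\<Sum>i\<le>n. \<bar>avg (M n) (h i) (w n) - expectation (h i)\<bar>) < 1 / real (Suc n)" for n
    by simp_all
  have "\<exists>v. v \<in> ?S \<and> (\<forall>i. shift (M n *\<^sub>R axis i 1) v = v) \<and>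
     (\<forall>y K. \<forall>x\<in>cball 0 (real K). y \<in> cube (M n - 2 * (real K + 1)) \<longrightarrow> shift y v x = shift y (w n) x)" for n
    by (rule periodization[OF w(1)[of n] M3[of n]]) blast
  from choice[OF allI, OF this]
  obtain v where "\<forall>n. v n \<in> ?S \<and> (\<forall>i. shift (M n *\<^sub>R axis i 1) (v n) = v n) \<and>
     (\<forall>y K. \<forall>x\<in>cball 0 (real K). y \<in> cube (M n - 2 * (real K + 1)) \<longrightarrow> shift y (v n) x = shift y (w n) x)" ..
  then have v: "v n \<in> ?S" "shift (M n *\<^sub>R axis i 1) (v n) = v n"
    "x \<in> cball 0 (real K) \<Longrightarrow> y \<in> cube (M n - 2 * (real K + 1)) \<Longrightarrow> shift y (v n) x = shift y (w n) x" for n i K x y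
    by blast+
  have lim: "(\<lambda>n. \<integral>y. h i (shift y (v n)) \<partial>unif (M n)) \<longlonglongrightarrow> expectation (h i)" for i
  proof -
    obtain L :: nat where L: "\<And>f g :: 'd env. (\<And>x. x \<in> cball 0 (real L) \<Longrightarrow> f x = g x) \<Longrightarrow> max_bumps (en i) f = max_bumps (en i) g"
      using max_bumps_local[of "en i"] by metis
    \<comment> \<open>The first term is the cost of periodization, with the margin for radius
      \<open>L\<close>. The second bounds the ergodic error, which is part of the controlled sum
      once \<open>n\<close> is at least \<open>i\<close>.\<close>
    let ?e = "\<lambda>n. 2 * B i * boundary_frac CARD('d) (real L + 1) (M n) + 1 / real (Suc n)"
    have "(\<lambda>n. (\<integral>y. h i (shift y (v n)) \<partial>unif (M n)) - expectation (h i)) \<longlonglongrightarrow> 0"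
    proof (rule Lim_null_comparison)
      have "\<forall>\<^sub>F n in sequentially. M n \<ge> 2 * (real L + 1)" using M_top by (simp add: filterlim_at_top)
      then show "\<forall>\<^sub>F n in sequentially. norm ((\<integral>y. h i (shift y (v n)) \<partial>unif (M n)) - expectation (h i)) \<le> ?e n"
        using eventually_ge_at_top[of i]
      proof eventually_elim
        case (elim n)
        have "\<bar>(\<integral>y. h i (shift y (v n)) \<partial>unif (M n)) - (\<integral>y. h i (shift y (w n)) \<partial>unif (M n))\<bar>
            \<le> 2 * B i * boundary_frac DIM(real^'d) (real L + 1) (M n)"
        proof (rule unif_integral_agree)
          fix y :: "real^'d" assume "y \<in> cube (M n - 2 * (real L + 1))"
          then have "max_bumps (en i) (shift y (v n)) = max_bumps (en i) (shift y (w n))"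
            by (intro L v(3))
          then show "h i (shift y (v n)) = h i (shift y (w n))"
            unfolding h_orbit using v(1) w(1) by simp
        qed (use M3[of n] elim(1) hB h_cont in \<open>auto intro: borel_measurable_continuous_onI\<close>)
        moreover have "\<bar>avg (M n) (h i) (w n) - expectation (h i)\<bar> \<le> (\<Sum>i\<le>n. \<bar>avg (M n) (h i) (w n) - expectation (h i)\<bar>)"
          using elim(2) by (intro member_le_sum) auto
        ultimately show ?case using w(2)[of n] unfolding avg_def by simp
      qed
      have "(\<lambda>n. 1 / real (Suc n)) \<longlonglongrightarrow> 0" by (rule LIMSEQ_Suc[OF lim_1_over_n])
      then have "?e \<longlonglongrightarrow> 0 + 0"
        by (intro tendsto_add tendsto_mult_right_zero filterlim_compose[OF boundary_frac_tendsto M_top])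
      then show "?e \<longlonglongrightarrow> 0" by simp
    qed
    then show ?thesis by (simp add: LIM_zero_iff)
  qed
  show ?thesis
  proof (rule that[OF v(1) _ M_mono M_top v(2)])
    show "M n > 0" for n using M3[of n] by simp
    fix ps assume "ps \<in> lists Z"
    then obtain i where i: "ps = en i" using en_range by blast
    show "(\<lambda>n. \<integral>y. max_bumps ps (shift y (v n)) \<partial>unif (M n)) \<longlonglongrightarrow> (\<integral>\<omega>. indicator ?S \<omega> * max_bumps ps \<omega> \<partial>\<mu>)"
      using lim[of i] v(1) unfolding h_orbit by (simp add: h_def[abs_def] i)
  qed
qed

text \<open>By dominated convergence one bump maximum below \<open>G\<close> already has integral
  above \<open>a\<close>. Its averages converge by hypothesis, and those of \<open>G\<close> are no
  smaller. The pointwise limit also provides the measurability of \<open>G\<close> on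
  \<open>OmegaR\<close>.\<close>

lemma lower_bound_of_bump_limits:
  fixes \<mu> :: "('d::finite) env measure" and G :: "'d env \<Rightarrow> real"
  assumes "prob_space \<mu>" and sets: "sets \<mu> = sets (OmegaBorel lam Lam)"
    and S: "OmegaR lam Lam r \<in> sets \<mu>" and Z: "\<And>p. p \<in> Z \<Longrightarrow> valid_bump p"
    and \<omega>s: "\<And>n. \<omega>s n \<in> OmegaR lam Lam r" and M: "\<And>n. M n > 0"
    and lim: "\<And>ps. ps \<in> lists Z \<Longrightarrow> (\<lambda>n. \<integral>y. max_bumps ps (shift y (\<omega>s n)) \<partial>unif (M n))
       \<longlonglongrightarrow> (\<integral>\<omega>. indicator (OmegaR lam Lam r) \<omega> * max_bumps ps \<omega> \<partial>\<mu>)"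
    and ps: "\<And>n. ps n \<in> lists Z" "\<And>n \<omega>. \<omega> \<in> OmegaR lam Lam r \<Longrightarrow> max_bumps (ps n) \<omega> \<le> G \<omega>"
      "\<And>\<omega>. \<omega> \<in> OmegaR lam Lam r \<Longrightarrow> (\<lambda>n. max_bumps (ps n) \<omega>) \<longlonglongrightarrow> G \<omega>"
    and G: "\<And>\<omega>. \<omega> \<in> OmegaR lam Lam r \<Longrightarrow> \<bar>G \<omega>\<bar> \<le> B" "c1_continuous_on (OmegaR lam Lam r) G"
  shows "(\<lambda>\<omega>. indicator (OmegaR lam Lam r) \<omega> * G \<omega>) \<in> borel_measurable \<mu>"
    and "a < (\<integral>\<omega>. indicator (OmegaR lam Lam r) \<omega> * G \<omega> \<partial>\<mu>) \<Longrightarrow>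
      \<forall>\<^sub>F n in sequentially. a < (\<integral>y. G (shift y (\<omega>s n)) \<partial>unif (M n))"
proof -
  let ?S = "OmegaR lam Lam r"
  interpret prob_space \<mu> by fact
  have valid: "\<forall>p\<in>set (ps n). valid_bump p" for n using ps(1)[of n] Z by auto
  have hm: "(\<lambda>\<omega>. indicator ?S \<omega> * max_bumps (ps n) \<omega>) \<in> borel_measurable \<mu>" for n
    by (rule max_bumps_measurable[OF sets S valid])
  have conv: "(\<lambda>n. indicator ?S \<omega> * max_bumps (ps n) \<omega>) \<longlonglongrightarrow> indicator ?S \<omega> * G \<omega>" for \<omega>
    using ps(3)[of \<omega>] by (cases "\<omega> \<in> ?S") auto
  show Gm: "(\<lambda>\<omega>. indicator ?S \<omega> * G \<omega>) \<in> borel_measurable \<mu>"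
    by (rule borel_measurable_LIMSEQ_real[OF conv hm])
  assume a: "a < (\<integral>\<omega>. indicator ?S \<omega> * G \<omega> \<partial>\<mu>)"
  have hB: "\<bar>indicator ?S \<omega> * max_bumps (ps n) \<omega>\<bar> \<le> \<bar>B\<bar>" for n \<omega>
    using max_bumps_nonneg[of "ps n" \<omega>] ps(2)[of \<omega> n] G(1)[of \<omega>] by (cases "\<omega> \<in> ?S") auto
  have "(\<lambda>n. \<integral>\<omega>. indicator ?S \<omega> * max_bumps (ps n) \<omega> \<partial>\<mu>) \<longlonglongrightarrow> (\<integral>\<omega>. indicator ?S \<omega> * G \<omega> \<partial>\<mu>)"
    by (rule integral_dominated_convergence[where w = "\<lambda>_. \<bar>B\<bar>", OF Gm hm])
      (use conv hB in \<open>auto simp del: abs_mult\<close>)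
  from eventually_happens'[OF sequentially_bot order_tendstoD(1)[OF this a]]
  obtain m where m: "a < (\<integral>\<omega>. indicator ?S \<omega> * max_bumps (ps m) \<omega> \<partial>\<mu>)" by blast
  have C1: "\<omega>s n \<in> C1_maps" for n by (rule subsetD[OF OmegaR_subset_C1 \<omega>s])
  from order_tendstoD(1)[OF lim[OF ps(1)] m]
  show "\<forall>\<^sub>F n in sequentially. a < (\<integral>y. G (shift y (\<omega>s n)) \<partial>unif (M n))"
  proof eventually_elim
    case (elim n)
    have "(\<integral>y. max_bumps (ps m) (shift y (\<omega>s n)) \<partial>unif (M n)) \<le> (\<integral>y. G (shift y (\<omega>s n)) \<partial>unif (M n))"
    proof (rule Bochner_Integration.integral_mono)
      have "continuous_on UNIV (\<lambda>y. max_bumps (ps m) (shift y (\<omega>s n)))"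
        unfolding shift_def by (rule max_bumps_orbit_continuous[OF valid C1])
      then show "integrable (unif (M n)) (\<lambda>y. max_bumps (ps m) (shift y (\<omega>s n)))"
        using hB[of "shift _ (\<omega>s n)" m] OmegaR_shift[OF \<omega>s[of n]]
        by (intro unif_integrable_bounded[OF M borel_measurable_continuous_onI, of _ "\<bar>B\<bar>"]) auto
      show "integrable (unif (M n)) (\<lambda>y. G (shift y (\<omega>s n)))"
        using c1_continuous_orbit[OF G(2) \<omega>s[of n]] G(1) OmegaR_shift[OF \<omega>s[of n]]
        by (intro unif_integrable_bounded[OF M borel_measurable_continuous_onI, of _ B]) auto
      show "max_bumps (ps m) (shift y (\<omega>s n)) \<le> G (shift y (\<omega>s n))" for y
        by (rule ps(2)[OF OmegaR_shift[OF \<omega>s]])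
    qed
    with elim show ?case by linarith
  qed
qed

theorem theorem3p3:
  fixes lam Lam r :: real and \<mu> :: "('d::finite) env measure"
  assumes "lam > 0" and "Lam > 0"
    and "prob_space \<mu>"
    and "sets \<mu> = sets (OmegaBorel lam Lam)" and "space \<mu> = OmegaSet lam Lam"
    and "shift_invariant \<mu>" and "shift_ergodic \<mu>"
    and "r > 0" and "emeasure \<mu> (OmegaR lam Lam r) = 1"
  shows "\<exists>(\<omega>s :: nat \<Rightarrow> 'd env) (M :: nat \<Rightarrow> real).
     (\<forall>n. \<omega>s n \<in> OmegaR lam Lam r) \<and> (\<forall>n. M n > 0) \<and> strict_mono M \<and> filterlim M at_top sequentially \<and>
     (\<forall>n i. shift (M n *\<^sub>R axis i 1) (\<omega>s n) = \<omega>s n) \<and>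
     (\<forall>F. bdd_dr_cont (OmegaR lam Lam r) F \<longrightarrow>
        (\<lambda>n. periodic_avg (M n) (\<omega>s n) F) \<longlonglongrightarrow>
          (\<integral>\<omega>. indicator (OmegaR lam Lam r) \<omega> * F \<omega> \<partial>\<mu>))"
proof -
  let ?S = "OmegaR lam Lam r :: 'd env set"
  interpret prob_space \<mu> by fact
  \<comment> \<open>\<open>Z\<close> is fixed before the environments, so that one sequence serves
    every \<open>F\<close>.\<close>
  obtain Z where Z: "countable Z" "\<And>p. p \<in> Z \<Longrightarrow> valid_bump p"
    and approx: "\<And>F. (\<And>f. f \<in> ?S \<Longrightarrow> 0 \<le> F f) \<Longrightarrow> c1_continuous_on ?S F \<Longrightarrow>
      \<exists>ps. (\<forall>n::nat. ps n \<in> lists Z) \<and> (\<forall>n. \<forall>f\<in>?S. max_bumps (ps n) f \<le> F f)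
        \<and> (\<forall>f\<in>?S. (\<lambda>n. max_bumps (ps n) f) \<longlonglongrightarrow> F f)"
    by (rule bump_approximation[OF OmegaR_subset_C1]) blast
  obtain \<omega>s :: "nat \<Rightarrow> 'd env" and M :: "nat \<Rightarrow> real"
  where \<omega>s: "\<And>n. \<omega>s n \<in> ?S" and M: "\<And>n. M n > 0" "strict_mono M" "filterlim M at_top sequentially"
    and per: "\<And>n i. shift (M n *\<^sub>R axis i 1) (\<omega>s n) = \<omega>s n"
    and lim: "\<And>ps. ps \<in> lists Z \<Longrightarrow> (\<lambda>n. \<integral>y. max_bumps ps (shift y (\<omega>s n)) \<partial>unif (M n))
       \<longlonglongrightarrow> (\<integral>\<omega>. indicator ?S \<omega> * max_bumps ps \<omega> \<partial>\<mu>)"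
    by (rule periodic_approximants[OF assms(3,4,6,7,9) Z]) blast+
  have S: "?S \<in> events" using assms(9) emeasure_notin_sets[of ?S \<mu>] by auto
  have pS: "(\<integral>\<omega>. indicator ?S \<omega> \<partial>\<mu>) = (1::real)"
    using S assms(9) by (simp add: measure_def)
  have "(\<lambda>n. periodic_avg (M n) (\<omega>s n) F) \<longlonglongrightarrow> (\<integral>\<omega>. indicator ?S \<omega> * F \<omega> \<partial>\<mu>)"
    if F: "bdd_dr_cont ?S F" for F
  proof -
    obtain B where B: "\<And>\<omega>. \<omega> \<in> ?S \<Longrightarrow> \<bar>F \<omega>\<bar> \<le> B" using F unfolding bdd_dr_cont_def by blast
    have Fc: "c1_continuous_on ?S F" by (rule bdd_dr_cont_imp_c1_continuous[OF F OmegaR_subset_C1])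
    let ?avg = "\<lambda>G n. \<integral>y. G (shift y (\<omega>s n)) \<partial>unif (M n)"
    have orbit: "continuous_on UNIV (\<lambda>y. F (shift y (\<omega>s n)))" for n
      by (rule c1_continuous_orbit[OF Fc \<omega>s])
    have Fi: "integrable (unif (M n)) (\<lambda>y. F (shift y (\<omega>s n)))" for n
      using B[OF OmegaR_shift[OF \<omega>s]]
      by (rule unif_integrable_bounded[OF M(1) borel_measurable_continuous_onI[OF orbit]])
    \<comment> \<open>Adding the bound \<open>B\<close> makes both \<open>F\<close> and its negative
      nonnegative. The sign \<open>s = 1\<close> yields the lower and \<open>s = -1\<close> the
      upper estimate for the averages of \<open>F\<close>.\<close>
    have lower: "(\<lambda>\<omega>. indicator ?S \<omega> * (s * F \<omega> + B)) \<in> borel_measurable \<mu> \<and>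
       (\<forall>a < (\<integral>\<omega>. indicator ?S \<omega> * (s * F \<omega> + B) \<partial>\<mu>). \<forall>\<^sub>F n in sequentially. a < ?avg (\<lambda>\<omega>. s * F \<omega> + B) n)"
      if s: "s = 1 \<or> s = -1" for s
    proof -
      have nonneg: "0 \<le> s * F \<omega> + B" and le: "\<bar>s * F \<omega> + B\<bar> \<le> 2 * B" if "\<omega> \<in> ?S" for \<omega>
        using B[OF that] s by auto
      have "\<bar>s\<bar> = 1" using s by auto
      then have "\<bar>s * F g + B - (s * F f + B)\<bar> = \<bar>F g - F f\<bar>" for f g
        by (simp add: abs_mult flip: right_diff_distrib)
      then have c: "c1_continuous_on ?S (\<lambda>\<omega>. s * F \<omega> + B)"
        using Fc unfolding c1_continuous_on_def by simp
      obtain ps where ps: "\<And>n. ps n \<in> lists Z" "\<And>n \<omega>. \<omega> \<in> ?S \<Longrightarrow> max_bumps (ps n) \<omega> \<le> s * F \<omega> + B"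
        "\<And>\<omega>. \<omega> \<in> ?S \<Longrightarrow> (\<lambda>n. max_bumps (ps n) \<omega>) \<longlonglongrightarrow> s * F \<omega> + B"
        using approx[OF nonneg c] by blast
      note lb = lower_bound_of_bump_limits[OF assms(3,4) S Z(2) \<omega>s M(1) lim ps le c]
      show ?thesis using lb by blast
    qed
    \<comment> \<open>Measurability of \<open>F\<close> on \<open>OmegaR\<close> is recovered from
      that of \<open>F + B\<close>.\<close>
    have "(\<lambda>\<omega>. indicator ?S \<omega> * (1 * F \<omega> + B) - B * indicator ?S \<omega>) \<in> borel_measurable \<mu>"
      by (rule borel_measurable_diff[OF conjunct1[OF lower[OF disjI1[OF refl]]]]) (use S in auto)
    then have Fm: "(\<lambda>\<omega>. indicator ?S \<omega> * F \<omega>) \<in> borel_measurable \<mu>" by (simp add: algebra_simps)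
    have "integrable \<mu> (\<lambda>\<omega>. indicator ?S \<omega> * F \<omega>)"
      by (rule integrable_const_bound[OF _ Fm, of "\<bar>B\<bar>"]) (use B in \<open>force simp: indicator_def\<close>)
    moreover have "integrable \<mu> (\<lambda>\<omega>. B * indicator ?S \<omega>)"
      using S assms(9) by (intro integrable_mult_right integrable_real_indicator) auto
    ultimately have E: "(\<integral>\<omega>. indicator ?S \<omega> * (s * F \<omega> + B) \<partial>\<mu>) = s * (\<integral>\<omega>. indicator ?S \<omega> * F \<omega> \<partial>\<mu>) + B" for s
    proof -
      assume i: "integrable \<mu> (\<lambda>\<omega>. indicator ?S \<omega> * F \<omega>)" "integrable \<mu> (\<lambda>\<omega>. B * indicator ?S \<omega>)"
      have "(\<integral>\<omega>. indicator ?S \<omega> * (s * F \<omega> + B) \<partial>\<mu>)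
          = (\<integral>\<omega>. s * (indicator ?S \<omega> * F \<omega>) + B * indicator ?S \<omega> \<partial>\<mu>)"
        by (simp add: algebra_simps)
      also have "\<dots> = (\<integral>\<omega>. s * (indicator ?S \<omega> * F \<omega>) \<partial>\<mu>) + (\<integral>\<omega>. B * indicator ?S \<omega> \<partial>\<mu>)"
        by (rule Bochner_Integration.integral_add[OF integrable_mult_right[OF i(1)] i(2)])
      also have "\<dots> = s * (\<integral>\<omega>. indicator ?S \<omega> * F \<omega> \<partial>\<mu>) + B"
        by (simp only: integral_mult_right_zero pS mult_1_right)
      finally show ?thesis .
    qed
    have A: "?avg (\<lambda>\<omega>. s * F \<omega> + B) n = s * ?avg F n + B" for s n
    proof -
      interpret U: prob_space "unif (M n) :: (real^'d) measure" by (rule prob_space_unif[OF M(1)])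
      have "?avg (\<lambda>\<omega>. s * F \<omega> + B) n = (\<integral>y. s * F (shift y (\<omega>s n)) \<partial>unif (M n)) + (\<integral>y. B \<partial>(unif (M n) :: (real^'d) measure))"
        by (rule Bochner_Integration.integral_add[OF integrable_mult_right[OF Fi] U.integrable_const])
      then show ?thesis by (simp add: U.prob_space[simplified])
    qed
    have "?avg F \<longlonglongrightarrow> (\<integral>\<omega>. indicator ?S \<omega> * F \<omega> \<partial>\<mu>)"
    proof (rule order_tendstoI)
      fix a assume "a < (\<integral>\<omega>. indicator ?S \<omega> * F \<omega> \<partial>\<mu>)"
      then have "a + B < (\<integral>\<omega>. indicator ?S \<omega> * (1 * F \<omega> + B) \<partial>\<mu>)" unfolding E by simp
      then have "\<forall>\<^sub>F n in sequentially. a + B < ?avg (\<lambda>\<omega>. 1 * F \<omega> + B) n" using lower[of 1] by blast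
      then show "\<forall>\<^sub>F n in sequentially. a < ?avg F n" unfolding A by simp
    next
      fix a assume "(\<integral>\<omega>. indicator ?S \<omega> * F \<omega> \<partial>\<mu>) < a"
      then have "- a + B < (\<integral>\<omega>. indicator ?S \<omega> * (- 1 * F \<omega> + B) \<partial>\<mu>)" unfolding E by simp
      then have "\<forall>\<^sub>F n in sequentially. - a + B < ?avg (\<lambda>\<omega>. - 1 * F \<omega> + B) n" using lower[of "-1"] by blast
      then show "\<forall>\<^sub>F n in sequentially. ?avg F n < a" unfolding A by simp
    qed
    moreover have "periodic_avg (M n) (\<omega>s n) F = ?avg F n" for n
      by (rule periodic_avg_eq[where \<omega> = "\<omega>s n" and F = F, OF M(1) borel_measurable_continuous_onI[OF orbit]])
    ultimately show ?thesis by (simp only:)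
  qed
  with \<omega>s M per show ?thesis
    by (intro exI[of _ \<omega>s] exI[of _ M] conjI allI impI)
qed

end
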